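(* Let $(\Omega,m)$ be a PDE friendly domain, and for $i\in\{0,1\}$ let $\mu_i$ be either an elliptic measure ($\mu_i=\{\omega_i^X\}_{X\in\Omega}$) or a doubling measure ($\mu_i=\sigma_i$) on $\partial\Omega$. If $\mu_1\in A_\infty(\mu_0)$, then for each $f\in L^2_{loc}(\Omega,m)$, $$f\in KCM(\mu_0)\quad\text{if and only if}\quad f\in KCM(\mu_1).$$
   Context: **Notation.** $n\ge2$, $\Omega\subset\mathbb R^n$ open, $\delta(X)=\operatorname{dist}(X,\partial\Omega)$, $B_X=B(X,\delta(X)/4)$; for $x\in\partial\Omega$, $r>0$, $\Delta(x,r)=B(x,r)\cap\partial\Omega$ is a boundary ball. $u_B=m(B)^{-1}\iint_B u\,dm$ for balls $B\subset\Omega$. **The measure $m$.** (i) $dm=w\,dX$ with $0\le w\in L^1_{loc}(\Omega)$; (ii) $m(B(X,2r)\cap\Omega)\le C_m m(B(X,r)\cap\Omega)$ for all $X\in\overline\Omega$, $r>0$; (iii) for every open $D$ compactly contained in $\Omega$ and $\{u_i\}\subset C^\infty(\overline D)$ with $\iint_D|u_i|\,dm\to0$ and $\iint_D|\nabla u_i-v|^2dm\to0$, $v\in L^2(D,m)$ vector-valued, one has $v\equiv0$; (iv) for every ball $B$ of radius $r$ with $2B\subset\Omega$ and $u\in W^{1,2}(B,m)$, $(m(B)^{-1}\iint_B|u-u_B|^2dm)^{1/2}\le C_P r(m(B)^{-1}\iint_B|\nabla u|^2dm)^{1/2}$. By (iii) a gradient is well defined by $L^2$-approximation with smooth functions, and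 $W^{1,2}_{loc}(\Omega,m)$ is the space of $u\in L^2_{loc}(\Omega,m)$ with gradient in $L^2_{loc}(\Omega,m)$. **1-sided NTA.** Corkscrew condition: there is $c_1\in(0,1)$ such that for $x\in\partial\Omega$, $r\in(0,\operatorname{diam}\Omega)$ there is $X$ with $B(X,c_1r)\subset B(x,r)\cap\Omega$. A point $X$ is a Corkscrew point associated to $(x,r)$ if $c_1r/100\le\delta(X)\le|X-x|\le100r$. Harnack chain condition: for every $\Lambda\ge1$ there is $N_\Lambda$ such that if $\delta(X)>r$, $\delta(Y)>r$, $|X-Y|\le\Lambda r$, there are balls $B_1,\dots,B_{N_\Lambda}$ with $X\in B_1$, $Y\in B_{N_\Lambda}$, $2B_i\subset\Omega$, $B_i\cap B_{i+1}\ne\emptyset$. **Operators.** $L=-\operatorname{div}(w\mathcal A\nabla)$, $\mathcal A$ real measurable (not necessarily symmetric), with $\mathcal A\xi\cdot\xi\ge C_L^{-1}|\xi|^2$, $|\mathcal A\xi\cdot\zeta|\le C_L|\xi||\zeta|$ a.e. in $\Omega$. A weak solution of $Lu=0$ is $u\in W^{1,2}_{loc}(\Omega,m)$ with $\iint\mathcal A\nabla u\cdot\nabla\varphi\,dm=0$ for all $\varphi\in C_c^\infty(\Omega)$ (similarly on open subsets). **PDE friendly.** $(\Omega,m)$ is PDE friendly if $\Omega$ is 1-sided NTA, $m$ is a measure on $\Omega$ with $dm=w\,dX$, $0\le w\in L^1_{loc}(\Omega)$, which is doubling ($m(B(X,2r)\cap\Omega)\le C_m m(B(X,r)\cap\Omega)$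 for all $X\in\overline\Omega$, $r>0$), has the closability property that $v\equiv0$ whenever $D$ is open and compactly contained in $\Omega$, $\{u_i\}\subset C^\infty(\overline D)$, $v\in L^2(D,m)$ is vector-valued, $\iint_D|u_i|\,dm\to0$ and $\iint_D|\nabla u_i-v|^2dm\to0$, and satisfies the Poincaré inequality $(m(B)^{-1}\iint_B|u-u_B|^2dm)^{1/2}\le C_P r(m(B)^{-1}\iint_B|\nabla u|^2dm)^{1/2}$ for every ball $B$ of radius $r$ with $2B\subset\Omega$ and every $u\in W^{1,2}(B,m)$, and for every such $L$ (all constants depending on $L$ only via $C_L$): - there is a unique family of probability measures $\omega_L=\{\omega_L^X\}_{X\in\Omega}$ on $\partial\Omega$ (the elliptic measure of $L$) such that for $f\in C_c^\infty(\mathbb R^n)$, $u_f(X)=\int f\,d\omega_L^X$ is continuous on $\overline\Omega$, equals $f$ on $\partial\Omega$, and is a weak solution of $Lu=0$; - $\omega_L^X(\Delta(x,2r))\le C\omega_L^X(\Delta(x,r))$ for $X\in\Omega\setminus B(x,3r)$; - if $X$ is a Corkscrew point associated to $(x,r)$ and $E\subset\Delta(x,r)$ is Borel, $C^{-1}\omega_L^X(E)\le\omega_L^Y(E)/\omega_L^Y(\Delta(x,r))\le C\omega_L^X(E)$ for $Y\in\Omega\setminus B(x,2r)$; - $\omega_L^X(E)\le C(\delta(X)/\operatorname{dist}(X,E))^\gamma$ for $X\in\Omega$, $E\subset\partial\Omega$ Borel, some $\gamma\in(0,1)$; - for $X\in\Omega$, $r=\delta(X)/2$, $x\in\partial\Omega$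 with $|X-x|=2r$, there is a weak solution $G_X^*$ of $L^*u=-\operatorname{div}(w\mathcal A^T\nabla u)=0$ in $B(x,r)\cap\Omega$ such that for $y\in\Delta(x,r)$, $s\in(0,r)$ and $Y\in B(x,r)\cap\Omega$ a Corkscrew point associated to $(y,s)$, $C^{-1}\frac{m(B(y,s)\cap\Omega)}{s^2}G_X^*(Y)\le\omega_L^X(\Delta(y,s))\le C\frac{m(B(y,s)\cap\Omega)}{s^2}G_X^*(Y)$. An elliptic measure on $\partial\Omega$ means $\omega_L$ for some such $L$. **Doubling.** A Borel measure $\sigma$ on $\partial\Omega$ is doubling if $\sigma(\Delta(x,2r))\le C\sigma(\Delta(x,r))$ for all $x\in\partial\Omega$, $r>0$; implicitly boundary balls have positive finite measure. **Carleson condition.** $\gamma^r(x)=\{X\in\Omega:|X-x|\le2\delta(X)\le2r\}$, $\mathsf A^r(f)(x)=\big(\iint_{\gamma^r(x)}|f|^2\frac{dm(X)}{m(B_X)}\big)^{1/2}$. For a family $\omega=\{\omega^X\}$, $f\in KCM(\omega)$ if there is $M>0$ with $\int_{\Delta(x,r)}|\mathsf A^r(f)|^2d\omega^X\le M\omega^X(\Delta(x,r))$ for all $x\in\partial\Omega$, $r>0$, $X\in\Omega\setminus B(x,2r)$ (no condition if that set is empty). For a measure $\sigma$, replace $\omega^X$ by $\sigma$. **$A_\infty$.** $\omega_1\in A_\infty(\omega_0)$ if for every $\xi>0$ there is $\zeta>0$ such that for every boundary ball $\Delta=\Delta(x,r)$, every $X\in\Omega\setminus B(x,2r)$ and every Borel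 $E\subset\Delta$: $\omega_1^X(E)/\omega_1^X(\Delta)<\zeta$ implies $\omega_0^X(E)/\omega_0^X(\Delta)<\xi$. If $\omega_0$ and/or $\omega_1$ is a single measure, the superscript $X$ is dropped for it. *)

theory Defs
  imports "HOL-Probability.Probability_Measure"
begin

section \<open>Smooth functions\<close>

primrec Ck_on :: "nat \<Rightarrow> (real^'n) set \<Rightarrow> (real^'n \<Rightarrow> real) \<Rightarrow> bool" where
  "Ck_on 0 U u \<longleftrightarrow> continuous_on U u"
| "Ck_on (Suc k) U u \<longleftrightarrow>
     (\<forall>X\<in>U. u differentiable (at X)) \<and>
     (\<forall>h. Ck_on k U (\<lambda>X. frechet_derivative u (at X) h))"

text \<open>Meant for open \<open>U\<close>.\<close>

definition smooth_on :: "(real^'n) set \<Rightarrow> (real^'n \<Rightarrow> real) \<Rightarrow> bool" where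
  "smooth_on U u \<longleftrightarrow> (\<forall>k. Ck_on k U u)"

text \<open>\<open>C\<^sup>\<infinity>\<close> on the closure of \<open>D\<close>, understood as smoothness in a neighbourhood of the closure.\<close>

definition smooth_upto :: "(real^'n) set \<Rightarrow> (real^'n \<Rightarrow> real) \<Rightarrow> bool" where
  "smooth_upto D u \<longleftrightarrow> (\<exists>U. open U \<and> closure D \<subseteq> U \<and> smooth_on U u)"

text \<open>Test functions on \<open>U\<close>, extended by zero to the whole space.\<close>

definition test_functions :: "(real^'n) set \<Rightarrow> (real^'n \<Rightarrow> real) set" where
  "test_functions U =
     {u. smooth_on UNIV u \<and> compact (closure {X. u X \<noteq> 0}) \<and> closure {X. u X \<noteq> 0} \<subseteq> U}"

definition grad :: "(real^'n \<Rightarrow> real) \<Rightarrow> real^'n \<Rightarrow> real^'n" where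
  "grad u X = (\<chi> i. frechet_derivative u (at X) (axis i 1))"


section \<open>Geometry of the domain\<close>

definition bdist :: "(real^'n) set \<Rightarrow> real^'n \<Rightarrow> real" where
  "bdist \<Omega> X = infdist X (frontier \<Omega>)"

definition bball :: "(real^'n) set \<Rightarrow> real^'n \<Rightarrow> real \<Rightarrow> (real^'n) set" where
  "bball \<Omega> x r = ball x r \<inter> frontier \<Omega>"

text \<open>For unbounded \<open>\<Omega>\<close> (infinite diameter) all \<open>r > 0\<close> are allowed;
  the real-valued \<^const>\<open>diameter\<close> is meaningful only in the bounded case.\<close>

definition corkscrew_condition :: "(real^'n) set \<Rightarrow> real \<Rightarrow> bool" where
  "corkscrew_condition \<Omega> c\<^sub>1 \<longleftrightarrow>
     0 < c\<^sub>1 \<and> c\<^sub>1 < 1 \<and>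
     (\<forall>x\<in>frontier \<Omega>. \<forall>r>0. (bounded \<Omega> \<longrightarrow> r < diameter \<Omega>) \<longrightarrow>
        (\<exists>X. ball X (c\<^sub>1 * r) \<subseteq> ball x r \<inter> \<Omega>))"

definition corkscrew_point ::
    "(real^'n) set \<Rightarrow> real \<Rightarrow> real^'n \<Rightarrow> real \<Rightarrow> real^'n \<Rightarrow> bool" where
  "corkscrew_point \<Omega> c\<^sub>1 x r X \<longleftrightarrow>
     X \<in> \<Omega> \<and> c\<^sub>1 * r / 100 \<le> bdist \<Omega> X \<and> bdist \<Omega> X \<le> dist X x \<and> dist X x \<le> 100 * r"

definition harnack_chain_condition :: "(real^'n) set \<Rightarrow> bool" where
  "harnack_chain_condition \<Omega> \<longleftrightarrow>
     (\<forall>\<Lambda>\<ge>1. \<exists>N::nat. N \<ge> 1 \<and>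
        (\<forall>X\<in>\<Omega>. \<forall>Y\<in>\<Omega>. \<forall>r>0.
           bdist \<Omega> X > r \<and> bdist \<Omega> Y > r \<and> dist X Y \<le> \<Lambda> * r \<longrightarrow>
           (\<exists>(Z :: nat \<Rightarrow> real^'n) (\<rho> :: nat \<Rightarrow> real).
              X \<in> ball (Z 1) (\<rho> 1) \<and> Y \<in> ball (Z N) (\<rho> N) \<and>
              (\<forall>i\<in>{1..N}. \<rho> i > 0 \<and> ball (Z i) (2 * \<rho> i) \<subseteq> \<Omega>) \<and>
              (\<forall>i\<in>{1..<N}. ball (Z i) (\<rho> i) \<inter> ball (Z (i+1)) (\<rho> (i+1)) \<noteq> {}))))"

definition compactly_contained :: "(real^'n) set \<Rightarrow> (real^'n) set \<Rightarrow> bool" where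
  "compactly_contained D U \<longleftrightarrow> compact (closure D) \<and> closure D \<subseteq> U"


section \<open>The measure \<open>m\<close> and the associated function spaces\<close>

text \<open>The measure \<open>m\<close> lives on the Lebesgue measurable subsets of \<open>\<Omega>\<close>.\<close>

definition weighted_measure :: "(real^'n) set \<Rightarrow> (real^'n) measure \<Rightarrow> bool" where
  "weighted_measure \<Omega> m \<longleftrightarrow>
     (\<exists>w :: real^'n \<Rightarrow> real.
        w \<in> borel_measurable (lebesgue_on \<Omega>) \<and> (\<forall>X\<in>\<Omega>. 0 \<le> w X) \<and>
        (\<forall>K. compact K \<and> K \<subseteq> \<Omega> \<longrightarrow> set_integrable lebesgue K w) \<and>
        m = density (lebesgue_on \<Omega>) (\<lambda>X. ennreal (w X)))"

definition m_doubling :: "(real^'n) set \<Rightarrow> (real^'n) measure \<Rightarrow> bool" where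
  "m_doubling \<Omega> m \<longleftrightarrow>
     (\<exists>C\<^sub>m>0. \<forall>X\<in>closure \<Omega>. \<forall>r>0.
        emeasure m (ball X (2 * r) \<inter> \<Omega>) \<le> ennreal C\<^sub>m * emeasure m (ball X r \<inter> \<Omega>))"

definition L2_on :: "(real^'n) measure \<Rightarrow> (real^'n) set \<Rightarrow> (real^'n \<Rightarrow> 'b::euclidean_space) set" where
  "L2_on m U =
     {g. g \<in> borel_measurable (restrict_space m U) \<and>
         (\<integral>\<^sup>+X\<in>U. ennreal ((norm (g X))\<^sup>2) \<partial>m) < \<infinity>}"

definition L2_loc :: "(real^'n) measure \<Rightarrow> (real^'n) set \<Rightarrow> (real^'n \<Rightarrow> 'b::euclidean_space) set" where
  "L2_loc m U =
     {g. g \<in> borel_measurable (restrict_space m U) \<and>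
         (\<forall>K. compact K \<and> K \<subseteq> U \<longrightarrow> (\<integral>\<^sup>+X\<in>K. ennreal ((norm (g X))\<^sup>2) \<partial>m) < \<infinity>)}"

definition closability :: "(real^'n) set \<Rightarrow> (real^'n) measure \<Rightarrow> bool" where
  "closability \<Omega> m \<longleftrightarrow>
     (\<forall>D (u :: nat \<Rightarrow> real^'n \<Rightarrow> real) (v :: real^'n \<Rightarrow> real^'n).
        open D \<and> compactly_contained D \<Omega> \<and> (\<forall>i. smooth_upto D (u i)) \<and> v \<in> L2_on m D \<and>
        (\<lambda>i. \<integral>\<^sup>+X\<in>D. ennreal \<bar>u i X\<bar> \<partial>m) \<longlonglongrightarrow> 0 \<and>
        (\<lambda>i. \<integral>\<^sup>+X\<in>D. ennreal ((norm (grad (u i) X - v X))\<^sup>2) \<partial>m) \<longlonglongrightarrow> 0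
        \<longrightarrow> (AE X in m. X \<in> D \<longrightarrow> v X = 0))"

text \<open>\<open>v\<close> is a gradient of \<open>u\<close> on the open set \<open>U\<close>: on every open set compactly contained in \<open>U\<close>,
  the pair \<open>(u, v)\<close> is an \<open>L\<^sup>2\<close>-limit of pairs \<open>(u\<^sub>i, \<nabla>u\<^sub>i)\<close> with \<open>u\<^sub>i\<close> smooth.
  Under \<^const>\<open>closability\<close>, \<open>v\<close> is determined up to \<open>m\<close>-null sets. It need not be the
  distributional gradient.\<close>

definition has_gradient ::
    "(real^'n) measure \<Rightarrow> (real^'n) set \<Rightarrow> (real^'n \<Rightarrow> real) \<Rightarrow> (real^'n \<Rightarrow> real^'n) \<Rightarrow> bool" where
  "has_gradient m U u v \<longleftrightarrow>
     (\<forall>D. open D \<and> compactly_contained D U \<longrightarrow>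
        (\<exists>s :: nat \<Rightarrow> real^'n \<Rightarrow> real. (\<forall>i. smooth_upto D (s i)) \<and>
           (\<lambda>i. \<integral>\<^sup>+X\<in>D. ennreal ((s i X - u X)\<^sup>2) \<partial>m) \<longlonglongrightarrow> 0 \<and>
           (\<lambda>i. \<integral>\<^sup>+X\<in>D. ennreal ((norm (grad (s i) X - v X))\<^sup>2) \<partial>m) \<longlonglongrightarrow> 0))"

text \<open>The Sobolev spaces, presented as sets of pairs (function, gradient).\<close>

definition W12 :: "(real^'n) measure \<Rightarrow> (real^'n) set \<Rightarrow> ((real^'n \<Rightarrow> real) \<times> (real^'n \<Rightarrow> real^'n)) set" where
  "W12 m U = {(u, v). u \<in> L2_on m U \<and> v \<in> L2_on m U \<and> has_gradient m U u v}"

definition W12_loc :: "(real^'n) measure \<Rightarrow> (real^'n) set \<Rightarrow> ((real^'n \<Rightarrow> real) \<times> (real^'n \<Rightarrow> real^'n)) set" where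
  "W12_loc m U = {(u, v). u \<in> L2_loc m U \<and> v \<in> L2_loc m U \<and> has_gradient m U u v}"

definition average :: "(real^'n) measure \<Rightarrow> (real^'n) set \<Rightarrow> (real^'n \<Rightarrow> real) \<Rightarrow> real" where
  "average m B u = (LINT X:B|m. u X) / measure m B"

definition poincare :: "(real^'n) set \<Rightarrow> (real^'n) measure \<Rightarrow> bool" where
  "poincare \<Omega> m \<longleftrightarrow>
     (\<exists>C\<^sub>P>0. \<forall>Z. \<forall>r>0. ball Z (2 * r) \<subseteq> \<Omega> \<longrightarrow>
        (\<forall>(u, v) \<in> W12 m (ball Z r).
           sqrt (average m (ball Z r) (\<lambda>X. (u X - average m (ball Z r) u)\<^sup>2))
           \<le> C\<^sub>P * r * sqrt (average m (ball Z r) (\<lambda>X. (norm (v X))\<^sup>2))))"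


section \<open>Elliptic operators and elliptic measure\<close>

text \<open>The operator \<open>L = - div (w \<A> \<nabla>)\<close> is represented by its coefficient matrix \<open>\<A>\<close>;
  the weight \<open>w\<close> enters only through \<open>dm = w dX\<close>.\<close>

definition elliptic_matrix :: "(real^'n) set \<Rightarrow> real \<Rightarrow> (real^'n \<Rightarrow> real^'n^'n) \<Rightarrow> bool" where
  "elliptic_matrix \<Omega> C\<^sub>L \<A> \<longleftrightarrow>
     \<A> \<in> borel_measurable (lebesgue_on \<Omega>) \<and>
     (AE X in lebesgue_on \<Omega>.
        (\<forall>\<xi>. (\<A> X *v \<xi>) \<bullet> \<xi> \<ge> inverse C\<^sub>L * (norm \<xi>)\<^sup>2) \<and>
        (\<forall>\<xi> \<zeta>. \<bar>(\<A> X *v \<xi>) \<bullet> \<zeta>\<bar> \<le> C\<^sub>L * norm \<xi> * norm \<zeta>))"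

definition weak_solution ::
    "(real^'n) measure \<Rightarrow> (real^'n \<Rightarrow> real^'n^'n) \<Rightarrow> (real^'n) set \<Rightarrow> (real^'n \<Rightarrow> real) \<Rightarrow> bool" where
  "weak_solution m \<A> U u \<longleftrightarrow>
     (\<exists>v. (u, v) \<in> W12_loc m U \<and>
        (\<forall>\<phi>\<in>test_functions U. (LINT X:U|m. (\<A> X *v v X) \<bullet> grad \<phi> X) = 0))"

definition boundary_borel_measure :: "(real^'n) set \<Rightarrow> (real^'n) measure \<Rightarrow> bool" where
  "boundary_borel_measure \<Omega> \<sigma> \<longleftrightarrow> sets \<sigma> = sets (restrict_space borel (frontier \<Omega>))"

text \<open>The function \<open>u\<^sub>f\<close> is given by the integral inside \<open>\<Omega>\<close> and by the boundary data \<open>f\<close> on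
  \<open>\<partial>\<Omega>\<close>. Values of \<open>\<omega> X\<close> for \<open>X \<notin> \<Omega>\<close> are irrelevant.\<close>

definition elliptic_measure_of ::
    "(real^'n) set \<Rightarrow> (real^'n) measure \<Rightarrow> (real^'n \<Rightarrow> real^'n^'n) \<Rightarrow>
     (real^'n \<Rightarrow> (real^'n) measure) \<Rightarrow> bool" where
  "elliptic_measure_of \<Omega> m \<A> \<omega> \<longleftrightarrow>
     (\<forall>X\<in>\<Omega>. boundary_borel_measure \<Omega> (\<omega> X) \<and> prob_space (\<omega> X)) \<and>
     (\<forall>f\<in>test_functions UNIV.
        continuous_on (closure \<Omega>) (\<lambda>X. if X \<in> \<Omega> then (LINT y|\<omega> X. f y) else f X) \<and>
        weak_solution m \<A> \<Omega> (\<lambda>X. LINT y|\<omega> X. f y))"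

definition boundary_doubling ::
    "(real^'n) set \<Rightarrow> real \<Rightarrow> (real^'n \<Rightarrow> (real^'n) measure) \<Rightarrow> bool" where
  "boundary_doubling \<Omega> C \<omega> \<longleftrightarrow>
     (\<forall>x\<in>frontier \<Omega>. \<forall>r>0. \<forall>X \<in> \<Omega> - ball x (3 * r).
        measure (\<omega> X) (bball \<Omega> x (2 * r)) \<le> C * measure (\<omega> X) (bball \<Omega> x r))"

text \<open>Positivity of the denominator is what the quotient in the change of pole formula
  presupposes; in HOL, division by zero would yield \<open>0\<close>.\<close>

definition change_of_pole ::
    "(real^'n) set \<Rightarrow> real \<Rightarrow> real \<Rightarrow> (real^'n \<Rightarrow> (real^'n) measure) \<Rightarrow> bool" where
  "change_of_pole \<Omega> c\<^sub>1 C \<omega> \<longleftrightarrow>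
     (\<forall>x\<in>frontier \<Omega>. \<forall>r>0. \<forall>X. corkscrew_point \<Omega> c\<^sub>1 x r X \<longrightarrow>
        (\<forall>Y \<in> \<Omega> - ball x (2 * r). measure (\<omega> Y) (bball \<Omega> x r) > 0 \<and>
           (\<forall>E\<in>sets borel. E \<subseteq> bball \<Omega> x r \<longrightarrow>
              inverse C * measure (\<omega> X) E \<le> measure (\<omega> Y) E / measure (\<omega> Y) (bball \<Omega> x r) \<and>
              measure (\<omega> Y) E / measure (\<omega> Y) (bball \<Omega> x r) \<le> C * measure (\<omega> X) E)))"

text \<open>For \<open>E = {}\<close> both sides are \<open>0\<close>, as \<^term>\<open>infdist X {} = 0\<close>.\<close>

definition decay_estimate ::
    "(real^'n) set \<Rightarrow> real \<Rightarrow> real \<Rightarrow> (real^'n \<Rightarrow> (real^'n) measure) \<Rightarrow> bool" where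
  "decay_estimate \<Omega> C \<gamma> \<omega> \<longleftrightarrow>
     (\<forall>X\<in>\<Omega>. \<forall>E\<in>sets borel. E \<subseteq> frontier \<Omega> \<longrightarrow>
        measure (\<omega> X) E \<le> C * (bdist \<Omega> X / infdist X E) powr \<gamma>)"

definition green_comparison ::
    "(real^'n) set \<Rightarrow> (real^'n) measure \<Rightarrow> real \<Rightarrow> real \<Rightarrow> (real^'n \<Rightarrow> real^'n^'n) \<Rightarrow>
     (real^'n \<Rightarrow> (real^'n) measure) \<Rightarrow> bool" where
  "green_comparison \<Omega> m c\<^sub>1 C \<A> \<omega> \<longleftrightarrow>
     (\<forall>X\<in>\<Omega>. \<forall>r. \<forall>x\<in>frontier \<Omega>. r = bdist \<Omega> X / 2 \<and> dist X x = 2 * r \<longrightarrow>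
        (\<exists>G :: real^'n \<Rightarrow> real.
           weak_solution m (\<lambda>Z. transpose (\<A> Z)) (ball x r \<inter> \<Omega>) G \<and>
           (\<forall>y \<in> bball \<Omega> x r. \<forall>s. 0 < s \<and> s < r \<longrightarrow>
              (\<forall>Y \<in> ball x r \<inter> \<Omega>. corkscrew_point \<Omega> c\<^sub>1 y s Y \<longrightarrow>
                 inverse C * (measure m (ball y s \<inter> \<Omega>) / s\<^sup>2 * G Y)
                   \<le> measure (\<omega> X) (bball \<Omega> y s) \<and>
                 measure (\<omega> X) (bball \<Omega> y s)
                   \<le> C * (measure m (ball y s \<inter> \<Omega>) / s\<^sup>2 * G Y)))))"

text \<open>The constants \<open>C\<close> and \<open>\<gamma>\<close> are chosen after \<open>C\<^sub>L\<close> and before the operator.\<close>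

definition pde_friendly :: "(real^'n) set \<Rightarrow> (real^'n) measure \<Rightarrow> bool" where
  "pde_friendly \<Omega> m \<longleftrightarrow>
     open \<Omega> \<and> harnack_chain_condition \<Omega> \<and>
     weighted_measure \<Omega> m \<and> m_doubling \<Omega> m \<and> closability \<Omega> m \<and> poincare \<Omega> m \<and>
     (\<exists>c\<^sub>1. corkscrew_condition \<Omega> c\<^sub>1 \<and>
        (\<forall>C\<^sub>L>0. \<exists>C>0. \<exists>\<gamma>. 0 < \<gamma> \<and> \<gamma> < 1 \<and>
           (\<forall>\<A>. elliptic_matrix \<Omega> C\<^sub>L \<A> \<longrightarrow>
              (\<exists>\<omega>. elliptic_measure_of \<Omega> m \<A> \<omega> \<and>
                 (\<forall>\<omega>'. elliptic_measure_of \<Omega> m \<A> \<omega>' \<longrightarrow> (\<forall>X\<in>\<Omega>. \<omega>' X = \<omega> X)) \<and>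
                 boundary_doubling \<Omega> C \<omega> \<and>
                 change_of_pole \<Omega> c\<^sub>1 C \<omega> \<and>
                 decay_estimate \<Omega> C \<gamma> \<omega> \<and>
                 green_comparison \<Omega> m c\<^sub>1 C \<A> \<omega>))))"


section \<open>Elliptic and doubling measures, Carleson condition, \<open>A\<^sub>\<infinity>\<close>\<close>

datatype 'n bdry_measure =
    Family "real^'n \<Rightarrow> (real^'n) measure"
  | Single "(real^'n) measure"

definition doubling_measure :: "(real^'n) set \<Rightarrow> (real^'n) measure \<Rightarrow> bool" where
  "doubling_measure \<Omega> \<sigma> \<longleftrightarrow>
     boundary_borel_measure \<Omega> \<sigma> \<and>
     (\<forall>x\<in>frontier \<Omega>. \<forall>r>0. 0 < emeasure \<sigma> (bball \<Omega> x r) \<and> emeasure \<sigma> (bball \<Omega> x r) < \<infinity>) \<and>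
     (\<exists>C>0. \<forall>x\<in>frontier \<Omega>. \<forall>r>0.
        emeasure \<sigma> (bball \<Omega> x (2 * r)) \<le> ennreal C * emeasure \<sigma> (bball \<Omega> x r))"

fun elliptic_or_doubling :: "(real^'n) set \<Rightarrow> (real^'n) measure \<Rightarrow> 'n bdry_measure \<Rightarrow> bool" where
  "elliptic_or_doubling \<Omega> m (Family \<omega>) \<longleftrightarrow>
     (\<exists>C\<^sub>L>0. \<exists>\<A>. elliptic_matrix \<Omega> C\<^sub>L \<A> \<and> elliptic_measure_of \<Omega> m \<A> \<omega>)"
| "elliptic_or_doubling \<Omega> m (Single \<sigma>) \<longleftrightarrow> doubling_measure \<Omega> \<sigma>"

fun at_pole :: "'n bdry_measure \<Rightarrow> real^'n \<Rightarrow> (real^'n) measure" where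
  "at_pole (Family \<omega>) X = \<omega> X"
| "at_pole (Single \<sigma>) X = \<sigma>"

text \<open>The poles admitted for the boundary ball of centre \<open>x\<close> and radius \<open>r\<close>. A single measure does
  not involve a pole and hence imposes no restriction; in particular, conditions on single measures
  only are required for all boundary balls, even if \<open>\<Omega> \<subseteq> B(x,2r)\<close>.\<close>

fun poles :: "(real^'n) set \<Rightarrow> 'n bdry_measure \<Rightarrow> real^'n \<Rightarrow> real \<Rightarrow> (real^'n) set" where
  "poles \<Omega> (Family \<omega>) x r = \<Omega> - ball x (2 * r)"
| "poles \<Omega> (Single \<sigma>) x r = UNIV"

definition cone :: "(real^'n) set \<Rightarrow> real \<Rightarrow> real^'n \<Rightarrow> (real^'n) set" where
  "cone \<Omega> r x = {X\<in>\<Omega>. dist X x \<le> 2 * bdist \<Omega> X \<and> 2 * bdist \<Omega> X \<le> 2 * r}"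

definition ennreal_sqrt :: "ennreal \<Rightarrow> ennreal" where
  "ennreal_sqrt t = (if t = \<infinity> then \<infinity> else ennreal (sqrt (enn2real t)))"

lemma ennreal_sqrt_power2: "(ennreal_sqrt t)\<^sup>2 = t"
  by (cases t) (auto simp: ennreal_sqrt_def ennreal_power power2_eq_square ennreal_mult[symmetric])

definition area_fun ::
    "(real^'n) set \<Rightarrow> (real^'n) measure \<Rightarrow> real \<Rightarrow> (real^'n \<Rightarrow> real) \<Rightarrow> real^'n \<Rightarrow> ennreal" where
  "area_fun \<Omega> m r f x =
     ennreal_sqrt (\<integral>\<^sup>+X\<in>cone \<Omega> r x. (ennreal (\<bar>f X\<bar>\<^sup>2) / emeasure m (ball X (bdist \<Omega> X / 4))) \<partial>m)"

definition KCM ::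
    "(real^'n) set \<Rightarrow> (real^'n) measure \<Rightarrow> 'n bdry_measure \<Rightarrow> (real^'n \<Rightarrow> real) set" where
  "KCM \<Omega> m \<mu> =
     {f. \<exists>M>0. \<forall>x\<in>frontier \<Omega>. \<forall>r>0. \<forall>X \<in> poles \<Omega> \<mu> x r.
        (\<integral>\<^sup>+y\<in>bball \<Omega> x r. (area_fun \<Omega> m r f y)\<^sup>2 \<partial>(at_pole \<mu> X))
        \<le> ennreal M * emeasure (at_pole \<mu> X) (bball \<Omega> x r)}"

definition A_infinity :: "(real^'n) set \<Rightarrow> 'n bdry_measure \<Rightarrow> 'n bdry_measure set" where
  "A_infinity \<Omega> \<mu>\<^sub>0 =
     {\<mu>\<^sub>1. \<forall>\<xi>>0. \<exists>\<zeta>>0. \<forall>x\<in>frontier \<Omega>. \<forall>r>0. \<forall>X \<in> poles \<Omega> \<mu>\<^sub>0 x r \<inter> poles \<Omega> \<mu>\<^sub>1 x r.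
        \<forall>E\<in>sets borel. E \<subseteq> bball \<Omega> x r \<longrightarrow>
          measure (at_pole \<mu>\<^sub>1 X) E / measure (at_pole \<mu>\<^sub>1 X) (bball \<Omega> x r) < \<zeta> \<longrightarrow>
          measure (at_pole \<mu>\<^sub>0 X) E / measure (at_pole \<mu>\<^sub>0 X) (bball \<Omega> x r) < \<xi>}"

end

theory Submission
  imports Defs
begin

text \<open>Write \<open>\<delta>\<close> for the distance to the boundary. The square of the area function at \<open>y\<close> is the mass
that the measure \<open>H\<close> with \<open>dH = |f|\<^sup>2 / m(B\<^sub>X) dm\<close> gives to the cone with apex \<open>y\<close>, so both Carleson
conditions say that the mean over a boundary ball of the \<open>H\<close>-mass of truncated cones is bounded. The
proof rests on the finiteness of \<open>H\<close> on compact subsets of \<open>\<Omega>\<close> and on Fubini's theorem in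
the form \<open>\<integral>\<^sub>B H(cone y) d\<nu>(y) = \<integral> \<nu>(B \<inter> shadow X) dH(X)\<close>, where the shadow of \<open>X\<close> is the ball
of radius \<open>2\<delta>(X)\<close> about \<open>X\<close>; elliptic measures enter through doubling and positivity on boundary balls.

Suppose the Carleson condition holds for \<open>\<nu>\<close>, and that small \<open>\<nu>\<close>-proportion of a boundary ball forces
small \<open>\<nu>'\<close>-proportion. By Chebyshev's inequality the cone masses are at most some \<open>N\<close> off a set that is
\<open>\<nu>\<close>-small, hence \<open>\<nu>'\<close>-small, in each boundary ball; let \<open>F\<close> be the remaining good set. A point \<open>X\<close> whose
shadow is at least half filled by \<open>F\<close>, as measured by \<open>\<nu>'\<close>, is paid for by \<open>N\<close>. The
shadows of the other points can be thinned out by Vitali's covering lemma to disjoint ones that are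
at least half filled by the complement of \<open>F\<close>; the contribution of all points in the boxes over these shadows is at
most a doubling constant times the best Carleson constant \<open>K\<close> for \<open>\<nu>'\<close> times the small measure of
that complement. This yields
\<open>K \<le> const + K / 2\<close> (\<open>carleson_step\<close>, \<open>carleson_bound_of_good_sets\<close>), hence a bound for \<open>K\<close> once \<open>K\<close>
is known to be finite; it is finite when \<open>H\<close> has finite mass, and the bound survives exhausting \<open>\<Omega>\<close> by
compact sets (\<open>carleson_transfer\<close>).

The hypothesis \<open>\<mu>\<^sub>1 \<in> A\<^sub>\<infinity>(\<mu>\<^sub>0)\<close> says directly that \<open>\<mu>\<^sub>1\<close>-small sets are \<open>\<mu>\<^sub>0\<close>-small. For the other
implication the relation has to be reversed. In contrapositive form it says that a set filling half of a
ball for \<open>\<mu>\<^sub>0\<close> fills a fixed proportion of it for \<open>\<mu>\<^sub>1\<close>. An open set that is very small for \<open>\<mu>\<^sub>0\<close>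
can therefore be enlarged repeatedly by adding balls in which its density is at most one half
but not small: each time its \<open>\<mu>\<^sub>0\<close>-measure grows at most, and its \<open>\<mu>\<^sub>1\<close>-measure at least, by a fixed factor larger
than 1. After many rounds the enlarged set still lies in the doubled ball, so the original set was small
for \<open>\<mu>\<^sub>1\<close> (\<open>enlarge_open_set\<close>, \<open>half_comparable_imp_small\<close>).

These arguments need poles far away from the ball. Tall parts of the cones, of height comparable to the
radius of the ball, are therefore bounded separately: the Carleson condition for one measure bounds the
\<open>H\<close>-mass of every Whitney ball, which no longer refers to a measure on the boundary (\<open>whitney_ball_bound\<close>). If
\<open>\<Omega>\<close> is bounded and no pole is far enough away, then the points concerned stay in a compact part of
\<open>\<Omega>\<close>, and \<open>f \<in> L\<^sup>2\<^sub>l\<^sub>o\<^sub>c\<close> suffices.\<close>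

section \<open>Reversing the comparison of small sets\<close>

text \<open>The form in which Vitali's covering lemma is applied throughout: dilated balls \<open>A j\<close> cover, while
the original balls, or parts \<open>B j\<close> of them, are disjoint. Allowing two different measures
also covers estimates of integrals over \<open>X\<close>, by taking \<open>\<mu>\<close> to be a density measure.\<close>

lemma emeasure_le_by_disjoint_family:
  assumes J: "countable J" and disj: "disjoint_family_on B J"
    and A: "\<And>j. j \<in> J \<Longrightarrow> A j \<in> sets \<mu>" and B: "\<And>j. j \<in> J \<Longrightarrow> B j \<in> sets \<nu>"
    and Y: "Y \<in> sets \<nu>"
    and le: "\<And>j. j \<in> J \<Longrightarrow> emeasure \<mu> (A j) \<le> c * emeasure \<nu> (B j)"
    and cov: "X \<subseteq> (\<Union>j\<in>J. A j)" and sub: "\<And>j. j \<in> J \<Longrightarrow> B j \<subseteq> Y"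
  shows "emeasure \<mu> X \<le> c * emeasure \<nu> Y"
proof -
  define I where "I = to_nat_on J ` J"
  define A' where "A' k = (if k \<in> I then A (from_nat_into J k) else {})" for k
  define B' where "B' k = (if k \<in> I then B (from_nat_into J k) else {})" for k
  have in_J: "from_nat_into J k \<in> J" if "k \<in> I" for k
    using that J by (auto simp: I_def)
  have inj: "k = l" if "k \<in> I" "l \<in> I" "from_nat_into J k = from_nat_into J l" for k l
    using that J by (auto simp: I_def)
  have cov': "X \<subseteq> (\<Union>k. A' k)"
  proof
    fix x assume "x \<in> X"
    then obtain j where "j \<in> J" "x \<in> A j" using cov by auto
    then show "x \<in> (\<Union>k. A' k)"
      using J by (intro UN_I[of "to_nat_on J j"]) (auto simp: A'_def I_def)
  qed
  have A's: "range A' \<subseteq> sets \<mu>" using A in_J by (auto simp: A'_def)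
  have B's: "range B' \<subseteq> sets \<nu>" using B in_J by (auto simp: B'_def)
  have dB': "disjoint_family B'"
    unfolding disjoint_family_on_def
  proof (intro ballI impI)
    fix k l :: nat assume "k \<noteq> l"
    show "B' k \<inter> B' l = {}"
    proof (cases "k \<in> I \<and> l \<in> I")
      case True
      then have "from_nat_into J k \<noteq> from_nat_into J l" using inj \<open>k \<noteq> l\<close> by blast
      then show ?thesis using disj in_J True by (auto simp: disjoint_family_on_def B'_def)
    qed (auto simp: B'_def)
  qed
  have "emeasure \<mu> X \<le> emeasure \<mu> (\<Union>k. A' k)"
    using cov' A's by (intro emeasure_mono) auto
  also have "\<dots> \<le> (\<Sum>k. emeasure \<mu> (A' k))"
    using A's by (intro emeasure_subadditive_countably) auto
  also have "\<dots> \<le> (\<Sum>k. c * emeasure \<nu> (B' k))"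
    by (intro suminf_le) (auto simp: A'_def B'_def intro!: le in_J)
  also have "\<dots> = c * (\<Sum>k. emeasure \<nu> (B' k))"
    by simp
  also have "(\<Sum>k. emeasure \<nu> (B' k)) = emeasure \<nu> (\<Union>k. B' k)"
    using B's dB' by (intro suminf_emeasure) auto
  also have "\<dots> \<le> emeasure \<nu> Y"
    using Y sub in_J by (intro emeasure_mono) (auto simp: B'_def split: if_splits)
  finally show ?thesis by (simp add: mult_left_mono)
qed

text \<open>Doubling at the factor 5 of Vitali's lemma, for centres in \<open>S\<close> near \<open>x\<^sub>0\<close> only: doubling of an elliptic
measure is available only for balls that stay away from its pole.\<close>

definition ball_doubling :: "('a::euclidean_space) set \<Rightarrow> 'a \<Rightarrow> real \<Rightarrow> real \<Rightarrow> real \<Rightarrow> 'a measure \<Rightarrow> bool" where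
  "ball_doubling S x\<^sub>0 R q C \<nu> \<longleftrightarrow>
     (\<forall>y\<in>S \<inter> ball x\<^sub>0 R. \<forall>s. 0 < s \<and> s \<le> q \<longrightarrow>
        0 < emeasure \<nu> (ball y s) \<and> emeasure \<nu> (ball y (5 * s)) \<le> ennreal C * emeasure \<nu> (ball y s))"

text \<open>The weak, one-scale consequence of \<open>\<nu>' \<in> A\<^sub>\<infinity>(\<nu>)\<close>: sets that fill half of a ball for \<open>\<nu>\<close> fill at least
the proportion \<open>\<zeta>\<close> of it for \<open>\<nu>'\<close>.\<close>

definition half_comparable :: "('a::euclidean_space) set \<Rightarrow> 'a \<Rightarrow> real \<Rightarrow> real \<Rightarrow> real \<Rightarrow> 'a measure \<Rightarrow> 'a measure \<Rightarrow> bool" where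
  "half_comparable S x\<^sub>0 R q \<zeta> \<nu> \<nu>' \<longleftrightarrow>
     (\<forall>y\<in>S \<inter> ball x\<^sub>0 R. \<forall>s. 0 < s \<and> s \<le> q \<longrightarrow> (\<forall>E\<in>sets borel. E \<subseteq> ball y s \<longrightarrow>
        measure \<nu> (ball y s) \<le> 2 * measure \<nu> E \<longrightarrow> \<zeta> * measure \<nu>' (ball y s) \<le> measure \<nu>' E))"

text \<open>Around a point of the open set \<open>V\<close> the \<open>\<nu>\<close>-density of \<open>V\<close> is 1 at small radii and at most one half at
radius \<open>\<rho>\<close>, so by doubling there is a radius at which it lies between \<open>1/(2C)\<close> and one half. In these
balls \<open>V\<close> is not negligible for \<open>\<nu>\<close>, so their union is not much larger than \<open>V\<close>; and half of each is
missing from \<open>V\<close>, so by comparability adding them increases \<open>\<nu>'(V)\<close> by a definite factor.\<close>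

lemma enlarge_open_set:
  fixes \<nu> \<nu>' :: "('a::euclidean_space) measure"
  assumes fin: "finite_measure \<nu>" "finite_measure \<nu>'" and sets[simp]: "sets \<nu> = sets borel" "sets \<nu>' = sets borel"
    and S: "closed S" "emeasure \<nu>' (- S) = 0"
    and C: "1 \<le> C" and \<zeta>: "0 < \<zeta>" and \<rho>: "0 < \<rho>"
    and dbl: "ball_doubling S x\<^sub>0 R \<rho> C \<nu>" "ball_doubling S x\<^sub>0 R \<rho> C \<nu>'"
    and comp: "half_comparable S x\<^sub>0 R \<rho> \<zeta> \<nu> \<nu>'"
    and V: "open V" "V \<subseteq> ball x\<^sub>0 R"
    and small: "\<And>y. y \<in> S \<inter> ball x\<^sub>0 R \<Longrightarrow> 2 * measure \<nu> V \<le> measure \<nu> (ball y \<rho>)"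
  obtains V' where "open V'" "V' \<subseteq> ball x\<^sub>0 (R + \<rho>)"
    "measure \<nu> V' \<le> (1 + 2 * C\<^sup>2) * measure \<nu> V"
    "(1 + \<zeta> / C) * measure \<nu>' V \<le> measure \<nu>' V'"
proof -
  interpret n0: finite_measure \<nu> by fact
  interpret n1: finite_measure \<nu>' by fact
  note [simp] = n0.emeasure_eq_measure n1.emeasure_eq_measure
  have dbl_real: "0 < measure \<nu> (ball y s)" "measure \<nu> (ball y (5 * s)) \<le> C * measure \<nu> (ball y s)"
      "0 < measure \<nu>' (ball y s)" "measure \<nu>' (ball y (5 * s)) \<le> C * measure \<nu>' (ball y s)"
    if "y \<in> S \<inter> ball x\<^sub>0 R" "0 < s" "s \<le> \<rho>" for y s
  proof -
    have "0 < emeasure \<nu> (ball y s) \<and> emeasure \<nu> (ball y (5 * s)) \<le> ennreal C * emeasure \<nu> (ball y s)"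
      "0 < emeasure \<nu>' (ball y s) \<and> emeasure \<nu>' (ball y (5 * s)) \<le> ennreal C * emeasure \<nu>' (ball y s)"
      using dbl that unfolding ball_doubling_def by blast+
    then show "0 < measure \<nu> (ball y s)" "measure \<nu> (ball y (5 * s)) \<le> C * measure \<nu> (ball y s)"
      "0 < measure \<nu>' (ball y s)" "measure \<nu>' (ball y (5 * s)) \<le> C * measure \<nu>' (ball y s)"
      using C by (simp_all add: ennreal_mult[symmetric])
  qed
  have ex: "\<exists>s. 0 < s \<and> s \<le> \<rho> \<and> 2 * measure \<nu> (V \<inter> ball y s) \<le> measure \<nu> (ball y s) \<and>
       measure \<nu> (ball y s) \<le> 2 * C * measure \<nu> (V \<inter> ball y s)" if y: "y \<in> V \<inter> S" for y
  proof -
    have yR: "y \<in> S \<inter> ball x\<^sub>0 R" using y V by auto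
    define L where "L k \<longleftrightarrow> 2 * measure \<nu> (V \<inter> ball y (\<rho> / 2 ^ k)) \<le> measure \<nu> (ball y (\<rho> / 2 ^ k))" for k
    have L0: "L 0"
      using small[OF yR] n0.finite_measure_mono[of "V \<inter> ball y \<rho>" V] V(1)
      by (auto simp: L_def borel_open)
    obtain e where e: "0 < e" "ball y e \<subseteq> V" using V(1) y by (auto elim: openE)
    obtain k where k: "\<rho> / 2 ^ k < e"
      using real_arch_pow[of 2 "\<rho> / e"] e(1) by (auto simp: field_simps)
    have "ball y (\<rho> / 2 ^ k) \<subseteq> V" using k e(2) subset_ball[of "\<rho> / 2 ^ k" e y] by auto
    then have "V \<inter> ball y (\<rho> / 2 ^ k) = ball y (\<rho> / 2 ^ k)" by auto
    moreover have "0 < measure \<nu> (ball y (\<rho> / 2 ^ k))"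
      using \<rho> by (intro dbl_real[OF yR]) (auto simp: field_simps)
    ultimately have "\<not> L k" by (simp add: L_def)
    \<comment> \<open>The first dyadic radius at which more than half of the ball lies in \<open>V\<close>; at twice that radius
      the density is at most one half, and by doubling not much smaller.\<close>
    then have notL: "\<not> L (LEAST k. \<not> L k)" by (rule LeastI)
    then obtain j where j: "(LEAST k. \<not> L k) = Suc j" using L0 by (cases "LEAST k. \<not> L k") auto
    have notLj: "\<not> L (Suc j)" using notL unfolding j .
    have Lj: "L j" using not_less_Least[of j "\<lambda>k. \<not> L k"] j by auto
    define s where "s = \<rho> / 2 ^ j"
    have s: "0 < s" "s \<le> \<rho>" using \<rho> by (auto simp: s_def field_simps)
    have "measure \<nu> (ball y s) \<le> measure \<nu> (ball y (5 * (s / 2)))"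
      using s by (intro n0.finite_measure_mono) (auto simp: subset_ball)
    also have "\<dots> \<le> C * measure \<nu> (ball y (s / 2))"
      using s by (intro dbl_real yR) auto
    also have "\<dots> \<le> C * (2 * measure \<nu> (V \<inter> ball y (s / 2)))"
      using notLj C unfolding L_def s_def by (intro mult_left_mono) (auto simp: mult.commute)
    also have "measure \<nu> (V \<inter> ball y (s / 2)) \<le> measure \<nu> (V \<inter> ball y s)"
      using s V(1) by (intro n0.finite_measure_mono) auto
    finally have "measure \<nu> (ball y s) \<le> 2 * C * measure \<nu> (V \<inter> ball y s)" using C by simp
    with s Lj show ?thesis unfolding L_def s_def[symmetric] by blast
  qed
  define good where "good y s \<longleftrightarrow> 0 < s \<and> s \<le> \<rho> \<and>
       2 * measure \<nu> (V \<inter> ball y s) \<le> measure \<nu> (ball y s) \<and>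
       measure \<nu> (ball y s) \<le> 2 * C * measure \<nu> (V \<inter> ball y s)" for y s
  define s where "s y = (SOME s. good y s)" for y
  have s: "0 < s y \<and> s y \<le> \<rho> \<and>
       2 * measure \<nu> (V \<inter> ball y (s y)) \<le> measure \<nu> (ball y (s y)) \<and>
       measure \<nu> (ball y (s y)) \<le> 2 * C * measure \<nu> (V \<inter> ball y (s y))" if "y \<in> V \<inter> S" for y
    using someI_ex[of "good y"] ex[OF that] unfolding s_def good_def by blast
  define W where "W = (\<Union>y\<in>V \<inter> S. ball y (s y))"
  obtain J where J: "countable J" "J \<subseteq> V \<inter> S"
      "pairwise (\<lambda>i j. disjnt (ball i (s i)) (ball j (s j))) J" "W \<subseteq> (\<Union>i\<in>J. ball i (5 * s i))"
  proof (rule Vitali_covering_lemma_balls[where S = W and K = "V \<inter> S" and a = "\<lambda>y. y" and r = s and B = \<rho>])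
    show "W \<subseteq> (\<Union>i\<in>V \<inter> S. ball i (s i))" by (simp add: W_def)
    show "0 < s i \<and> s i \<le> \<rho>" if "i \<in> V \<inter> S" for i using s that by blast
  qed (rule that)
  have JR: "j \<in> S \<inter> ball x\<^sub>0 R" if "j \<in> J" for j using that J(2) V by auto
  have sJ: "0 < s j" "s j \<le> \<rho>" if "j \<in> J" for j using s J(2) that by blast+
  have disj: "disjoint_family_on (\<lambda>j. ball j (s j)) J"
    using J(3) by (auto simp: disjoint_family_on_def pairwise_def disjnt_def)
  have W: "open W" by (auto simp: W_def)
  have [measurable]: "V \<in> sets borel" "W \<in> sets borel" using V(1) W by auto
  have meas_V: "measure \<nu>' V \<le> measure \<nu>' (V \<inter> S)"
  proof -
    have S_borel [measurable]: "S \<in> sets borel" using S(1) by auto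
    have "measure \<nu>' V = measure \<nu>' (V \<inter> S) + measure \<nu>' (V - S)"
      using n1.finite_measure_Union[of "V \<inter> S" "V - S"] by (auto simp: Int_Diff_disjoint Int_Diff_Un)
    moreover have "measure \<nu>' (V - S) \<le> measure \<nu>' (- S)"
      using S_borel by (intro n1.finite_measure_mono) auto
    ultimately show ?thesis using S(2) by simp
  qed
  \<comment> \<open>Upper bound for \<open>\<nu>\<close>: compare each dilated ball with the part of \<open>V\<close> in the original ball.\<close>
  have W0: "emeasure \<nu> W \<le> ennreal (2 * C\<^sup>2) * emeasure \<nu> V"
  proof (rule emeasure_le_by_disjoint_family[where A = "\<lambda>j. ball j (5 * s j)" and B = "\<lambda>j. V \<inter> ball j (s j)", OF J(1)])
    show "disjoint_family_on (\<lambda>j. V \<inter> ball j (s j)) J"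
      using disj by (auto simp: disjoint_family_on_def)
    fix j assume j: "j \<in> J"
    have "measure \<nu> (ball j (5 * s j)) \<le> C * measure \<nu> (ball j (s j))"
      using dbl_real[OF JR[OF j] sJ[OF j]] by blast
    also have "\<dots> \<le> C * (2 * C * measure \<nu> (V \<inter> ball j (s j)))"
      using s J(2) j C by (intro mult_left_mono) auto
    finally show "emeasure \<nu> (ball j (5 * s j)) \<le> ennreal (2 * C\<^sup>2) * emeasure \<nu> (V \<inter> ball j (s j))"
      using C by (simp add: ennreal_mult[symmetric] power2_eq_square mult_ac ennreal_leI)
  qed (use J in auto)
  \<comment> \<open>Lower bound for \<open>\<nu>'\<close>: compare each dilated ball with the part of the original ball outside \<open>V\<close>.\<close>
  have W1: "emeasure \<nu>' (V \<inter> S) \<le> ennreal (C / \<zeta>) * emeasure \<nu>' (W - V)"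
  proof (rule emeasure_le_by_disjoint_family[where A = "\<lambda>j. ball j (5 * s j)" and B = "\<lambda>j. ball j (s j) - V", OF J(1)])
    show "disjoint_family_on (\<lambda>j. ball j (s j) - V) J"
      using disj by (auto simp: disjoint_family_on_def)
    show "V \<inter> S \<subseteq> (\<Union>j\<in>J. ball j (5 * s j))"
      using s J(4) by (force simp: W_def)
    show "ball j (s j) - V \<subseteq> W - V" if "j \<in> J" for j using that J(2) by (auto simp: W_def)
    fix j assume j: "j \<in> J"
    have "measure \<nu> (ball j (s j) - V) = measure \<nu> (ball j (s j)) - measure \<nu> (V \<inter> ball j (s j))"
      using n0.finite_measure_Diff'[of "ball j (s j)" V] by (simp add: Int_commute)
    then have "measure \<nu> (ball j (s j)) \<le> 2 * measure \<nu> (ball j (s j) - V)"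
      using s[of j] J(2) j by auto
    then have *: "\<zeta> * measure \<nu>' (ball j (s j)) \<le> measure \<nu>' (ball j (s j) - V)"
      using comp JR[OF j] sJ[OF j] unfolding half_comparable_def by auto
    have "measure \<nu>' (ball j (5 * s j)) \<le> C * measure \<nu>' (ball j (s j))"
      using dbl_real[OF JR[OF j] sJ[OF j]] by blast
    also have "\<dots> \<le> C * (measure \<nu>' (ball j (s j) - V) / \<zeta>)"
      using * \<zeta> C by (intro mult_left_mono) (auto simp: field_simps)
    finally show "emeasure \<nu>' (ball j (5 * s j)) \<le> ennreal (C / \<zeta>) * emeasure \<nu>' (ball j (s j) - V)"
      using C \<zeta> by (simp add: ennreal_mult[symmetric] ennreal_leI)
  qed (use J in auto)
  show thesis
  proof (rule that[of "V \<union> W"])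
    show "open (V \<union> W)" using V W by auto
    show "V \<union> W \<subseteq> ball x\<^sub>0 (R + \<rho>)"
    proof
      fix z assume "z \<in> V \<union> W"
      then show "z \<in> ball x\<^sub>0 (R + \<rho>)"
      proof
        assume "z \<in> W"
        then obtain y where y: "y \<in> V \<inter> S" "dist y z < s y" by (auto simp: W_def)
        then have "dist x\<^sub>0 y < R" "s y \<le> \<rho>" using s V by auto
        then show ?thesis using y(2) dist_triangle[of x\<^sub>0 z y] by auto
      qed (use V \<rho> in force)
    qed
    have "measure \<nu> (V \<union> W) \<le> measure \<nu> V + measure \<nu> W"
      by (intro measure_Un_le) auto
    also have "measure \<nu> W \<le> 2 * C\<^sup>2 * measure \<nu> V"
      using W0 by (simp add: ennreal_mult[symmetric])
    finally show "measure \<nu> (V \<union> W) \<le> (1 + 2 * C\<^sup>2) * measure \<nu> V" by (simp add: algebra_simps)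
    have "measure \<nu>' V \<le> C / \<zeta> * measure \<nu>' (W - V)"
      using meas_V W1 C \<zeta> by (simp add: ennreal_mult[symmetric])
    then have "\<zeta> / C * measure \<nu>' V \<le> measure \<nu>' (W - V)"
      using C \<zeta> by (simp add: field_simps)
    moreover have "measure \<nu>' (V \<union> W) = measure \<nu>' V + measure \<nu>' (W - V)"
      using n1.finite_measure_Union[of V "W - V"] by simp
    ultimately show "(1 + \<zeta> / C) * measure \<nu>' V \<le> measure \<nu>' (V \<union> W)" by (simp add: algebra_simps)
  qed
qed

lemma ball_doubling_iterate:
  assumes "ball_doubling S x\<^sub>0 R q C \<nu>" "y \<in> S \<inter> ball x\<^sub>0 R" "0 < s" "5 ^ p * s \<le> 5 * q" "0 \<le> C"
  shows "emeasure \<nu> (ball y (5 ^ p * s)) \<le> ennreal (C ^ p) * emeasure \<nu> (ball y s)"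
  using assms(4)
proof (induction p)
  case (Suc p)
  have p: "5 ^ p * s \<le> q" using Suc.prems by (simp add: mult.commute)
  moreover have "0 < 5 ^ p * s" using assms(3) by simp
  ultimately have "emeasure \<nu> (ball y (5 * (5 ^ p * s))) \<le> ennreal C * emeasure \<nu> (ball y (5 ^ p * s))"
    using assms(1,2,3) unfolding ball_doubling_def by blast
  also have "\<dots> \<le> ennreal C * (ennreal (C ^ p) * emeasure \<nu> (ball y s))"
    using p \<open>0 < 5 ^ p * s\<close> by (intro mult_left_mono Suc.IH) (linarith, simp)
  finally show ?case using assms(5) by (simp add: ennreal_mult mult_ac)
qed simp

text \<open>Iterating \<open>enlarge_open_set\<close> \<open>K\<close> times with increments \<open>\<rho> = r / K\<close> multiplies the \<open>\<nu>'\<close>-measure by at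
least \<open>\<theta>\<^sup>K\<close> and stays inside the ball of radius \<open>2r\<close>, so the initial set has \<open>\<nu>'\<close>-measure at most
\<open>C \<theta>\<^sup>-\<^sup>K \<nu>'(ball x\<^sub>0 r)\<close>. The \<open>\<nu>\<close>-measure grows by at most \<open>A\<^sup>K\<close>, and \<open>\<epsilon>\<close> is chosen so small that the
density at scale \<open>\<rho>\<close> stays below one half during all \<open>K\<close> rounds.\<close>

lemma half_comparable_imp_small:
  fixes C \<zeta> \<xi> :: real
  assumes C: "1 \<le> C" and \<zeta>: "0 < \<zeta>" and \<xi>: "0 < \<xi>"
  obtains \<epsilon> where "0 < \<epsilon>"
    "\<And>(\<nu> :: ('a::euclidean_space) measure) \<nu>' S x\<^sub>0 r E.
       \<lbrakk>finite_measure \<nu>; finite_measure \<nu>'; sets \<nu> = sets borel; sets \<nu>' = sets borel;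
        closed S; emeasure \<nu>' (- S) = 0; x\<^sub>0 \<in> S; 0 < r;
        ball_doubling S x\<^sub>0 (2 * r) (3 * r) C \<nu>; ball_doubling S x\<^sub>0 (2 * r) (3 * r) C \<nu>';
        half_comparable S x\<^sub>0 (2 * r) r \<zeta> \<nu> \<nu>';
        E \<in> sets borel; E \<subseteq> ball x\<^sub>0 r; measure \<nu> E < \<epsilon> * measure \<nu> (ball x\<^sub>0 r)\<rbrakk>
       \<Longrightarrow> measure \<nu>' E \<le> \<xi> * measure \<nu>' (ball x\<^sub>0 r)"
proof -
  define \<theta> where "\<theta> = 1 + \<zeta> / C"
  have \<theta>: "1 < \<theta>" using C \<zeta> by (simp add: \<theta>_def)
  define A where "A = 1 + 2 * C\<^sup>2"
  have A: "1 \<le> A" by (simp add: A_def)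
  obtain k where "C / \<xi> < \<theta> ^ k" using real_arch_pow[OF \<theta>] by blast
  also have "\<theta> ^ k \<le> \<theta> ^ Suc k" using \<theta> by simp
  finally have k: "C < \<xi> * \<theta> ^ Suc k" using \<xi> by (simp add: field_simps)
  define K where "K = Suc k"
  have K: "0 < K" by (simp add: K_def)
  obtain p where p: "3 * real K < 5 ^ p" using real_arch_pow[of 5 "3 * real K"] by auto
  define \<epsilon> where "\<epsilon> = 1 / (2 * A ^ K * C ^ p)"
  have \<epsilon>: "0 < \<epsilon>" using A C by (simp add: \<epsilon>_def)
  show thesis
  proof (rule that[OF \<epsilon>])
    fix \<nu> \<nu>' :: "'a measure" and S x\<^sub>0 r E
    assume fin: "finite_measure \<nu>" "finite_measure \<nu>'" and s[simp]: "sets \<nu> = sets borel" "sets \<nu>' = sets borel"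
      and S: "closed S" "emeasure \<nu>' (- S) = 0" "x\<^sub>0 \<in> S" and r: "0 < r"
      and dbl: "ball_doubling S x\<^sub>0 (2 * r) (3 * r) C \<nu>" "ball_doubling S x\<^sub>0 (2 * r) (3 * r) C \<nu>'"
      and comp: "half_comparable S x\<^sub>0 (2 * r) r \<zeta> \<nu> \<nu>'"
      and E: "E \<in> sets borel" "E \<subseteq> ball x\<^sub>0 r" "measure \<nu> E < \<epsilon> * measure \<nu> (ball x\<^sub>0 r)"
    interpret n0: finite_measure \<nu> by fact
    interpret n1: finite_measure \<nu>' by fact
    define \<rho> where "\<rho> = r / K"
    have \<rho>: "0 < \<rho>" "\<rho> \<le> r" using K r by (auto simp: \<rho>_def field_simps)
    \<comment> \<open>Every ball of radius \<open>\<rho>\<close> in sight has a definite share of the measure of the given ball.\<close>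
    have lower: "measure \<nu> (ball x\<^sub>0 r) \<le> C ^ p * measure \<nu> (ball y \<rho>)" if y: "y \<in> S \<inter> ball x\<^sub>0 (2 * r)" for y
    proof -
      have *: "\<exists>q. 3 * r \<le> 5 ^ q * \<rho> \<and> 5 ^ q * \<rho> \<le> 15 * r \<and> q \<le> p"
      proof -
        define q where "q = (LEAST q. 3 * r \<le> 5 ^ q * \<rho>)"
        have pp: "3 * r \<le> 5 ^ p * \<rho>"
          using p K r by (simp add: \<rho>_def field_simps)
        have 1: "3 * r \<le> 5 ^ q * \<rho>" unfolding q_def by (rule LeastI[where P = "\<lambda>q. 3 * r \<le> 5 ^ q * \<rho>", OF pp])
        have 2: "q \<le> p" unfolding q_def by (rule Least_le[where P = "\<lambda>q. 3 * r \<le> 5 ^ q * \<rho>", OF pp])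
        have "q \<noteq> 0" using 1 \<rho> r by (intro notI) simp
        then obtain q' where q': "q = Suc q'" by (cases q) auto
        then have "\<not> 3 * r \<le> 5 ^ q' * \<rho>"
          using not_less_Least[of q' "\<lambda>q. 3 * r \<le> 5 ^ q * \<rho>"] unfolding q_def by auto
        then have "5 ^ q' * \<rho> \<le> 3 * r" by simp
        with 1 2 q' show ?thesis by (intro exI[of _ q]) (auto simp: mult.commute)
      qed
      then obtain q where q: "3 * r \<le> 5 ^ q * \<rho>" "5 ^ q * \<rho> \<le> 15 * r" "q \<le> p" by blast
      have "ball x\<^sub>0 r \<subseteq> ball y (3 * r)"
      proof
        fix z assume "z \<in> ball x\<^sub>0 r"
        then show "z \<in> ball y (3 * r)" using y dist_triangle[of y z x\<^sub>0] by (auto simp: dist_commute)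
      qed
      also have "\<dots> \<subseteq> ball y (5 ^ q * \<rho>)" using q(1) by (rule subset_ball)
      finally have "measure \<nu> (ball x\<^sub>0 r) \<le> measure \<nu> (ball y (5 ^ q * \<rho>))"
        by (intro n0.finite_measure_mono) auto
      also have "\<dots> \<le> C ^ q * measure \<nu> (ball y \<rho>)"
        using ball_doubling_iterate[OF dbl(1) y \<rho>(1), of q] q(2) C
        by (simp add: n0.emeasure_eq_measure ennreal_mult[symmetric])
      also have "\<dots> \<le> C ^ p * measure \<nu> (ball y \<rho>)"
        using q(3) C by (intro mult_right_mono power_increasing) auto
      finally show ?thesis .
    qed
    have outer: "\<exists>U. open U \<and> E \<subseteq> U \<and> measure \<nu> U < \<epsilon> * measure \<nu> (ball x\<^sub>0 r)"
    proof -
      have "emeasure \<nu> E < ennreal (\<epsilon> * measure \<nu> (ball x\<^sub>0 r))"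
        using E(3) by (simp add: n0.emeasure_eq_measure ennreal_less_iff)
      then have "(INF U\<in>{U. E \<subseteq> U \<and> open U}. emeasure \<nu> U) < ennreal (\<epsilon> * measure \<nu> (ball x\<^sub>0 r))"
        using outer_regular[of \<nu> E] E(1) by simp
      then obtain U where "E \<subseteq> U" "open U" "emeasure \<nu> U < ennreal (\<epsilon> * measure \<nu> (ball x\<^sub>0 r))"
        unfolding INF_less_iff by blast
      then show ?thesis by (auto simp: n0.emeasure_eq_measure ennreal_less_iff)
    qed
    then obtain U where U: "open U" "E \<subseteq> U" "measure \<nu> U < \<epsilon> * measure \<nu> (ball x\<^sub>0 r)" by blast
    define V where "V = U \<inter> ball x\<^sub>0 r"
    have V: "open V" "E \<subseteq> V" "V \<subseteq> ball x\<^sub>0 r" using U E(2) by (auto simp: V_def)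
    have V_small: "measure \<nu> V < \<epsilon> * measure \<nu> (ball x\<^sub>0 r)"
      using U n0.finite_measure_mono[of V U] by (auto simp: V_def)
    have step: "\<exists>W. open W \<and> W \<subseteq> ball x\<^sub>0 (r + j * \<rho>) \<and> measure \<nu> W \<le> A ^ j * measure \<nu> V \<and>
        \<theta> ^ j * measure \<nu>' V \<le> measure \<nu>' W" if "j \<le> K" for j
      using that
    proof (induction j)
      case 0
      then show ?case using V by (intro exI[of _ V]) auto
    next
      case (Suc j)
      then obtain W where W: "open W" "W \<subseteq> ball x\<^sub>0 (r + j * \<rho>)" "measure \<nu> W \<le> A ^ j * measure \<nu> V"
        "\<theta> ^ j * measure \<nu>' V \<le> measure \<nu>' W" by auto
      have jr: "r + j * \<rho> \<le> 2 * r" using Suc.prems r K by (simp add: \<rho>_def field_simps)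
      then have sub: "ball x\<^sub>0 (r + j * \<rho>) \<subseteq> ball x\<^sub>0 (2 * r)" by (rule subset_ball)
      have small: "2 * measure \<nu> W \<le> measure \<nu> (ball y \<rho>)" if "y \<in> S \<inter> ball x\<^sub>0 (r + j * \<rho>)" for y
      proof -
        have "2 * measure \<nu> W \<le> 2 * (A ^ K * measure \<nu> V)"
          using W(3) Suc.prems A
          by (intro mult_left_mono order.trans[OF W(3)] mult_right_mono power_increasing) auto
        also have "\<dots> \<le> 2 * (A ^ K * (\<epsilon> * (C ^ p * measure \<nu> (ball y \<rho>))))"
          using V_small lower[of y] that sub A \<epsilon>
          by (intro mult_left_mono order.trans[OF less_imp_le[OF V_small]]) auto
        also have "\<dots> = measure \<nu> (ball y \<rho>)" using A C by (simp add: \<epsilon>_def field_simps)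
        finally show ?thesis .
      qed
      have d: "ball_doubling S x\<^sub>0 (r + j * \<rho>) \<rho> C n" if "ball_doubling S x\<^sub>0 (2 * r) (3 * r) C n" for n
        unfolding ball_doubling_def
      proof (intro ballI allI impI)
        fix y s assume "y \<in> S \<inter> ball x\<^sub>0 (r + j * \<rho>)" "0 < s \<and> s \<le> \<rho>"
        then have "y \<in> S \<inter> ball x\<^sub>0 (2 * r)" "0 < s \<and> s \<le> 3 * r" using sub \<rho> by auto
        then show "0 < emeasure n (ball y s) \<and> emeasure n (ball y (5 * s)) \<le> ennreal C * emeasure n (ball y s)"
          using that unfolding ball_doubling_def by blast
      qed
      have c: "half_comparable S x\<^sub>0 (r + j * \<rho>) \<rho> \<zeta> \<nu> \<nu>'"
        unfolding half_comparable_def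
      proof (intro ballI allI impI)
        fix y s E assume *: "y \<in> S \<inter> ball x\<^sub>0 (r + j * \<rho>)" "0 < s \<and> s \<le> \<rho>"
          and E: "E \<in> sets borel" "E \<subseteq> ball y s" "measure \<nu> (ball y s) \<le> 2 * measure \<nu> E"
        then have "y \<in> S \<inter> ball x\<^sub>0 (2 * r)" "0 < s \<and> s \<le> r" using sub \<rho> by auto
        then show "\<zeta> * measure \<nu>' (ball y s) \<le> measure \<nu>' E"
          using comp E unfolding half_comparable_def by blast
      qed
      obtain W' where W': "open W'" "W' \<subseteq> ball x\<^sub>0 (r + j * \<rho> + \<rho>)"
        "measure \<nu> W' \<le> A * measure \<nu> W" "\<theta> * measure \<nu>' W \<le> measure \<nu>' W'"
        using enlarge_open_set[OF fin s S(1,2) C \<zeta> \<rho>(1) d[OF dbl(1)] d[OF dbl(2)] c W(1,2) small]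
        unfolding A_def \<theta>_def by blast
      have "measure \<nu> W' \<le> A * (A ^ j * measure \<nu> V)"
        using A by (intro order.trans[OF W'(3)] mult_left_mono W(3)) auto
      moreover have "\<theta> * (\<theta> ^ j * measure \<nu>' V) \<le> measure \<nu>' W'"
        using \<theta> by (intro order.trans[OF _ W'(4)] mult_left_mono W(4)) auto
      ultimately show ?case using W'(1,2) by (intro exI[of _ W']) (auto simp: algebra_simps)
    qed
    obtain W where W: "open W" "W \<subseteq> ball x\<^sub>0 (r + K * \<rho>)" "\<theta> ^ K * measure \<nu>' V \<le> measure \<nu>' W"
      using step[of K] by blast
    have "\<theta> ^ K * measure \<nu>' E \<le> \<theta> ^ K * measure \<nu>' V"
      using V E \<theta> by (intro mult_left_mono n1.finite_measure_mono) auto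
    also have "\<dots> \<le> measure \<nu>' (ball x\<^sub>0 (5 * r))"
      using W K r by (intro order.trans[OF W(3)] n1.finite_measure_mono order.trans[OF W(2)] subset_ball) (auto simp: \<rho>_def)
    also have "\<dots> \<le> C * measure \<nu>' (ball x\<^sub>0 r)"
    proof -
      have "emeasure \<nu>' (ball x\<^sub>0 (5 * r)) \<le> ennreal C * emeasure \<nu>' (ball x\<^sub>0 r)"
        using dbl(2) S(3) r unfolding ball_doubling_def by auto
      then show ?thesis using C by (simp add: n1.emeasure_eq_measure ennreal_mult[symmetric])
    qed
    also have "\<dots> \<le> \<theta> ^ K * (\<xi> * measure \<nu>' (ball x\<^sub>0 r))"
    proof -
      have "C * measure \<nu>' (ball x\<^sub>0 r) \<le> (\<xi> * \<theta> ^ K) * measure \<nu>' (ball x\<^sub>0 r)"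
        using k unfolding K_def by (intro mult_right_mono) auto
      then show ?thesis by (simp add: mult_ac)
    qed
    finally show "measure \<nu>' E \<le> \<xi> * measure \<nu>' (ball x\<^sub>0 r)" using \<theta> by simp
  qed
qed

section \<open>Families of measures with poles\<close>

text \<open>The flag \<open>b\<close> tells whether poles matter, which is the case as soon as an elliptic measure is involved.
Single measures are treated as constant families, for which \<open>b\<close> is \<open>False\<close> and every \<open>P\<close> is admissible.\<close>

definition admissible :: "bool \<Rightarrow> (real^'n) set \<Rightarrow> real \<Rightarrow> real^'n \<Rightarrow> real \<Rightarrow> real^'n \<Rightarrow> bool" where
  "admissible b \<Omega> \<kappa> x r P \<longleftrightarrow> (b \<longrightarrow> P \<in> \<Omega> \<and> \<kappa> * r \<le> dist x P)"

text \<open>What is kept of elliptic and of doubling measures. The measures live on the whole space and give no mass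
to the complement of the boundary, so that Euclidean balls can replace boundary balls.\<close>

definition doubling_family :: "bool \<Rightarrow> (real^'n) set \<Rightarrow> real \<Rightarrow> (real^'n \<Rightarrow> (real^'n) measure) \<Rightarrow> bool" where
  "doubling_family b \<Omega> C \<nu> \<longleftrightarrow>
     (\<forall>P. (b \<longrightarrow> P \<in> \<Omega>) \<longrightarrow>
        sets (\<nu> P) = sets borel \<and> emeasure (\<nu> P) (- frontier \<Omega>) = 0 \<and> sigma_finite_measure (\<nu> P)) \<and>
     (\<forall>x\<in>frontier \<Omega>. \<forall>r>0. \<forall>P. admissible b \<Omega> 3 x r P \<longrightarrow>
        0 < emeasure (\<nu> P) (ball x r) \<and> emeasure (\<nu> P) (ball x r) < \<infinity> \<and>
        emeasure (\<nu> P) (ball x (2 * r)) \<le> ennreal C * emeasure (\<nu> P) (ball x r))"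

definition carleson_bound ::
    "bool \<Rightarrow> (real^'n) set \<Rightarrow> (real^'n) measure \<Rightarrow> (real^'n \<Rightarrow> (real^'n) measure) \<Rightarrow> real \<Rightarrow> bool" where
  "carleson_bound b \<Omega> H \<nu> M \<longleftrightarrow>
     (\<forall>x\<in>frontier \<Omega>. \<forall>r>0. \<forall>P. admissible b \<Omega> 2 x r P \<longrightarrow>
        (\<integral>\<^sup>+y\<in>ball x r. emeasure H (cone \<Omega> r y) \<partial>\<nu> P) \<le> ennreal M * emeasure (\<nu> P) (ball x r))"

lemma admissible_shift:
  assumes "admissible b \<Omega> \<kappa> x r P" "\<kappa>' * r' + dist x y \<le> \<kappa> * r"
  shows "admissible b \<Omega> \<kappa>' y r' P"
  using assms dist_triangle[of x P y] by (auto simp: admissible_def)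

lemma doubling_familyD:
  assumes "doubling_family b \<Omega> C \<nu>" "admissible b \<Omega> \<kappa> x r P"
  shows "sets (\<nu> P) = sets borel" "emeasure (\<nu> P) (- frontier \<Omega>) = 0" "sigma_finite_measure (\<nu> P)"
  using assms by (auto simp: doubling_family_def admissible_def)

lemma doubling_family_ball:
  assumes "doubling_family b \<Omega> C \<nu>" "x \<in> frontier \<Omega>" "0 < r" "admissible b \<Omega> 3 x r P"
  shows "0 < emeasure (\<nu> P) (ball x r)" "emeasure (\<nu> P) (ball x r) < \<infinity>"
    "emeasure (\<nu> P) (ball x (2 * r)) \<le> ennreal C * emeasure (\<nu> P) (ball x r)"
  using assms unfolding doubling_family_def by blast+

lemma doubling_family_iterate:
  assumes fam: "doubling_family b \<Omega> C \<nu>" and C: "1 \<le> C" and x: "x \<in> frontier \<Omega>" "0 < r"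
    and adm: "admissible b \<Omega> (3/2) x (2 ^ k * r) P"
  shows "emeasure (\<nu> P) (ball x (2 ^ k * r)) \<le> ennreal (C ^ k) * emeasure (\<nu> P) (ball x r)"
  using adm
proof (induction k)
  case (Suc k)
  have "0 < 2 ^ k * r" using x by simp
  have a: "admissible b \<Omega> 3 x (2 ^ k * r) P"
    using Suc.prems by (auto simp: admissible_def mult_ac)
  have "admissible b \<Omega> (3/2) x (2 ^ k * r) P"
    using a \<open>0 < 2 ^ k * r\<close> unfolding admissible_def by auto
  note IH = Suc.IH[OF this]
  have "emeasure (\<nu> P) (ball x (2 * (2 ^ k * r))) \<le> ennreal C * emeasure (\<nu> P) (ball x (2 ^ k * r))"
    by (rule doubling_family_ball[OF fam x(1) \<open>0 < 2 ^ k * r\<close> a])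
  also have "\<dots> \<le> ennreal C * (ennreal (C ^ k) * emeasure (\<nu> P) (ball x r))"
    by (intro mult_left_mono IH) auto
  finally show ?case using C by (simp add: ennreal_mult mult_ac)
qed simp

lemma continuous_bdist [continuous_intros]: "continuous_on A f \<Longrightarrow> continuous_on A (\<lambda>z. bdist \<Omega> (f z))"
  unfolding bdist_def by (rule continuous_on_infdist)

lemma borel_measurable_bdist [measurable]: "bdist \<Omega> \<in> borel_measurable borel"
  by (intro borel_measurable_continuous_onI continuous_intros)

lemma bdist_nonneg: "0 \<le> bdist \<Omega> X"
  by (simp add: bdist_def infdist_nonneg)

lemma bdist_le: "y \<in> frontier \<Omega> \<Longrightarrow> bdist \<Omega> X \<le> dist X y"
  unfolding bdist_def by (rule infdist_le)

lemma bdist_lipschitz: "bdist \<Omega> X \<le> bdist \<Omega> Y + dist X Y"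
  unfolding bdist_def by (rule infdist_triangle)

lemma nearest_boundary_point:
  assumes "frontier \<Omega> \<noteq> {}"
  obtains x where "x \<in> frontier \<Omega>" "dist X x = bdist \<Omega> X"
  using infdist_attains_inf[OF frontier_closed assms, of X] unfolding bdist_def by metis

lemma bdist_pos:
  assumes "open \<Omega>" "frontier \<Omega> \<noteq> {}" "X \<in> \<Omega>"
  shows "0 < bdist \<Omega> X"
proof -
  obtain x where x: "x \<in> frontier \<Omega>" "dist X x = bdist \<Omega> X" using nearest_boundary_point[OF assms(2)] .
  have "x \<noteq> X" using x(1) assms by (auto simp: frontier_def interior_open)
  then show ?thesis using x(2) by (metis zero_less_dist_iff)
qed

section \<open>Cones, shadows and Fubini\<close>

text \<open>The points \<open>y\<close> whose cone, with no restriction on the height, contains \<open>X\<close>.\<close>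

definition shadow :: "(real^'n) set \<Rightarrow> real^'n \<Rightarrow> (real^'n) set" where
  "shadow \<Omega> X = cball X (2 * bdist \<Omega> X)"

text \<open>The part in \<open>D\<close> of the untruncated cone with apex \<open>y\<close>. Cones are the case where \<open>D\<close> is a sublevel set of
the distance to the boundary; the more general \<open>D\<close> serve for the bad points in \<open>carleson_step\<close>.\<close>

definition fiber :: "(real^'n) set \<Rightarrow> (real^'n) set \<Rightarrow> real^'n \<Rightarrow> (real^'n) set" where
  "fiber \<Omega> D y = {X \<in> D. y \<in> shadow \<Omega> X}"

lemma cone_eq_fiber: "cone \<Omega> r y = fiber \<Omega> {X \<in> \<Omega>. bdist \<Omega> X \<le> r} y"
  by (auto simp: cone_def fiber_def shadow_def)

lemma shadow_relation_measurable:
  "{p. snd p \<in> shadow \<Omega> (fst p)} \<in> sets (borel \<Otimes>\<^sub>M borel)"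
  "{p. fst p \<in> shadow \<Omega> (snd p)} \<in> sets (borel \<Otimes>\<^sub>M borel)"
  unfolding borel_prod shadow_def mem_cball
  by (intro borel_closed closed_Collect_le continuous_intros)+

lemma fiber_borel [measurable]: "D \<in> sets borel \<Longrightarrow> fiber \<Omega> D y \<in> sets borel"
proof -
  assume [measurable]: "D \<in> sets borel"
  have "fiber \<Omega> D y = D \<inter> {X. dist X y \<le> 2 * bdist \<Omega> X}" by (auto simp: fiber_def shadow_def)
  moreover have "closed {X. dist X y \<le> 2 * bdist \<Omega> X}"
    by (intro closed_Collect_le continuous_intros)
  ultimately show ?thesis by auto
qed

lemma shadow_borel [measurable]: "shadow \<Omega> X \<in> sets borel"
  by (simp add: shadow_def)

lemma cone_base_borel [measurable]: "open \<Omega> \<Longrightarrow> {X \<in> \<Omega>. bdist \<Omega> X \<le> r} \<in> sets borel"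
proof -
  assume [measurable_dest]: "open \<Omega>"
  then have [measurable]: "\<Omega> \<in> sets borel" by auto
  have "{X \<in> \<Omega>. bdist \<Omega> X \<le> r} = \<Omega> \<inter> {X \<in> space borel. bdist \<Omega> X \<le> r}" by auto
  also have "\<dots> \<in> sets borel" by measurable
  finally show ?thesis .
qed

lemma borel_measurable_emeasure_fiber:
  assumes "sigma_finite_measure H" and [measurable_cong, simp]: "sets H = sets borel"
    and [measurable]: "D \<in> sets borel"
  shows "(\<lambda>y. emeasure H (fiber \<Omega> D y)) \<in> borel_measurable borel"
proof -
  interpret sigma_finite_measure H by fact
  have "(UNIV \<times> D) \<inter> {p. fst p \<in> shadow \<Omega> (snd p)} \<in> sets (borel \<Otimes>\<^sub>M H)"
    using shadow_relation_measurable(2)[of \<Omega>] sets_pair_measure_cong[OF refl assms(2), of borel] by auto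
  from measurable_emeasure_Pair[OF this] show ?thesis
    by (rule back_subst[of "\<lambda>f. f \<in> borel_measurable borel"]) (auto simp: fiber_def intro!: ext arg_cong[of _ _ "emeasure H"])
qed

lemma borel_measurable_emeasure_shadow:
  assumes "sigma_finite_measure \<nu>" and [measurable_cong, simp]: "sets \<nu> = sets borel"
    and [measurable]: "B \<in> sets borel"
  shows "(\<lambda>X. emeasure \<nu> (B \<inter> shadow \<Omega> X)) \<in> borel_measurable borel"
proof -
  interpret sigma_finite_measure \<nu> by fact
  have "(UNIV \<times> B) \<inter> {p. snd p \<in> shadow \<Omega> (fst p)} \<in> sets (borel \<Otimes>\<^sub>M \<nu>)"
    using shadow_relation_measurable(1)[of \<Omega>] sets_pair_measure_cong[OF refl assms(2), of borel] by auto
  from measurable_emeasure_Pair[OF this] show ?thesis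
    by (rule back_subst[of "\<lambda>f. f \<in> borel_measurable borel"]) (auto intro!: ext arg_cong[of _ _ "emeasure \<nu>"])
qed

lemma integral_fiber_eq_integral_shadow:
  fixes \<Omega> :: "(real^'n) set"
  assumes H: "sigma_finite_measure H" and [measurable_cong, simp]: "sets H = sets borel"
    and \<nu>: "sigma_finite_measure \<nu>" and [measurable_cong, simp]: "sets \<nu> = sets borel"
    and [measurable]: "D \<in> sets borel" "B \<in> sets borel"
  shows "(\<integral>\<^sup>+y\<in>B. emeasure H (fiber \<Omega> D y) \<partial>\<nu>) = (\<integral>\<^sup>+X\<in>D. emeasure \<nu> (B \<inter> shadow \<Omega> X) \<partial>H)"
proof -
  interpret pair_sigma_finite H \<nu> by (intro pair_sigma_finite.intro H \<nu>)
  define f :: "real^'n \<Rightarrow> real^'n \<Rightarrow> ennreal"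
    where "f X y = indicator {p. snd p \<in> shadow \<Omega> (fst p)} (X, y) * (indicator D X * indicator B y)" for X y
  have "{p. snd p \<in> shadow \<Omega> (fst p)} \<in> sets (H \<Otimes>\<^sub>M \<nu>)"
    using shadow_relation_measurable(1)[of \<Omega>] sets_pair_measure_cong[OF assms(2,4)] by simp
  then have "case_prod f \<in> borel_measurable (H \<Otimes>\<^sub>M \<nu>)"
    unfolding f_def case_prod_beta by measurable
  then have *: "(\<integral>\<^sup>+y. \<integral>\<^sup>+X. f X y \<partial>H \<partial>\<nu>) = (\<integral>\<^sup>+X. \<integral>\<^sup>+y. f X y \<partial>\<nu> \<partial>H)" by (rule Fubini')
  have "(\<integral>\<^sup>+X. f X y \<partial>H) = emeasure H (fiber \<Omega> D y) * indicator B y" for y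
  proof -
    have "f X y = indicator (fiber \<Omega> D y) X * indicator B y" for X
      by (auto simp: f_def fiber_def indicator_def)
    then show ?thesis by (simp add: nn_integral_multc)
  qed
  moreover have "(\<integral>\<^sup>+y. f X y \<partial>\<nu>) = emeasure \<nu> (B \<inter> shadow \<Omega> X) * indicator D X" for X
  proof -
    have "f X y = indicator (B \<inter> shadow \<Omega> X) y * indicator D X" for y
      by (auto simp: f_def indicator_def)
    then show ?thesis by (simp add: nn_integral_multc)
  qed
  ultimately show ?thesis using * by simp
qed

lemma frontier_borel [measurable]: "frontier \<Omega> \<in> sets borel"
  by (simp add: borel_closed)

section \<open>Absorbing the Carleson constant\<close>

text \<open>The heart of the matter: if the cone masses are at most \<open>N\<close> on a subset \<open>F\<close> that exhausts the doubled ball up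
to a proportion \<open>\<epsilon>\<close>, then a known Carleson constant \<open>K\<close> enters the bound for low cones only with the
factor \<open>\<epsilon>\<close>. By Fubini the integral is one of \<open>\<nu>(ball x r \<inter> shadow X)\<close> over \<open>X\<close>. If \<open>F\<close> fills half
of the shadow of \<open>X\<close>, the integrand is at most \<open>2 \<nu>(F \<inter> shadow X)\<close>, and reading Fubini backwards
gives the term with \<open>N\<close>. The remaining, bad points are grouped by Vitali's lemma into boxes over disjoint shadows, each box
costs \<open>K\<close> times the measure of its shadow, and the shadow is half filled by the complement of \<open>F\<close>.

Restricting to heights \<open>\<le> r / 8\<close> keeps the shadows of bad points inside the doubled ball; the factor 128
leaves ample room for the pole to be admissible for all the smaller balls that occur.\<close>

lemma carleson_step:
  fixes \<Omega> :: "(real^'n) set"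
  assumes fam: "doubling_family b \<Omega> C \<nu>" and C: "1 \<le> C" and \<Omega>: "open \<Omega>" "frontier \<Omega> \<noteq> {}"
    and H: "finite_measure H" and sets_H [measurable_cong, simp]: "sets H = sets borel"
    and K: "carleson_bound b \<Omega> H \<nu> K" "0 \<le> K"
    and x: "x \<in> frontier \<Omega>" "0 < r" and adm: "admissible b \<Omega> 128 x r P"
    and F [measurable]: "F \<in> sets borel" and F_sub: "F \<subseteq> ball x (2 * r)"
    and F_large: "emeasure (\<nu> P) (ball x (2 * r) - F) \<le> ennreal \<epsilon> * emeasure (\<nu> P) (ball x (2 * r))"
    and F_bound: "\<And>y. y \<in> F \<Longrightarrow> emeasure H (cone \<Omega> r y) \<le> ennreal N" and N: "0 \<le> N" and \<epsilon>: "0 \<le> \<epsilon>"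
  shows "(\<integral>\<^sup>+y\<in>ball x r. emeasure H (cone \<Omega> (r / 8) y) \<partial>\<nu> P)
    \<le> ennreal (2 * C * N + 2 * C ^ 5 * \<epsilon> * K) * emeasure (\<nu> P) (ball x r)"
proof -
  interpret H: finite_measure H by fact
  note sets_\<nu> [measurable_cong, simp] = doubling_familyD(1)[OF fam adm]
  note sf = doubling_familyD(3)[OF fam adm]
  have sfH: "sigma_finite_measure H" by (rule H.sigma_finite_measure_axioms)
  note [measurable] = \<Omega>(1)[THEN borel_open]
  define D where "D = {X \<in> \<Omega>. bdist \<Omega> X \<le> r / 8}"
  have D [measurable]: "D \<in> sets borel" unfolding D_def using \<Omega>(1) by (rule cone_base_borel)
  define n where "n = emeasure (\<nu> P)"
  note meas_shadow [measurable] = borel_measurable_emeasure_shadow[OF sf sets_\<nu>, of _ \<Omega>, folded n_def]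
  have meas_shadow' [measurable]: "(\<lambda>X. n (shadow \<Omega> X)) \<in> borel_measurable borel"
    using meas_shadow[of UNIV] by simp
  define Bad where "Bad = {X \<in> D. 0 < n (ball x r \<inter> shadow \<Omega> X) \<and> 2 * n (F \<inter> shadow \<Omega> X) < n (shadow \<Omega> X)}"
  have Bad [measurable]: "Bad \<in> sets borel"
  proof -
    have "Bad = D \<inter> {X \<in> space borel. 0 < n (ball x r \<inter> shadow \<Omega> X) \<and> 2 * n (F \<inter> shadow \<Omega> X) < n (shadow \<Omega> X)}"
      by (auto simp: Bad_def)
    also have "\<dots> \<in> sets borel" by measurable
    finally show ?thesis .
  qed
  have r_adm: "admissible b \<Omega> 3 x r P" using adm x by (auto simp: admissible_def)
  have dbl_r: "n (ball x (2 * r)) \<le> ennreal C * n (ball x r)"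
    unfolding n_def by (rule doubling_family_ball[OF fam x r_adm])

  have dist_Bad: "dist x X \<le> r + 2 * bdist \<Omega> X" if "X \<in> Bad" for X
  proof -
    have "ball x r \<inter> shadow \<Omega> X \<noteq> {}" using that by (auto simp: Bad_def n_def)
    then obtain z where "dist x z < r" "dist X z \<le> 2 * bdist \<Omega> X" by (auto simp: shadow_def)
    then show ?thesis using dist_triangle[of x X z] by (simp add: dist_commute)
  qed
  have \<delta>_Bad: "0 < bdist \<Omega> X" "bdist \<Omega> X \<le> r / 8" if "X \<in> Bad" for X
    using that bdist_pos[OF \<Omega>, of X] by (auto simp: Bad_def D_def)
  have shadow_sub: "shadow \<Omega> X \<subseteq> ball x (2 * r)" if "X \<in> Bad" for X
  proof
    fix z assume "z \<in> shadow \<Omega> X"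
    then have "dist X z \<le> 2 * bdist \<Omega> X" by (simp add: shadow_def)
    then show "z \<in> ball x (2 * r)"
      using dist_Bad[OF that] \<delta>_Bad[OF that] dist_triangle[of x z X] x(2) by simp
  qed
  have outside_F: "n (shadow \<Omega> X) \<le> 2 * n (shadow \<Omega> X - F)" if X: "X \<in> Bad" for X
  proof -
    have split: "n (shadow \<Omega> X) = n (F \<inter> shadow \<Omega> X) + n (shadow \<Omega> X - F)"
      unfolding n_def by (subst plus_emeasure) (auto intro!: arg_cong[of _ _ "emeasure (\<nu> P)"])
    have "2 * n (F \<inter> shadow \<Omega> X) < n (F \<inter> shadow \<Omega> X) + n (shadow \<Omega> X - F)"
      using X split by (simp add: Bad_def)
    then have "n (F \<inter> shadow \<Omega> X) \<le> n (shadow \<Omega> X - F)"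
      using add_left_mono[of "n (shadow \<Omega> X - F)" "n (F \<inter> shadow \<Omega> X)" "n (F \<inter> shadow \<Omega> X)"]
      unfolding mult_2 by (meson leD le_cases)
    then show ?thesis unfolding split by (metis add_right_mono mult_2)
  qed

  \<comment> \<open>The box of \<open>j\<close> is the set \<open>A j\<close> of points whose shadow lies in the shadow of \<open>j\<close> dilated five times.
    The whole box is seen from the boundary ball of radius \<open>12 d\<close> about a boundary point \<open>z\<close> nearest to
    \<open>j\<close>, through cones of height \<open>12 d\<close>, so the constant \<open>K\<close> applies to it.\<close>
  have bad_part: "(\<integral>\<^sup>+X\<in>Bad. n (shadow \<Omega> X) \<partial>H) \<le> ennreal (2 * K * C ^ 4) * n (ball x (2 * r) - F)"
  proof -
    obtain J where J: "countable J" "J \<subseteq> Bad"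
        "pairwise (\<lambda>i j. disjnt (shadow \<Omega> i) (shadow \<Omega> j)) J"
        and cov: "\<And>i. i \<in> Bad \<Longrightarrow> \<exists>j. j \<in> J \<and> \<not> disjnt (shadow \<Omega> i) (shadow \<Omega> j) \<and>
           shadow \<Omega> i \<subseteq> ball j (5 * (2 * bdist \<Omega> j))"
    proof (rule Vitali_covering_lemma_cballs_balls[where K = Bad and a = "\<lambda>X. X" and r = "\<lambda>X. 2 * bdist \<Omega> X" and B = "r / 4"])
      show "0 < 2 * bdist \<Omega> i \<and> 2 * bdist \<Omega> i \<le> r / 4" if "i \<in> Bad" for i
        using \<delta>_Bad[OF that] by auto
    qed (simp add: that flip: shadow_def)
    define A where "A j = {X \<in> \<Omega>. dist X j + 2 * bdist \<Omega> X \<le> 10 * bdist \<Omega> j}" for j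
    have A [measurable]: "A j \<in> sets borel" for j
    proof -
      have "A j = \<Omega> \<inter> {X. dist X j + 2 * bdist \<Omega> X \<le> 10 * bdist \<Omega> j}" by (auto simp: A_def)
      moreover have "closed {X. dist X j + 2 * bdist \<Omega> X \<le> 10 * bdist \<Omega> j}"
        by (intro closed_Collect_le continuous_intros)
      ultimately show ?thesis by auto
    qed
    define \<eta> where "\<eta> = density H (\<lambda>X. n (shadow \<Omega> X))"
    have sets_\<eta> [simp]: "sets \<eta> = sets borel" by (simp add: \<eta>_def)
    have \<eta>: "emeasure \<eta> X = (\<integral>\<^sup>+X\<in>X. n (shadow \<Omega> X) \<partial>H)" if "X \<in> sets borel" for X
      unfolding \<eta>_def using that by (subst emeasure_density) auto
    have "emeasure \<eta> Bad \<le> ennreal (2 * K * C ^ 4) * emeasure (\<nu> P) (ball x (2 * r) - F)"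
    proof (rule emeasure_le_by_disjoint_family[where A = A and B = "\<lambda>j. shadow \<Omega> j - F", OF J(1)])
      show "disjoint_family_on (\<lambda>j. shadow \<Omega> j - F) J"
        using J(3) by (auto simp: disjoint_family_on_def pairwise_def disjnt_def)
      show "Bad \<subseteq> (\<Union>j\<in>J. A j)"
      proof
        fix X assume X: "X \<in> Bad"
        then obtain j where j: "j \<in> J" "cball X (2 * bdist \<Omega> X) \<subseteq> ball j (10 * bdist \<Omega> j)"
          using cov[OF X] by (auto simp: shadow_def)
        then have "dist X j + 2 * bdist \<Omega> X < 10 * bdist \<Omega> j"
          using \<delta>_Bad[OF X] unfolding cball_subset_ball_iff by auto
        then have "X \<in> A j" using X by (simp add: A_def Bad_def D_def)
        then show "X \<in> (\<Union>j\<in>J. A j)" using j(1) by blast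
      qed
      show "shadow \<Omega> j - F \<subseteq> ball x (2 * r) - F" if "j \<in> J" for j
        using shadow_sub J(2) that by blast
      fix j assume "j \<in> J"
      then have j: "j \<in> Bad" using J(2) by auto
      define d where "d = bdist \<Omega> j"
      have d: "0 < d" "d \<le> r / 8" using \<delta>_Bad[OF j] by (auto simp: d_def)
      obtain z where z: "z \<in> frontier \<Omega>" "dist j z = d"
        using nearest_boundary_point[OF \<Omega>(2), of j] unfolding d_def by blast
      have dist_xz: "dist x z \<le> r + 3 * d"
        using dist_Bad[OF j] z(2) dist_triangle[of x z j] by (simp add: d_def)
      have adm_z: "admissible b \<Omega> 2 z (12 * d) P"
        using d dist_xz by (intro admissible_shift[OF adm]) simp
      have "emeasure \<eta> (A j) = (\<integral>\<^sup>+X\<in>A j. n (UNIV \<inter> shadow \<Omega> X) \<partial>H)"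
        using \<eta>[of "A j"] by simp
      also have "\<dots> = (\<integral>\<^sup>+y\<in>UNIV. emeasure H (fiber \<Omega> (A j) y) \<partial>\<nu> P)"
        unfolding n_def by (intro integral_fiber_eq_integral_shadow[symmetric] sfH sf) auto
      also have "\<dots> \<le> (\<integral>\<^sup>+y\<in>ball z (12 * d). emeasure H (cone \<Omega> (12 * d) y) \<partial>\<nu> P)"
      proof (intro nn_integral_mono)
        fix y
        show "emeasure H (fiber \<Omega> (A j) y) * indicator UNIV y
            \<le> emeasure H (cone \<Omega> (12 * d) y) * indicator (ball z (12 * d)) y"
        proof (cases "fiber \<Omega> (A j) y = {}")
          case False
          then obtain X where X: "X \<in> A j" "dist X y \<le> 2 * bdist \<Omega> X" by (auto simp: fiber_def shadow_def)
          have "dist z y \<le> dist z j + dist j X + dist X y"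
            using dist_triangle[of z y j] dist_triangle[of j y X] by simp
          also have "\<dots> < 12 * d" using X z(2) d by (simp add: A_def d_def dist_commute)
          finally have "y \<in> ball z (12 * d)" by simp
          moreover have "fiber \<Omega> (A j) y \<subseteq> cone \<Omega> (12 * d) y"
          proof
            fix X assume "X \<in> fiber \<Omega> (A j) y"
            then have "X \<in> \<Omega>" "dist X y \<le> 2 * bdist \<Omega> X" "dist X j + 2 * bdist \<Omega> X \<le> 10 * d"
              by (auto simp: fiber_def shadow_def A_def d_def)
            moreover then have "2 * bdist \<Omega> X \<le> 2 * (12 * d)" using d zero_le_dist[of X j] by linarith
            ultimately show "X \<in> cone \<Omega> (12 * d) y" by (simp add: cone_def)
          qed
          ultimately show ?thesis
            using \<Omega>(1) by (auto intro!: emeasure_mono simp: cone_eq_fiber)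
        qed simp
      qed
      also have "\<dots> \<le> ennreal K * n (ball z (12 * d))"
        using K(1) z(1) d adm_z unfolding carleson_bound_def n_def by simp
      \<comment> \<open>Four doublings lead from \<open>3/4 d\<close> to \<open>12 d\<close>, and the ball of radius \<open>3/4 d\<close> about \<open>z\<close> lies in the
        shadow of \<open>j\<close>.\<close>
      also have "n (ball z (12 * d)) \<le> ennreal (C ^ 4) * n (ball z (3/4 * d))"
      proof -
        have "(2::real) ^ 4 * (3/4 * d) = 12 * d" by simp
        moreover have "admissible b \<Omega> (3/2) z (12 * d) P"
          using adm_z d by (auto simp: admissible_def)
        ultimately show ?thesis
          using doubling_family_iterate[OF fam C z(1), of "3/4 * d" 4 P] d unfolding n_def by simp
      qed
      also have "n (ball z (3/4 * d)) \<le> n (shadow \<Omega> j)"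
        unfolding n_def
      proof (rule emeasure_mono)
        show "ball z (3/4 * d) \<subseteq> shadow \<Omega> j"
        proof
          fix y assume "y \<in> ball z (3/4 * d)"
          then show "y \<in> shadow \<Omega> j" using z(2) d dist_triangle[of j y z] by (simp add: shadow_def flip: d_def)
        qed
      qed simp
      also have "n (shadow \<Omega> j) \<le> 2 * n (shadow \<Omega> j - F)" by (rule outside_F[OF j])
      finally have "emeasure \<eta> (A j) \<le> ennreal K * (ennreal (C ^ 4) * (2 * n (shadow \<Omega> j - F)))"
        by (simp add: mult_left_mono)
      also have "\<dots> = ennreal (2 * K * C ^ 4) * emeasure (\<nu> P) (shadow \<Omega> j - F)"
        using K(2) C by (simp add: n_def ennreal_mult mult_ac)
      finally show "emeasure \<eta> (A j) \<le> ennreal (2 * K * C ^ 4) * emeasure (\<nu> P) (shadow \<Omega> j - F)" .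
    qed simp_all
    then show ?thesis by (simp add: \<eta> n_def)
  qed

  have "(\<integral>\<^sup>+y\<in>ball x r. emeasure H (cone \<Omega> (r / 8) y) \<partial>\<nu> P) = (\<integral>\<^sup>+X\<in>D. n (ball x r \<inter> shadow \<Omega> X) \<partial>H)"
    unfolding n_def D_def cone_eq_fiber using \<Omega>(1)
    by (intro integral_fiber_eq_integral_shadow sfH sf) auto
  also have "\<dots> \<le> (\<integral>\<^sup>+X. 2 * (n (F \<inter> shadow \<Omega> X) * indicator D X) + n (shadow \<Omega> X) * indicator Bad X \<partial>H)"
  proof (rule nn_integral_mono)
    fix X
    have le: "n (ball x r \<inter> shadow \<Omega> X) \<le> n (shadow \<Omega> X)" unfolding n_def by (intro emeasure_mono) auto
    show "n (ball x r \<inter> shadow \<Omega> X) * indicator D X \<le>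
        2 * (n (F \<inter> shadow \<Omega> X) * indicator D X) + n (shadow \<Omega> X) * indicator Bad X"
    proof (cases "X \<in> Bad")
      case True
      then show ?thesis using le by (auto simp: Bad_def intro: order.trans[OF le] add_increasing)
    next
      case False
      then show ?thesis
        using le by (auto simp: Bad_def indicator_def not_less intro: order.trans)
    qed
  qed
  also have "\<dots> = 2 * (\<integral>\<^sup>+X\<in>D. n (F \<inter> shadow \<Omega> X) \<partial>H) + (\<integral>\<^sup>+X\<in>Bad. n (shadow \<Omega> X) \<partial>H)"
    by (subst nn_integral_add) (auto simp: nn_integral_cmult)
  also have "(\<integral>\<^sup>+X\<in>D. n (F \<inter> shadow \<Omega> X) \<partial>H) = (\<integral>\<^sup>+y\<in>F. emeasure H (fiber \<Omega> D y) \<partial>\<nu> P)"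
    unfolding n_def by (intro integral_fiber_eq_integral_shadow[symmetric] sfH sf) auto
  also have "\<dots> \<le> (\<integral>\<^sup>+y\<in>F. ennreal N \<partial>\<nu> P)"
  proof (intro nn_integral_mono)
    fix y
    have "emeasure H (fiber \<Omega> D y) \<le> emeasure H (cone \<Omega> r y)"
    proof (rule emeasure_mono)
      show "fiber \<Omega> D y \<subseteq> cone \<Omega> r y" using x(2) by (auto simp: cone_eq_fiber fiber_def D_def)
      show "cone \<Omega> r y \<in> sets H" unfolding cone_eq_fiber using \<Omega>(1) by simp
    qed
    then show "emeasure H (fiber \<Omega> D y) * indicator F y \<le> ennreal N * indicator F y"
      using F_bound[of y] by (auto simp: indicator_def)
  qed
  also have "\<dots> = ennreal N * n F" by (simp add: nn_integral_cmult_indicator n_def)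
  also have "n F \<le> n (ball x (2 * r))" unfolding n_def using F_sub by (intro emeasure_mono) auto
  also note dbl_r
  also note bad_part
  also have "n (ball x (2 * r) - F) \<le> ennreal \<epsilon> * n (ball x (2 * r))" using F_large by (simp add: n_def)
  also note dbl_r
  finally have "(\<integral>\<^sup>+y\<in>ball x r. emeasure H (cone \<Omega> (r / 8) y) \<partial>\<nu> P)
    \<le> 2 * (ennreal N * (ennreal C * n (ball x r))) + ennreal (2 * K * C ^ 4) * (ennreal \<epsilon> * (ennreal C * n (ball x r)))"
    by (simp add: mult_left_mono add_mono)
  also have "\<dots> = (2 * (ennreal N * ennreal C) + ennreal (2 * K * C ^ 4) * (ennreal \<epsilon> * ennreal C)) * n (ball x r)"
    by (simp add: algebra_simps)
  also have "2 * (ennreal N * ennreal C) + ennreal (2 * K * C ^ 4) * (ennreal \<epsilon> * ennreal C)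
     = ennreal (2 * C * N + 2 * C ^ 5 * \<epsilon> * K)"
  proof -
    have "2 * (ennreal N * ennreal C) = ennreal (2 * (N * C))"
      using C N by (simp add: ennreal_mult)
    moreover have "ennreal (2 * K * C ^ 4) * (ennreal \<epsilon> * ennreal C) = ennreal (2 * K * C ^ 4 * (\<epsilon> * C))"
      using C K \<epsilon> by (simp add: ennreal_mult)
    ultimately show ?thesis
      using C K \<epsilon> N by (simp add: ennreal_plus[symmetric] algebra_simps eval_nat_numeral del: ennreal_plus)
  qed
  finally show ?thesis by (simp add: n_def)
qed

text \<open>Passing from mean bounds on small balls to a mean bound on a large one, for an arbitrary nonnegative
function. It lets poles that are merely outside the double ball be treated: they are far away
relative to sufficiently small balls. The margin \<open>\<rho> / 5\<close> is due to small balls that stick out of the large one.\<close>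

lemma integral_le_of_small_balls:
  fixes \<nu> :: "('a::euclidean_space) measure"
  assumes sets_\<nu> [measurable_cong, simp]: "sets \<nu> = sets borel"
    and S [measurable]: "S \<in> sets borel" and null: "emeasure \<nu> (- S) = 0" and \<rho>: "0 < \<rho>"
    and dbl: "\<And>y. y \<in> S \<inter> ball x r \<Longrightarrow> emeasure \<nu> (ball y \<rho>) \<le> ennreal A * emeasure \<nu> (ball y (\<rho> / 5))"
    and big: "emeasure \<nu> (ball x (r + \<rho> / 5)) \<le> ennreal A' * emeasure \<nu> (ball x r)"
    and g [measurable]: "g \<in> borel_measurable borel"
    and loc: "\<And>y. y \<in> S \<inter> ball x r \<Longrightarrow> (\<integral>\<^sup>+z\<in>ball y \<rho>. g z \<partial>\<nu>) \<le> ennreal B * emeasure \<nu> (ball y \<rho>)"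
    and nonneg: "0 \<le> A" "0 \<le> A'" "0 \<le> B"
  shows "(\<integral>\<^sup>+z\<in>ball x r. g z \<partial>\<nu>) \<le> ennreal (B * A * A') * emeasure \<nu> (ball x r)"
proof -
  obtain J where J: "countable J" "J \<subseteq> S \<inter> ball x r"
      "pairwise (\<lambda>i j. disjnt (ball i (\<rho> / 5)) (ball j (\<rho> / 5))) J"
      "S \<inter> ball x r \<subseteq> (\<Union>i\<in>J. ball i (5 * (\<rho> / 5)))"
  proof (rule Vitali_covering_lemma_balls[where S = "S \<inter> ball x r" and K = "S \<inter> ball x r"
        and a = "\<lambda>y. y" and r = "\<lambda>_. \<rho> / 5" and B = "\<rho> / 5"])
    show "S \<inter> ball x r \<subseteq> (\<Union>i\<in>S \<inter> ball x r. ball i (\<rho> / 5))" using \<rho> by force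
  qed (use \<rho> in \<open>auto intro: that\<close>)
  define \<eta> where "\<eta> = density \<nu> g"
  have sets_\<eta> [simp]: "sets \<eta> = sets borel" by (simp add: \<eta>_def)
  have \<eta>: "emeasure \<eta> X = (\<integral>\<^sup>+z\<in>X. g z \<partial>\<nu>)" if "X \<in> sets borel" for X
    unfolding \<eta>_def using that by (subst emeasure_density) auto
  have "emeasure \<eta> (S \<inter> ball x r) \<le> ennreal (B * A) * emeasure \<nu> (ball x (r + \<rho> / 5))"
  proof (rule emeasure_le_by_disjoint_family[where A = "\<lambda>y. ball y \<rho>" and B = "\<lambda>y. ball y (\<rho> / 5)", OF J(1)])
    show "disjoint_family_on (\<lambda>y. ball y (\<rho> / 5)) J"
      using J(3) by (auto simp: disjoint_family_on_def pairwise_def disjnt_def)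
    show "S \<inter> ball x r \<subseteq> (\<Union>i\<in>J. ball i \<rho>)" using J(4) by simp
    fix y assume y: "y \<in> J"
    then have yS: "y \<in> S \<inter> ball x r" using J(2) by auto
    show "ball y (\<rho> / 5) \<subseteq> ball x (r + \<rho> / 5)"
    proof
      fix z assume "z \<in> ball y (\<rho> / 5)"
      then show "z \<in> ball x (r + \<rho> / 5)" using yS dist_triangle[of x z y] by simp
    qed
    have "emeasure \<eta> (ball y \<rho>) \<le> ennreal B * emeasure \<nu> (ball y \<rho>)" using loc[OF yS] by (simp add: \<eta>)
    also have "\<dots> \<le> ennreal B * (ennreal A * emeasure \<nu> (ball y (\<rho> / 5)))"
      by (intro mult_left_mono dbl yS) auto
    finally show "emeasure \<eta> (ball y \<rho>) \<le> ennreal (B * A) * emeasure \<nu> (ball y (\<rho> / 5))"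
      using nonneg by (simp add: ennreal_mult mult_ac)
  qed simp_all
  also have "\<dots> \<le> ennreal (B * A) * (ennreal A' * emeasure \<nu> (ball x r))"
    by (intro mult_left_mono big) auto
  also have "\<dots> = ennreal (B * A * A') * emeasure \<nu> (ball x r)"
    using nonneg by (simp add: ennreal_mult mult_ac)
  finally have "emeasure \<eta> (S \<inter> ball x r) \<le> ennreal (B * A * A') * emeasure \<nu> (ball x r)" .
  moreover have "AE z in \<nu>. z \<in> S"
    using null by (intro AE_I[where N = "- S"]) auto
  then have "(\<integral>\<^sup>+z\<in>ball x r. g z \<partial>\<nu>) \<le> (\<integral>\<^sup>+z\<in>S \<inter> ball x r. g z \<partial>\<nu>)"
    by (intro nn_integral_mono_AE) (auto simp: indicator_def elim!: eventually_mono)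
  ultimately show ?thesis by (simp add: \<eta>)
qed

lemma doubling_family_small_balls:
  fixes \<Omega> :: "(real^'n) set"
  assumes fam: "doubling_family b \<Omega> C \<nu>" and C: "1 \<le> C"
    and x: "x \<in> frontier \<Omega>" "0 < r" and adm: "admissible b \<Omega> 2 x r P" and \<rho>: "0 < \<rho>" "\<rho> \<le> r / 2"
    and g [measurable]: "g \<in> borel_measurable borel" and B: "0 \<le> B"
    and loc: "\<And>y. y \<in> frontier \<Omega> \<inter> ball x r \<Longrightarrow> (\<integral>\<^sup>+z\<in>ball y \<rho>. g z \<partial>\<nu> P) \<le> ennreal B * emeasure (\<nu> P) (ball y \<rho>)"
  shows "(\<integral>\<^sup>+z\<in>ball x r. g z \<partial>\<nu> P) \<le> ennreal (B * C ^ 4) * emeasure (\<nu> P) (ball x r)"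
proof -
  note sets_\<nu> [measurable_cong, simp] = doubling_familyD(1)[OF fam adm]
  have "(\<integral>\<^sup>+z\<in>ball x r. g z \<partial>\<nu> P) \<le> ennreal (B * C ^ 3 * C) * emeasure (\<nu> P) (ball x r)"
  proof (rule integral_le_of_small_balls[OF sets_\<nu> frontier_borel doubling_familyD(2)[OF fam adm] \<rho>(1) _ _ g loc])
    fix y assume y: "y \<in> frontier \<Omega> \<inter> ball x r"
    have "admissible b \<Omega> (3/2) y (2 ^ 3 * (\<rho> / 8)) P"
      using y \<rho> by (intro admissible_shift[OF adm]) auto
    then have "emeasure (\<nu> P) (ball y (2 ^ 3 * (\<rho> / 8))) \<le> ennreal (C ^ 3) * emeasure (\<nu> P) (ball y (\<rho> / 8))"
      using y \<rho> by (intro doubling_family_iterate[OF fam C]) auto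
    also have "\<dots> \<le> ennreal (C ^ 3) * emeasure (\<nu> P) (ball y (\<rho> / 5))"
      using \<rho> by (intro mult_left_mono emeasure_mono subset_ball) auto
    finally show "emeasure (\<nu> P) (ball y \<rho>) \<le> ennreal (C ^ 3) * emeasure (\<nu> P) (ball y (\<rho> / 5))" by simp
  next
    \<comment> \<open>Doubling at radius \<open>r\<close> would require the pole to have distance \<open>3r\<close>; at radius \<open>2r/3\<close> distance
      \<open>2r\<close> is enough, and \<open>4r/3\<close> still exceeds \<open>r + \<rho>/5\<close>.\<close>
    have "emeasure (\<nu> P) (ball x (r + \<rho> / 5)) \<le> emeasure (\<nu> P) (ball x (2 * (2 / 3 * r)))"
      using \<rho> x(2) by (intro emeasure_mono subset_ball) auto
    also have "\<dots> \<le> ennreal C * emeasure (\<nu> P) (ball x (2 / 3 * r))"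
      using adm x by (intro doubling_family_ball[OF fam]) (auto simp: admissible_def)
    also have "\<dots> \<le> ennreal C * emeasure (\<nu> P) (ball x r)"
      using x by (intro mult_left_mono emeasure_mono subset_ball) auto
    finally show "emeasure (\<nu> P) (ball x (r + \<rho> / 5)) \<le> ennreal C * emeasure (\<nu> P) (ball x r)" .
  qed (use C B in auto)
  then show ?thesis by (simp add: eval_nat_numeral mult_ac)
qed

definition whitney_bound :: "(real^'n) set \<Rightarrow> (real^'n) measure \<Rightarrow> real \<Rightarrow> real \<Rightarrow> bool" where
  "whitney_bound \<Omega> H \<tau> W \<longleftrightarrow>
     (\<forall>y\<in>frontier \<Omega>. \<forall>r>0. emeasure H {X \<in> \<Omega>. dist X y \<le> 2 * r \<and> \<tau> * r \<le> bdist \<Omega> X} \<le> ennreal W)"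

lemma carleson_bound_mono:
  "carleson_bound b \<Omega> H \<nu> M \<Longrightarrow> M \<le> M' \<Longrightarrow> carleson_bound b \<Omega> H \<nu> M'"
  unfolding carleson_bound_def
  by (meson mult_right_mono ennreal_leI order_trans zero_le)

lemma emeasure_cone_split:
  assumes "sets H = sets borel" "open \<Omega>"
  shows "emeasure H (cone \<Omega> r y) \<le> emeasure H (cone \<Omega> s y) + emeasure H {X \<in> \<Omega>. dist X y \<le> 2 * r \<and> s \<le> bdist \<Omega> X}"
proof -
  have [measurable]: "\<Omega> \<in> sets borel" using assms(2) by auto
  have "{X \<in> \<Omega>. dist X y \<le> 2 * r \<and> s \<le> bdist \<Omega> X} = \<Omega> \<inter> ({X. dist X y \<le> 2 * r} \<inter> {X. s \<le> bdist \<Omega> X})" by auto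
  also have "{X. dist X y \<le> 2 * r} \<inter> {X. s \<le> bdist \<Omega> X} \<in> sets borel"
    by (intro borel_closed closed_Int closed_Collect_le continuous_intros)
  then have "\<Omega> \<inter> ({X. dist X y \<le> 2 * r} \<inter> {X. s \<le> bdist \<Omega> X}) \<in> sets borel" by measurable
  finally have m: "{X \<in> \<Omega>. dist X y \<le> 2 * r \<and> s \<le> bdist \<Omega> X} \<in> sets H" using assms(1) by simp
  have c: "cone \<Omega> s y \<in> sets H" unfolding cone_eq_fiber using assms by simp
  have "emeasure H (cone \<Omega> r y) \<le> emeasure H (cone \<Omega> s y \<union> {X \<in> \<Omega>. dist X y \<le> 2 * r \<and> s \<le> bdist \<Omega> X})"
    using m c by (intro emeasure_mono) (auto simp: cone_def)
  also have "\<dots> \<le> emeasure H (cone \<Omega> s y) + emeasure H {X \<in> \<Omega>. dist X y \<le> 2 * r \<and> s \<le> bdist \<Omega> X}"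
    using c m by (rule emeasure_subadditive)
  finally show ?thesis .
qed

text \<open>Covering a ball by balls 128 times smaller, to which \<open>carleson_step\<close> applies, and using the Whitney bound
for the heights in between (hence \<open>1/1024 = 1/128 \<sqdot> 1/8\<close>), improves a Carleson constant \<open>K\<close> to
\<open>a + K / 2\<close>. Since \<open>H\<close> is finite, its total mass is a first Carleson constant, and iteration leads
to \<open>2a + 1\<close>, which depends neither on the total mass of \<open>H\<close> nor on the pole. The proportion \<open>1/(4 C\<^sup>9)\<close> is what
makes the factor of \<open>K\<close> equal to one half: \<open>C\<^sup>5\<close> is lost in \<open>carleson_step\<close> and \<open>C\<^sup>4\<close> in the covering.\<close>

lemma carleson_bound_of_good_sets:
  fixes \<Omega> :: "(real^'n) set"
  assumes fam: "doubling_family b \<Omega> C \<nu>" and C: "1 \<le> C" and \<Omega>: "open \<Omega>" "frontier \<Omega> \<noteq> {}"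
    and H: "finite_measure H" and sets_H [measurable_cong, simp]: "sets H = sets borel"
    and W: "whitney_bound \<Omega> H (1/1024) W" "0 \<le> W" and N: "0 \<le> N"
    and good: "\<And>x r P. x \<in> frontier \<Omega> \<Longrightarrow> 0 < r \<Longrightarrow> admissible b \<Omega> 128 x r P \<Longrightarrow>
       \<exists>F\<in>sets borel. F \<subseteq> ball x (2 * r) \<and>
         emeasure (\<nu> P) (ball x (2 * r) - F) \<le> ennreal (1 / (4 * C ^ 9)) * emeasure (\<nu> P) (ball x (2 * r)) \<and>
         (\<forall>y\<in>F. emeasure H (cone \<Omega> r y) \<le> ennreal N)"
  shows "carleson_bound b \<Omega> H \<nu> (2 * (2 * C ^ 5 * N + W) + 1)"
proof -
  interpret H: finite_measure H by fact
  define a where "a = 2 * C ^ 5 * N + W"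
  have a: "0 \<le> a" using C N W by (simp add: a_def)
  have step: "carleson_bound b \<Omega> H \<nu> (a + K / 2)" if K: "carleson_bound b \<Omega> H \<nu> K" "0 \<le> K" for K
    unfolding carleson_bound_def
  proof (intro ballI allI impI)
    fix x r P assume x: "x \<in> frontier \<Omega>" "0 < r" and adm: "admissible b \<Omega> 2 x r P"
    note sets_\<nu> [measurable_cong, simp] = doubling_familyD(1)[OF fam adm]
    define \<rho> where "\<rho> = r / 128"
    have \<rho>: "0 < \<rho>" "\<rho> \<le> r / 2" using x by (auto simp: \<rho>_def)
    define g where "g y = emeasure H (cone \<Omega> (\<rho> / 8) y)" for y
    have g [measurable]: "g \<in> borel_measurable borel"
      unfolding g_def cone_eq_fiber using \<Omega>(1)
      by (intro borel_measurable_emeasure_fiber H.sigma_finite_measure_axioms) auto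
    have [measurable]: "g \<in> borel_measurable (\<nu> P)"
      using g by (simp add: measurable_cong_sets[OF sets_\<nu> refl])
    define B where "B = 2 * C * N + 2 * C ^ 5 * (1 / (4 * C ^ 9)) * K"
    have B: "0 \<le> B" using C N K by (simp add: B_def)
    have "(\<integral>\<^sup>+y\<in>ball x r. g y \<partial>\<nu> P) \<le> ennreal (B * C ^ 4) * emeasure (\<nu> P) (ball x r)"
    proof (rule doubling_family_small_balls[OF fam C x adm \<rho> g B])
      fix y assume y: "y \<in> frontier \<Omega> \<inter> ball x r"
      have adm_y: "admissible b \<Omega> 128 y \<rho> P"
        using y by (intro admissible_shift[OF adm]) (auto simp: \<rho>_def)
      obtain F where F: "F \<in> sets borel" "F \<subseteq> ball y (2 * \<rho>)"
         "emeasure (\<nu> P) (ball y (2 * \<rho>) - F) \<le> ennreal (1 / (4 * C ^ 9)) * emeasure (\<nu> P) (ball y (2 * \<rho>))"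
         "\<forall>z\<in>F. emeasure H (cone \<Omega> \<rho> z) \<le> ennreal N"
        using good[OF _ \<rho>(1) adm_y] y by blast
      show "(\<integral>\<^sup>+z\<in>ball y \<rho>. g z \<partial>\<nu> P) \<le> ennreal B * emeasure (\<nu> P) (ball y \<rho>)"
        unfolding g_def B_def using F y C N
        by (intro carleson_step[OF fam C \<Omega> H sets_H K _ \<rho>(1) adm_y]) auto
    qed
    moreover have "(\<integral>\<^sup>+y\<in>ball x r. emeasure H (cone \<Omega> r y) \<partial>\<nu> P) \<le> (\<integral>\<^sup>+y. g y * indicator (ball x r) y + ennreal W * indicator (ball x r) y \<partial>\<nu> P)"
    proof (rule nn_integral_mono_AE)
      have "AE y in \<nu> P. y \<in> frontier \<Omega>"
        using doubling_familyD(2)[OF fam adm] by (intro AE_I[where N = "- frontier \<Omega>"]) auto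
      then show "AE y in \<nu> P. emeasure H (cone \<Omega> r y) * indicator (ball x r) y \<le> g y * indicator (ball x r) y + ennreal W * indicator (ball x r) y"
      proof eventually_elim
        case (elim y)
        have "emeasure H (cone \<Omega> r y) \<le> g y + emeasure H {X \<in> \<Omega>. dist X y \<le> 2 * r \<and> \<rho> / 8 \<le> bdist \<Omega> X}"
          unfolding g_def by (rule emeasure_cone_split[OF sets_H \<Omega>(1)])
        also have "emeasure H {X \<in> \<Omega>. dist X y \<le> 2 * r \<and> \<rho> / 8 \<le> bdist \<Omega> X} \<le> ennreal W"
          using W(1) elim x(2) unfolding whitney_bound_def \<rho>_def by (auto dest!: bspec[OF _ elim] spec[of _ r])
        finally show ?case by (auto simp: indicator_def add_left_mono)
      qed
    qed
    moreover have "\<dots> = (\<integral>\<^sup>+y\<in>ball x r. g y \<partial>\<nu> P) + ennreal W * emeasure (\<nu> P) (ball x r)"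
    proof (subst nn_integral_add)
      have [measurable]: "ball x r \<in> sets (\<nu> P)" by simp
      show "(\<lambda>y. g y * indicator (ball x r) y) \<in> borel_measurable (\<nu> P)"
        "(\<lambda>y. ennreal W * indicator (ball x r) y) \<in> borel_measurable (\<nu> P)" by measurable
    qed (simp add: nn_integral_cmult_indicator)
    ultimately have "(\<integral>\<^sup>+y\<in>ball x r. emeasure H (cone \<Omega> r y) \<partial>\<nu> P)
        \<le> ennreal (B * C ^ 4) * emeasure (\<nu> P) (ball x r) + ennreal W * emeasure (\<nu> P) (ball x r)"
      by (simp add: order.trans add_right_mono)
    also have "\<dots> = ennreal (B * C ^ 4 + W) * emeasure (\<nu> P) (ball x r)"
      using B C W by (simp add: distrib_right)
    also have "B * C ^ 4 + W = a + K / 2"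
      using C by (simp add: B_def a_def field_simps eval_nat_numeral)
    finally show "(\<integral>\<^sup>+y\<in>ball x r. emeasure H (cone \<Omega> r y) \<partial>\<nu> P) \<le> ennreal (a + K / 2) * emeasure (\<nu> P) (ball x r)" .
  qed
  define K\<^sub>0 where "K\<^sub>0 = measure H UNIV"
  have K\<^sub>0: "carleson_bound b \<Omega> H \<nu> (2 * a + K\<^sub>0)"
    unfolding carleson_bound_def
  proof (intro ballI allI impI)
    fix x r P assume "x \<in> frontier \<Omega>" "0 < r" and adm: "admissible b \<Omega> 2 x r P"
    note sets_\<nu> [measurable_cong, simp] = doubling_familyD(1)[OF fam adm]
    have "(\<integral>\<^sup>+y\<in>ball x r. emeasure H (cone \<Omega> r y) \<partial>\<nu> P) \<le> (\<integral>\<^sup>+y\<in>ball x r. ennreal K\<^sub>0 \<partial>\<nu> P)"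
      unfolding K\<^sub>0_def H.emeasure_eq_measure using sets_eq_imp_space_eq[OF sets_H]
      by (intro nn_integral_mono mult_right_mono ennreal_leI H.finite_measure_mono) auto
    also have "\<dots> \<le> ennreal (2 * a + K\<^sub>0) * emeasure (\<nu> P) (ball x r)"
      using a by (auto simp: nn_integral_cmult_indicator K\<^sub>0_def intro!: mult_right_mono ennreal_leI)
    finally show "(\<integral>\<^sup>+y\<in>ball x r. emeasure H (cone \<Omega> r y) \<partial>\<nu> P) \<le> ennreal (2 * a + K\<^sub>0) * emeasure (\<nu> P) (ball x r)" .
  qed
  have iter: "carleson_bound b \<Omega> H \<nu> (2 * a + K\<^sub>0 / 2 ^ k)" for k
  proof (induction k)
    case (Suc k)
    have "0 \<le> 2 * a + K\<^sub>0 / 2 ^ k" using a by (simp add: K\<^sub>0_def)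
    from step[OF Suc.IH this] show ?case by (simp add: add_divide_distrib mult.commute)
  qed (use K\<^sub>0 in simp)
  obtain k where "K\<^sub>0 < 2 ^ k" using real_arch_pow[of 2 K\<^sub>0] by auto
  then have "2 * a + K\<^sub>0 / 2 ^ k \<le> 2 * a + 1" by (simp add: field_simps)
  from carleson_bound_mono[OF iter this] show ?thesis by (simp add: a_def)
qed

section \<open>Heights comparable to the radius\<close>

definition locally_finite_on :: "(real^'n) set \<Rightarrow> (real^'n) measure \<Rightarrow> bool" where
  "locally_finite_on \<Omega> H \<longleftrightarrow> sets H = sets borel \<and> (\<forall>K. compact K \<and> K \<subseteq> \<Omega> \<longrightarrow> emeasure H K < \<infinity>)"

lemma emeasure_away_from_boundary:
  assumes H: "locally_finite_on \<Omega> H" and \<Omega>: "open \<Omega>" "bounded \<Omega>" "frontier \<Omega> \<noteq> {}" and c: "0 < c"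
  shows "emeasure H {X \<in> \<Omega>. c \<le> bdist \<Omega> X} < \<infinity>"
proof -
  have "{X \<in> \<Omega>. c \<le> bdist \<Omega> X} = closure \<Omega> \<inter> {X. c \<le> bdist \<Omega> X}"
  proof -
    have "X \<in> \<Omega>" if "X \<in> closure \<Omega>" "c \<le> bdist \<Omega> X" for X
    proof (rule ccontr)
      assume "X \<notin> \<Omega>"
      then have "X \<in> frontier \<Omega>" using that(1) \<Omega>(1) by (simp add: frontier_def interior_open)
      then show False using bdist_le[of X \<Omega> X] that(2) c by simp
    qed
    then show ?thesis using closure_subset by blast
  qed
  moreover have "compact \<dots>"
    using \<Omega>(2) by (intro compact_Int_closed closed_Collect_le continuous_intros) (simp add: compact_closure)
  ultimately show ?thesis using H by (auto simp: locally_finite_on_def)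
qed

text \<open>Two different points of \<open>\<Omega>\<close> cannot both be close to \<open>x\<close>, so small balls, uniformly in their centre, always have an
admissible pole.\<close>

lemma far_pole_exists:
  fixes \<Omega> :: "(real^'n) set"
  assumes "open \<Omega>" "\<Omega> \<noteq> {}"
  obtains \<rho> where "0 < \<rho>" "\<And>x r. 0 < r \<Longrightarrow> r \<le> \<rho> \<or> \<not> bounded \<Omega> \<Longrightarrow> \<exists>P\<in>\<Omega>. 2 * r \<le> dist x P"
proof -
  obtain p where p: "p \<in> \<Omega>" using assms(2) by auto
  obtain e where e: "0 < e" "ball p e \<subseteq> \<Omega>" using assms(1) p by (auto elim: openE)
  obtain q where pq: "dist p q = e / 2" using vector_choose_dist[of "e / 2" p] e(1) by auto
  then have q: "q \<in> \<Omega>" using e by auto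
  show thesis
  proof (rule that[of "e / 8"])
    fix x :: "real^'n" and r :: real assume r: "0 < r" "r \<le> e / 8 \<or> \<not> bounded \<Omega>"
    show "\<exists>P\<in>\<Omega>. 2 * r \<le> dist x P"
    proof (cases "bounded \<Omega>")
      case True
      have "e / 2 \<le> dist x p + dist x q" using pq dist_triangle3[of p q x] by (simp add: dist_commute)
      then have "2 * r \<le> dist x p \<or> 2 * r \<le> dist x q" using r True by auto
      then show ?thesis using p q by auto
    next
      case False
      then have "\<not> \<Omega> \<subseteq> ball x (2 * r)" using bounded_subset by blast
      then show ?thesis by (auto simp: not_less)
    qed
  qed (use e in simp)
qed

text \<open>The Whitney ball about \<open>Z\<close> is contained in the cones of all boundary points in a ball about a point
nearest to \<open>Z\<close>. That ball has a definite share of a boundary ball obtained from it by three doublings, where the Carleson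
condition holds provided that a pole exists. If there is none, then \<open>\<Omega>\<close> is bounded and \<open>Z\<close> has a definite distance to
the boundary, so that local finiteness of \<open>H\<close> takes over.\<close>

lemma whitney_ball_bound:
  fixes \<Omega> :: "(real^'n) set"
  assumes fam: "doubling_family b \<Omega> C \<nu>" and C: "1 \<le> C" and \<Omega>: "open \<Omega>" "frontier \<Omega> \<noteq> {}"
    and H: "locally_finite_on \<Omega> H" and M: "carleson_bound b \<Omega> H \<nu> M" "0 \<le> M"
  obtains W where "0 \<le> W" "\<And>Z. Z \<in> \<Omega> \<Longrightarrow> emeasure H (\<Omega> \<inter> ball Z (bdist \<Omega> Z / 4)) \<le> ennreal W"
proof -
  have sets_H [simp]: "sets H = sets borel" using H by (simp add: locally_finite_on_def)
  have "\<Omega> \<noteq> {}" using \<Omega>(2) by auto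
  then obtain \<rho> where \<rho>: "0 < \<rho>" "\<And>x r. 0 < r \<Longrightarrow> r \<le> \<rho> \<or> \<not> bounded \<Omega> \<Longrightarrow> \<exists>P\<in>\<Omega>. 2 * r \<le> dist x P"
    using far_pole_exists[OF \<Omega>(1)] by blast
  define W\<^sub>1 where "W\<^sub>1 = (if bounded \<Omega> then enn2real (emeasure H {X \<in> \<Omega>. 3 / 8 * \<rho> \<le> bdist \<Omega> X}) else 0)"
  define W where "W = max W\<^sub>1 (M * C ^ 3)"
  have "emeasure H (\<Omega> \<inter> ball Z (bdist \<Omega> Z / 4)) \<le> ennreal W" if Z: "Z \<in> \<Omega>" for Z
  proof -
    define d where "d = bdist \<Omega> Z"
    have d: "0 < d" unfolding d_def by (rule bdist_pos[OF \<Omega> Z])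
    obtain z where z: "z \<in> frontier \<Omega>" "dist Z z = d"
      using nearest_boundary_point[OF \<Omega>(2), of Z] unfolding d_def by blast
    have near: "3 / 4 * d \<le> bdist \<Omega> X" "bdist \<Omega> X \<le> 5 / 4 * d" if "X \<in> ball Z (d / 4)" for X
      using that bdist_lipschitz[of \<Omega> Z X] bdist_lipschitz[of \<Omega> X Z] by (auto simp: d_def dist_commute)
    show ?thesis
    proof (cases "\<exists>P. admissible b \<Omega> 2 z (2 * d) P")
      case True
      then obtain P where P: "admissible b \<Omega> 2 z (2 * d) P" by blast
      note sets_\<nu> [measurable_cong, simp] = doubling_familyD(1)[OF fam P]
      define h where "h = emeasure H (\<Omega> \<inter> ball Z (d / 4))"
      define v where "v = emeasure (\<nu> P) (ball z (d / 4))"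
      have v: "0 < v" "v < \<infinity>"
        using doubling_family_ball[OF fam z(1), of "d / 4" P] d P unfolding v_def
        by (auto simp: admissible_def)
      have "h * v = (\<integral>\<^sup>+y\<in>ball z (d / 4). h \<partial>\<nu> P)" by (simp add: nn_integral_cmult_indicator v_def)
      also have "\<dots> \<le> (\<integral>\<^sup>+y\<in>ball z (2 * d). emeasure H (cone \<Omega> (2 * d) y) \<partial>\<nu> P)"
      proof (rule nn_integral_mono)
        fix y
        show "h * indicator (ball z (d / 4)) y \<le> emeasure H (cone \<Omega> (2 * d) y) * indicator (ball z (2 * d)) y"
        proof (cases "y \<in> ball z (d / 4)")
          case True
          have "\<Omega> \<inter> ball Z (d / 4) \<subseteq> cone \<Omega> (2 * d) y"
          proof
            fix X assume X: "X \<in> \<Omega> \<inter> ball Z (d / 4)"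
            have "dist X y \<le> dist X Z + dist Z z + dist z y"
              using dist_triangle[of X y Z] dist_triangle[of Z y z] by simp
            also have "\<dots> \<le> 2 * (3 / 4 * d)" using X z(2) True by (simp add: dist_commute)
            finally show "X \<in> cone \<Omega> (2 * d) y" using near[of X] X d by (auto simp: cone_def)
          qed
          then have "h \<le> emeasure H (cone \<Omega> (2 * d) y)"
            unfolding h_def cone_eq_fiber using \<Omega>(1) by (intro emeasure_mono) auto
          then show ?thesis using True d by auto
        qed simp
      qed
      also have "\<dots> \<le> ennreal M * emeasure (\<nu> P) (ball z (2 * d))"
        using M(1) z(1) d P unfolding carleson_bound_def by simp
      also have "emeasure (\<nu> P) (ball z (2 ^ 3 * (d / 4))) \<le> ennreal (C ^ 3) * v"
        unfolding v_def using d P by (intro doubling_family_iterate[OF fam C z(1)]) (auto simp: admissible_def)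
      then have "emeasure (\<nu> P) (ball z (2 * d)) \<le> ennreal (C ^ 3) * v" by simp
      finally have "h * v \<le> ennreal (M * C ^ 3) * v"
        using M C by (simp add: ennreal_mult mult.assoc mult_left_mono)
      then have "h \<le> ennreal (M * C ^ 3)"
        using v ennreal_mult_le_mult_iff[of v h "ennreal (M * C ^ 3)"] by (simp add: mult.commute)
      also have "\<dots> \<le> ennreal W" by (intro ennreal_leI) (simp add: W_def)
      finally show ?thesis by (simp add: h_def d_def)
    next
      case False
      then have "b" "\<not> (\<exists>P\<in>\<Omega>. 2 * (2 * d) \<le> dist z P)" by (auto simp: admissible_def)
      then have bd: "bounded \<Omega>" "\<rho> < 2 * d" using \<rho>(2)[of "2 * d" z] d by force+
      have "emeasure H (\<Omega> \<inter> ball Z (d / 4)) \<le> emeasure H {X \<in> \<Omega>. 3 / 8 * \<rho> \<le> bdist \<Omega> X}"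
      proof (rule emeasure_mono)
        show "\<Omega> \<inter> ball Z (d / 4) \<subseteq> {X \<in> \<Omega>. 3 / 8 * \<rho> \<le> bdist \<Omega> X}"
        proof
          fix X assume "X \<in> \<Omega> \<inter> ball Z (d / 4)"
          then show "X \<in> {X \<in> \<Omega>. 3 / 8 * \<rho> \<le> bdist \<Omega> X}" using near(1)[of X] bd by auto
        qed
        have "\<Omega> \<inter> {X. 3 / 8 * \<rho> \<le> bdist \<Omega> X} \<in> sets borel"
          using \<Omega>(1) by (intro sets.Int borel_closed[OF closed_Collect_le]) (auto intro!: continuous_intros)
        then show "{X \<in> \<Omega>. 3 / 8 * \<rho> \<le> bdist \<Omega> X} \<in> sets H" by (simp add: Int_def)
      qed
      also have "\<dots> = ennreal W\<^sub>1"
        using emeasure_away_from_boundary[OF H \<Omega>(1) bd(1) \<Omega>(2), of "3 / 8 * \<rho>"] \<rho>(1) bd(1)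
        by (simp add: W\<^sub>1_def)
      also have "\<dots> \<le> ennreal W" by (intro ennreal_leI) (simp add: W_def)
      finally show ?thesis by (simp add: d_def)
    qed
  qed
  moreover have "0 \<le> W" using M C by (auto simp: W_def le_max_iff_disj)
  ultimately show thesis using that by blast
qed

text \<open>The region within distance \<open>2r\<close> of the apex and at height at least \<open>\<tau> r\<close> is covered by a number of Whitney balls that does not depend on
the apex or on \<open>r\<close>: rescale a finite cover of the ball of radius 2 about the origin.\<close>

lemma whitney_bound_of_balls:
  fixes \<Omega> :: "(real^'n) set"
  assumes \<Omega>: "open \<Omega>" and sets_H [simp]: "sets H = sets borel" and \<tau>: "0 < \<tau>" and W: "0 \<le> W"
    and balls: "\<And>Z. Z \<in> \<Omega> \<Longrightarrow> emeasure H (\<Omega> \<inter> ball Z (bdist \<Omega> Z / 4)) \<le> ennreal W"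
  obtains W' where "0 \<le> W'" "whitney_bound \<Omega> H \<tau> W'"
proof -
  have [measurable]: "\<Omega> \<in> sets borel" using \<Omega> by auto
  have "cball (0::real^'n) 2 \<subseteq> (\<Union>t\<in>cball 0 2. ball t (\<tau> / 8))" using \<tau> by force
  then obtain T where T: "T \<subseteq> cball (0::real^'n) 2" "finite T" "cball 0 2 \<subseteq> (\<Union>t\<in>T. ball t (\<tau> / 8))"
    using compactE_image[OF compact_cball[of "0::real^'n" 2], of "cball 0 2" "\<lambda>t. ball t (\<tau> / 8)"] by auto
  have "emeasure H {X \<in> \<Omega>. dist X y \<le> 2 * r \<and> \<tau> * r \<le> bdist \<Omega> X} \<le> ennreal (card T * W)" if r: "0 < r" for y r
  proof -
    define U where "U = {X \<in> \<Omega>. \<tau> * r \<le> bdist \<Omega> X}"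
    have U [measurable]: "U \<in> sets borel"
    proof -
      have "\<Omega> \<inter> {X. \<tau> * r \<le> bdist \<Omega> X} \<in> sets borel"
        using \<Omega> by (intro sets.Int borel_closed[OF closed_Collect_le]) (auto intro!: continuous_intros)
      then show ?thesis by (simp add: U_def Int_def)
    qed
    have "{X \<in> \<Omega>. dist X y \<le> 2 * r \<and> \<tau> * r \<le> bdist \<Omega> X} \<subseteq> (\<Union>t\<in>T. U \<inter> ball (y + r *\<^sub>R t) (\<tau> * r / 8))"
    proof
      fix X assume X: "X \<in> {X \<in> \<Omega>. dist X y \<le> 2 * r \<and> \<tau> * r \<le> bdist \<Omega> X}"
      define s where "s = (1 / r) *\<^sub>R (X - y)"
      have s: "X = y + r *\<^sub>R s" using r by (simp add: s_def)
      have "norm s \<le> 2" unfolding s_def norm_scaleR using X r by (simp add: dist_norm field_simps)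
      then obtain t where t: "t \<in> T" "dist t s < \<tau> / 8" using T(3) by force
      have "dist (y + r *\<^sub>R t) X = r * dist t s"
        using r by (simp add: s dist_norm scaleR_diff_right[symmetric])
      then have "X \<in> ball (y + r *\<^sub>R t) (\<tau> * r / 8)" using t(2) r by (simp add: field_simps)
      then show "X \<in> (\<Union>t\<in>T. U \<inter> ball (y + r *\<^sub>R t) (\<tau> * r / 8))" using X t(1) by (auto simp: U_def)
    qed
    then have "emeasure H {X \<in> \<Omega>. dist X y \<le> 2 * r \<and> \<tau> * r \<le> bdist \<Omega> X}
        \<le> emeasure H (\<Union>t\<in>T. U \<inter> ball (y + r *\<^sub>R t) (\<tau> * r / 8))"
    proof (rule emeasure_mono)
      show "(\<Union>t\<in>T. U \<inter> ball (y + r *\<^sub>R t) (\<tau> * r / 8)) \<in> sets H"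
        using T(2) by (intro sets.finite_UN) auto
    qed
    also have "\<dots> \<le> (\<Sum>t\<in>T. emeasure H (U \<inter> ball (y + r *\<^sub>R t) (\<tau> * r / 8)))"
      using T(2) by (intro emeasure_subadditive_finite) auto
    also have "\<dots> \<le> (\<Sum>t\<in>T. ennreal W)"
    proof (rule sum_mono)
      fix t
      show "emeasure H (U \<inter> ball (y + r *\<^sub>R t) (\<tau> * r / 8)) \<le> ennreal W"
      proof (cases "U \<inter> ball (y + r *\<^sub>R t) (\<tau> * r / 8) = {}")
        case False
        then obtain Z where Z: "Z \<in> U" "dist (y + r *\<^sub>R t) Z < \<tau> * r / 8" by auto
        have "U \<inter> ball (y + r *\<^sub>R t) (\<tau> * r / 8) \<subseteq> \<Omega> \<inter> ball Z (bdist \<Omega> Z / 4)"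
        proof
          fix X assume X: "X \<in> U \<inter> ball (y + r *\<^sub>R t) (\<tau> * r / 8)"
          have "dist Z X \<le> dist (y + r *\<^sub>R t) Z + dist (y + r *\<^sub>R t) X" by (rule dist_triangle3)
          then have "dist Z X < bdist \<Omega> Z / 4" using X Z by (auto simp: U_def)
          then show "X \<in> \<Omega> \<inter> ball Z (bdist \<Omega> Z / 4)" using X by (simp add: U_def)
        qed
        then have "emeasure H (U \<inter> ball (y + r *\<^sub>R t) (\<tau> * r / 8)) \<le> emeasure H (\<Omega> \<inter> ball Z (bdist \<Omega> Z / 4))"
          by (rule emeasure_mono) auto
        also have "\<dots> \<le> ennreal W" using Z by (intro balls) (simp add: U_def)
        finally show ?thesis .
      qed simp
    qed
    also have "\<dots> = ennreal (card T * W)" using W by (simp add: ennreal_mult ennreal_of_nat_eq_real_of_nat)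
    finally show ?thesis .
  qed
  then have "whitney_bound \<Omega> H \<tau> (card T * W)" by (auto simp: whitney_bound_def)
  then show thesis using W by (intro that[of "card T * W"]) auto
qed

section \<open>Transfer of the Carleson condition\<close>

lemma exhaustion_by_finite_measures:
  fixes \<Omega> :: "(real^'n) set"
  assumes H: "locally_finite_on \<Omega> H" and \<Omega>: "open \<Omega>"
  obtains Hn where "\<And>n. finite_measure (Hn n)" "\<And>n. sets (Hn n) = sets borel"
    "\<And>n A. A \<in> sets borel \<Longrightarrow> emeasure (Hn n) A \<le> emeasure H A"
    "\<And>y r. incseq (\<lambda>n. emeasure (Hn n) (cone \<Omega> r y))"
    "\<And>y r. (SUP n. emeasure (Hn n) (cone \<Omega> r y)) = emeasure H (cone \<Omega> r y)"
proof -
  have sets_H [measurable_cong, simp]: "sets H = sets borel" using H by (simp add: locally_finite_on_def)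
  obtain K where K: "\<And>n. compact (K n)" "\<And>n. K n \<subseteq> \<Omega>" "\<And>n. K n \<subseteq> interior (K (Suc n))" "(\<Union>n. K n) = \<Omega>"
    using open_Union_compact_subsets[OF \<Omega>] by metis
  have mono: "incseq K" using K(3) interior_subset by (intro incseq_SucI) blast
  have K_borel [measurable]: "K n \<in> sets borel" for n using K(1) by (simp add: compact_imp_closed borel_closed)
  define Hn where "Hn n = density H (indicator (K n))" for n
  have sets_Hn [simp]: "sets (Hn n) = sets borel" for n by (simp add: Hn_def)
  have em: "emeasure (Hn n) A = emeasure H (K n \<inter> A)" if A: "A \<in> sets borel" for n A
    using A unfolding Hn_def by (subst emeasure_density) (auto simp: indicator_inter_arith[symmetric])
  have cone_sets: "cone \<Omega> r y \<in> sets borel" for r y unfolding cone_eq_fiber using \<Omega> by simp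
  show thesis
  proof (rule that[of Hn])
    show "finite_measure (Hn n)" for n
    proof
      have "space (Hn n) = UNIV" using sets_eq_imp_space_eq[OF sets_Hn] by simp
      then show "emeasure (Hn n) (space (Hn n)) \<noteq> \<infinity>"
        using H K(1,2) by (auto simp: em locally_finite_on_def less_top[symmetric])
    qed
    show "sets (Hn n) = sets borel" for n by simp
    show "emeasure (Hn n) A \<le> emeasure H A" if "A \<in> sets borel" for n A
      using that by (auto simp: em intro!: emeasure_mono)
    show inc: "incseq (\<lambda>n. emeasure (Hn n) (cone \<Omega> r y))" for y r
      using mono cone_sets by (auto simp: em mono_def intro!: emeasure_mono)
    show "(SUP n. emeasure (Hn n) (cone \<Omega> r y)) = emeasure H (cone \<Omega> r y)" for y r
    proof -
      have "(SUP n. emeasure H (K n \<inter> cone \<Omega> r y)) = emeasure H (\<Union>n. K n \<inter> cone \<Omega> r y)"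
        using mono cone_sets by (intro SUP_emeasure_incseq) (auto simp: mono_def)
      also have "(\<Union>n. K n \<inter> cone \<Omega> r y) = cone \<Omega> r y"
        using K(4) by (auto simp: cone_def)
      finally show ?thesis by (simp add: em cone_sets)
    qed
  qed
qed

lemma borel_measurable_emeasure_cone:
  fixes \<Omega> :: "(real^'n) set"
  assumes H: "locally_finite_on \<Omega> H" and \<Omega>: "open \<Omega>"
  shows "(\<lambda>y. emeasure H (cone \<Omega> r y)) \<in> borel_measurable borel"
proof -
  obtain Hn :: "nat \<Rightarrow> (real^'n) measure" where Hn: "\<And>n. finite_measure (Hn n)" "\<And>n. sets (Hn n) = sets borel"
    "\<And>y r. (SUP n. emeasure (Hn n) (cone \<Omega> r y)) = emeasure H (cone \<Omega> r y)"
    using exhaustion_by_finite_measures[OF H \<Omega>] by metis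
  have [measurable]: "(\<lambda>y. emeasure (Hn n) (cone \<Omega> r y)) \<in> borel_measurable borel" for n
    unfolding cone_eq_fiber using \<Omega>
    by (intro borel_measurable_emeasure_fiber Hn(2) finite_measure.axioms(1)[OF Hn(1)]) auto
  show ?thesis unfolding Hn(3)[symmetric] by measurable
qed

definition small_sets_transfer ::
    "bool \<Rightarrow> (real^'n) set \<Rightarrow> real \<Rightarrow> real \<Rightarrow> real \<Rightarrow> (real^'n \<Rightarrow> (real^'n) measure) \<Rightarrow> (real^'n \<Rightarrow> (real^'n) measure) \<Rightarrow> bool" where
  "small_sets_transfer b \<Omega> \<kappa> \<eta> \<epsilon> \<nu> \<nu>' \<longleftrightarrow>
     (\<forall>x\<in>frontier \<Omega>. \<forall>r>0. \<forall>P. admissible b \<Omega> \<kappa> x r P \<longrightarrow>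
        (\<forall>E\<in>sets borel. E \<subseteq> ball x r \<longrightarrow> measure (\<nu> P) E < \<eta> * measure (\<nu> P) (ball x r) \<longrightarrow>
           measure (\<nu>' P) E \<le> \<epsilon> * measure (\<nu>' P) (ball x r)))"

text \<open>Chebyshev's inequality for \<open>\<nu>\<close> and the comparison of small sets provide the good sets for \<open>\<nu>'\<close>. They also
serve for the restrictions of \<open>H\<close> to compact sets, where the absorption argument is legitimate because
the best Carleson constant is finite; the resulting constant \<open>M'\<close> is the same for all of them.\<close>

lemma carleson_transfer:
  fixes \<Omega> :: "(real^'n) set"
  assumes fam: "doubling_family b \<Omega> C \<nu>" "doubling_family b \<Omega> C \<nu>'" and C: "1 \<le> C"
    and \<Omega>: "open \<Omega>" "frontier \<Omega> \<noteq> {}" and H: "locally_finite_on \<Omega> H"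
    and W: "whitney_bound \<Omega> H (1/1024) W" "0 \<le> W"
    and M: "carleson_bound b \<Omega> H \<nu> M" "0 \<le> M"
    and small: "\<And>\<epsilon>. 0 < \<epsilon> \<Longrightarrow> \<exists>\<eta>>0. small_sets_transfer b \<Omega> 64 \<eta> \<epsilon> \<nu> \<nu>'"
  obtains M' where "carleson_bound b \<Omega> H \<nu>' M'"
proof -
  have sets_H [measurable_cong, simp]: "sets H = sets borel" using H by (simp add: locally_finite_on_def)
  obtain Hn where Hn: "\<And>n. finite_measure (Hn n)" "\<And>n. sets (Hn n) = sets borel"
    "\<And>n A. A \<in> sets borel \<Longrightarrow> emeasure (Hn n) A \<le> emeasure H A"
    "\<And>y r. incseq (\<lambda>n. emeasure (Hn n) (cone \<Omega> r y))"
    "\<And>y r. (SUP n. emeasure (Hn n) (cone \<Omega> r y)) = emeasure H (cone \<Omega> r y)"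
    using exhaustion_by_finite_measures[OF H \<Omega>(1)] by metis
  have cone_sets: "cone \<Omega> r y \<in> sets borel" for r y unfolding cone_eq_fiber using \<Omega> by simp
  note meas [measurable] = borel_measurable_emeasure_cone[OF H \<Omega>(1)]
  have meas_n [measurable]: "(\<lambda>y. emeasure (Hn n) (cone \<Omega> r y)) \<in> borel_measurable borel" for n r
    unfolding cone_eq_fiber using \<Omega>(1)
    by (intro borel_measurable_emeasure_fiber Hn(2) finite_measure.axioms(1)[OF Hn(1)]) auto
  define \<epsilon> where "\<epsilon> = 1 / (4 * C ^ 9)"
  have \<epsilon>: "0 < \<epsilon>" using C by (simp add: \<epsilon>_def)
  obtain \<eta> where \<eta>: "0 < \<eta>"
    and small': "\<And>x r P E. x \<in> frontier \<Omega> \<Longrightarrow> 0 < r \<Longrightarrow> admissible b \<Omega> 64 x r P \<Longrightarrow> E \<in> sets borel \<Longrightarrow> E \<subseteq> ball x r \<Longrightarrow>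
      measure (\<nu> P) E < \<eta> * measure (\<nu> P) (ball x r) \<Longrightarrow> measure (\<nu>' P) E \<le> \<epsilon> * measure (\<nu>' P) (ball x r)"
    using small[OF \<epsilon>] unfolding small_sets_transfer_def by blast
  \<comment> \<open>Taking \<open>M + 1\<close> instead of \<open>M\<close> makes the inequality from Chebyshev strict.\<close>
  define N where "N = (M + 1) / \<eta>"
  have N: "0 < N" using M \<eta> by (simp add: N_def)
  have good: "\<exists>F\<in>sets borel. F \<subseteq> ball x (2 * r) \<and>
         emeasure (\<nu>' P) (ball x (2 * r) - F) \<le> ennreal \<epsilon> * emeasure (\<nu>' P) (ball x (2 * r)) \<and>
         (\<forall>y\<in>F. emeasure H (cone \<Omega> r y) \<le> ennreal N)"
    if x: "x \<in> frontier \<Omega>" "0 < r" and adm: "admissible b \<Omega> 128 x r P" for x r P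
  proof -
    note sets_\<nu> [measurable_cong, simp] = doubling_familyD(1)[OF fam(1) adm]
    note sets_\<nu>' [simp] = doubling_familyD(1)[OF fam(2) adm]
    define E where "E = {y \<in> ball x (2 * r). ennreal N < emeasure H (cone \<Omega> (2 * r) y)}"
    have E [measurable]: "E \<in> sets borel"
    proof -
      have "E = ball x (2 * r) \<inter> {y \<in> space borel. ennreal N < emeasure H (cone \<Omega> (2 * r) y)}"
        by (auto simp: E_def)
      also have "\<dots> \<in> sets borel" by measurable
      finally show ?thesis .
    qed
    have adm': "admissible b \<Omega> 64 x (2 * r) P" "admissible b \<Omega> 3 x (2 * r) P" "admissible b \<Omega> 2 x (2 * r) P"
      using adm x by (auto simp: admissible_def)
    have r2: "0 < 2 * r" using x by simp
    note v = doubling_family_ball(1,2)[OF fam(1) x(1) r2 adm'(2)]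
    note v' = doubling_family_ball(1,2)[OF fam(2) x(1) r2 adm'(2)]
    have E_sub: "E \<subseteq> ball x (2 * r)" by (auto simp: E_def)
    have finE: "emeasure (\<nu> P) E < \<infinity>" "emeasure (\<nu>' P) E < \<infinity>"
      using order.strict_trans1[OF emeasure_mono[OF E_sub] v(2)] order.strict_trans1[OF emeasure_mono[OF E_sub] v'(2)]
      by auto
    have "ennreal N * emeasure (\<nu> P) E = (\<integral>\<^sup>+y. ennreal N * indicator E y \<partial>\<nu> P)"
      by (simp add: nn_integral_cmult_indicator)
    also have "\<dots> \<le> (\<integral>\<^sup>+y\<in>ball x (2 * r). emeasure H (cone \<Omega> (2 * r) y) \<partial>\<nu> P)"
      by (intro nn_integral_mono) (auto simp: E_def indicator_def)
    also have "\<dots> \<le> ennreal M * emeasure (\<nu> P) (ball x (2 * r))"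
      using M(1) x r2 adm'(3) unfolding carleson_bound_def by blast
    finally have "N * measure (\<nu> P) E \<le> M * measure (\<nu> P) (ball x (2 * r))"
      using finE v N M by (simp add: emeasure_eq_ennreal_measure less_top ennreal_mult[symmetric])
    moreover have pos: "0 < measure (\<nu> P) (ball x (2 * r))"
      using v by (simp add: emeasure_eq_ennreal_measure less_top)
    then have "M * measure (\<nu> P) (ball x (2 * r)) < (M + 1) * measure (\<nu> P) (ball x (2 * r))" by simp
    ultimately have "N * measure (\<nu> P) E < N * (\<eta> * measure (\<nu> P) (ball x (2 * r)))"
      using \<eta> by (simp add: N_def)
    then have "measure (\<nu> P) E < \<eta> * measure (\<nu> P) (ball x (2 * r))" using N by simp
    then have *: "measure (\<nu>' P) E \<le> \<epsilon> * measure (\<nu>' P) (ball x (2 * r))"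
      using E by (intro small'[OF x(1) r2 adm'(1)]) (auto simp: E_def)
    show ?thesis
    proof (intro bexI[of _ "ball x (2 * r) - E"] conjI ballI)
      have "ball x (2 * r) - (ball x (2 * r) - E) = E" by (auto simp: E_def)
      then show "emeasure (\<nu>' P) (ball x (2 * r) - (ball x (2 * r) - E)) \<le> ennreal \<epsilon> * emeasure (\<nu>' P) (ball x (2 * r))"
        using * finE v' \<epsilon> by (simp add: emeasure_eq_ennreal_measure less_top ennreal_mult[symmetric] ennreal_leI)
      fix y assume y: "y \<in> ball x (2 * r) - E"
      have "emeasure H (cone \<Omega> r y) \<le> emeasure H (cone \<Omega> (2 * r) y)"
        using cone_sets x by (intro emeasure_mono) (auto simp: cone_def)
      also have "\<dots> \<le> ennreal N" using y by (auto simp: E_def)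
      finally show "emeasure H (cone \<Omega> r y) \<le> ennreal N" .
    qed auto
  qed
  define M' where "M' = 2 * (2 * C ^ 5 * N + W) + 1"
  have Wm: "{X \<in> \<Omega>. dist X y \<le> 2 * r \<and> 1/1024 * r \<le> bdist \<Omega> X} \<in> sets borel" for y r
  proof -
    have "\<Omega> \<inter> ({X. dist X y \<le> 2 * r} \<inter> {X. 1/1024 * r \<le> bdist \<Omega> X}) \<in> sets borel"
      using \<Omega>(1) by (intro sets.Int borel_closed[OF closed_Collect_le]) (auto intro!: continuous_intros)
    then show ?thesis by (simp add: Int_def)
  qed
  have bound_n: "carleson_bound b \<Omega> (Hn n) \<nu>' M'" for n
    unfolding M'_def
  proof (rule carleson_bound_of_good_sets[OF fam(2) C \<Omega> Hn(1,2) _ W(2)])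
    show "whitney_bound \<Omega> (Hn n) (1/1024) W"
      using W(1) Hn(3)[OF Wm, of n] unfolding whitney_bound_def by (meson order_trans)
    fix x r P assume "x \<in> frontier \<Omega>" "0 < r" "admissible b \<Omega> 128 x r P"
    from good[OF this]
    show "\<exists>F\<in>sets borel. F \<subseteq> ball x (2 * r) \<and>
         emeasure (\<nu>' P) (ball x (2 * r) - F) \<le> ennreal (1 / (4 * C ^ 9)) * emeasure (\<nu>' P) (ball x (2 * r)) \<and>
         (\<forall>y\<in>F. emeasure (Hn n) (cone \<Omega> r y) \<le> ennreal N)"
      unfolding \<epsilon>_def using Hn(3)[OF cone_sets, of n r] by (meson order_trans)
  qed (use N in simp)
  have "carleson_bound b \<Omega> H \<nu>' M'"
    unfolding carleson_bound_def
  proof (intro ballI allI impI)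
    fix x r P assume x: "x \<in> frontier \<Omega>" "0 < r" and adm: "admissible b \<Omega> 2 x r P"
    note sets_\<nu>' [measurable_cong, simp] = doubling_familyD(1)[OF fam(2) adm]
    have [measurable]: "ball x r \<in> sets (\<nu>' P)" by simp
    have "(\<integral>\<^sup>+y\<in>ball x r. emeasure H (cone \<Omega> r y) \<partial>\<nu>' P)
       = (\<integral>\<^sup>+y. (SUP n. emeasure (Hn n) (cone \<Omega> r y) * indicator (ball x r) y) \<partial>\<nu>' P)"
      unfolding Hn(5)[symmetric] by (simp add: SUP_mult_right_ennreal)
    also have "\<dots> = (SUP n. \<integral>\<^sup>+y\<in>ball x r. emeasure (Hn n) (cone \<Omega> r y) \<partial>\<nu>' P)"
    proof (rule nn_integral_monotone_convergence_SUP)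
      show "incseq (\<lambda>n y. emeasure (Hn n) (cone \<Omega> r y) * indicator (ball x r) y)"
        using Hn(4) by (auto simp: mono_def le_fun_def intro!: mult_right_mono)
      have "(\<lambda>y. emeasure (Hn n) (cone \<Omega> r y)) \<in> borel_measurable (\<nu>' P)" for n
        using meas_n by (simp add: measurable_cong_sets[OF sets_\<nu>' refl])
      then show "(\<lambda>y. emeasure (Hn n) (cone \<Omega> r y) * indicator (ball x r) y) \<in> borel_measurable (\<nu>' P)" for n
        by measurable
    qed
    also have "\<dots> \<le> ennreal M' * emeasure (\<nu>' P) (ball x r)"
      using bound_n x adm unfolding carleson_bound_def by (intro SUP_least) blast
    finally show "(\<integral>\<^sup>+y\<in>ball x r. emeasure H (cone \<Omega> r y) \<partial>\<nu>' P) \<le> ennreal M' * emeasure (\<nu>' P) (ball x r)" .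
  qed
  then show thesis by (rule that)
qed

text \<open>The localization of \<open>half_comparable_imp_small\<close> to a ball: for a fixed pole both measures are
restricted to the ball of radius \<open>20 r\<close>, where they are finite and which contains all balls that matter.
A pole at distance \<open>64 r\<close> is admissible for all of these. The hypothesis is used in contrapositive form, and the
proportion 1/4 is less than one half because the comparison of small sets is stated with a weak inequality.\<close>

lemma small_sets_transfer_reverse:
  fixes \<Omega> :: "(real^'n) set"
  assumes fam: "doubling_family b \<Omega> C \<nu>" "doubling_family b \<Omega> C \<nu>'" and C: "1 \<le> C"
    and \<zeta>: "0 < \<zeta>" and weak: "small_sets_transfer b \<Omega> 3 \<zeta> (1/4) \<nu>' \<nu>" and \<epsilon>: "0 < \<epsilon>"
  obtains \<eta> where "0 < \<eta>" "small_sets_transfer b \<Omega> 64 \<eta> \<epsilon> \<nu> \<nu>'"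
proof -
  have C3: "1 \<le> C ^ 3" using C by (rule one_le_power)
  obtain \<eta> where \<eta>: "0 < \<eta>" and main:
    "\<And>(n :: (real^'n) measure) n' S x\<^sub>0 r E.
       \<lbrakk>finite_measure n; finite_measure n'; sets n = sets borel; sets n' = sets borel;
        closed S; emeasure n' (- S) = 0; x\<^sub>0 \<in> S; 0 < r;
        ball_doubling S x\<^sub>0 (2 * r) (3 * r) (C ^ 3) n; ball_doubling S x\<^sub>0 (2 * r) (3 * r) (C ^ 3) n';
        half_comparable S x\<^sub>0 (2 * r) r \<zeta> n n';
        E \<in> sets borel; E \<subseteq> ball x\<^sub>0 r; measure n E < \<eta> * measure n (ball x\<^sub>0 r)\<rbrakk>
       \<Longrightarrow> measure n' E \<le> \<epsilon> * measure n' (ball x\<^sub>0 r)"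
    using half_comparable_imp_small[OF C3 \<zeta> \<epsilon>] by blast
  have "small_sets_transfer b \<Omega> 64 \<eta> \<epsilon> \<nu> \<nu>'"
    unfolding small_sets_transfer_def
  proof (intro ballI allI impI)
    fix x r P E assume x: "x \<in> frontier \<Omega>" "0 < r" and adm: "admissible b \<Omega> 64 x r P"
      and E: "E \<in> sets borel" "E \<subseteq> ball x r" "measure (\<nu> P) E < \<eta> * measure (\<nu> P) (ball x r)"
    define loc where "loc N = density N (indicator (ball x (20 * r)))" for N :: "(real^'n) measure"
    have loc: "emeasure (loc N) A = emeasure N (ball x (20 * r) \<inter> A)" "sets (loc N) = sets borel"
      if N: "sets N = sets borel" "A \<in> sets borel" for N A
    proof -
      have "ball x (20 * r) \<in> sets N" "A \<in> sets N" using N by auto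
      then show "emeasure (loc N) A = emeasure N (ball x (20 * r) \<inter> A)"
        unfolding loc_def by (subst emeasure_density) (auto simp: indicator_inter_arith[symmetric])
    qed (simp add: loc_def N)
    have loc_eq: "emeasure (loc N) A = emeasure N A" "measure (loc N) A = measure N A"
      if "sets N = sets borel" "A \<in> sets borel" "A \<subseteq> ball x (20 * r)" for N A
      using loc(1)[OF that(1,2)] that(3) by (simp_all add: measure_def Int_absorb1)
    have fin: "finite_measure (loc (N P))" and null: "emeasure (loc (N P)) (- frontier \<Omega>) = 0"
      and dbl: "ball_doubling (frontier \<Omega>) x (2 * r) (3 * r) (C ^ 3) (loc (N P))"
      if N: "doubling_family b \<Omega> C N" for N
    proof -
      note sets_N [simp] = doubling_familyD(1)[OF N adm]
      have "emeasure (N P) (ball x (20 * r)) < \<infinity>"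
        using x adm by (intro doubling_family_ball[OF N]) (auto simp: admissible_def)
      then show "finite_measure (loc (N P))"
        using sets_eq_imp_space_eq[OF loc(2)[of "N P" UNIV]]
        by (intro finite_measureI) (simp add: loc(1))
      have "emeasure (loc (N P)) (- frontier \<Omega>) \<le> emeasure (N P) (- frontier \<Omega>)"
        by (subst loc(1)) (auto intro!: emeasure_mono)
      then show "emeasure (loc (N P)) (- frontier \<Omega>) = 0" using doubling_familyD(2)[OF N adm] by simp
      show "ball_doubling (frontier \<Omega>) x (2 * r) (3 * r) (C ^ 3) (loc (N P))"
        unfolding ball_doubling_def
      proof (intro ballI allI impI)
        fix y s assume y: "y \<in> frontier \<Omega> \<inter> ball x (2 * r)" and s: "0 < s \<and> s \<le> 3 * r"
        have sub: "ball y (5 * s) \<subseteq> ball x (20 * r)"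
        proof
          fix z assume "z \<in> ball y (5 * s)"
          then show "z \<in> ball x (20 * r)" using y s dist_triangle[of x z y] by simp
        qed
        moreover have "ball y s \<subseteq> ball y (5 * s)" using s by (intro subset_ball) auto
        ultimately have sub': "ball y s \<subseteq> ball x (20 * r)" by blast
        have "admissible b \<Omega> 3 y s P" using y s by (intro admissible_shift[OF adm]) auto
        then have "0 < emeasure (N P) (ball y s)" using y s by (intro doubling_family_ball[OF N]) auto
        moreover have "emeasure (N P) (ball y (5 * s)) \<le> ennreal (C ^ 3) * emeasure (N P) (ball y s)"
        proof -
          have "emeasure (N P) (ball y (5 * s)) \<le> emeasure (N P) (ball y (2 ^ 3 * s))"
            using s by (intro emeasure_mono subset_ball) auto
          also have "\<dots> \<le> ennreal (C ^ 3) * emeasure (N P) (ball y s)"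
            using y s by (intro doubling_family_iterate[OF N C] admissible_shift[OF adm]) auto
          finally show ?thesis .
        qed
        ultimately show "0 < emeasure (loc (N P)) (ball y s) \<and>
            emeasure (loc (N P)) (ball y (5 * s)) \<le> ennreal (C ^ 3) * emeasure (loc (N P)) (ball y s)"
          using sub sub' by (simp add: loc_eq)
      qed
    qed
    note sets_\<nu> [simp] = doubling_familyD(1)[OF fam(1) adm] doubling_familyD(1)[OF fam(2) adm]
    have comp: "half_comparable (frontier \<Omega>) x (2 * r) r \<zeta> (loc (\<nu> P)) (loc (\<nu>' P))"
      unfolding half_comparable_def
    proof (intro ballI allI impI)
      fix y s G assume y: "y \<in> frontier \<Omega> \<inter> ball x (2 * r)" and s: "0 < s \<and> s \<le> r"
        and G: "G \<in> sets borel" "G \<subseteq> ball y s" "measure (loc (\<nu> P)) (ball y s) \<le> 2 * measure (loc (\<nu> P)) G"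
      have sub: "ball y s \<subseteq> ball x (20 * r)"
      proof
        fix z assume "z \<in> ball y s"
        then show "z \<in> ball x (20 * r)" using y s dist_triangle[of x z y] by simp
      qed
      then have sub': "G \<subseteq> ball x (20 * r)" using G by auto
      have adm_y: "admissible b \<Omega> 3 y s P" using y s by (intro admissible_shift[OF adm]) auto
      have "0 < measure (\<nu> P) (ball y s)"
        using doubling_family_ball(1,2)[OF fam(1) _ _ adm_y] y s
        by (simp add: emeasure_eq_ennreal_measure less_top)
      then have "\<not> measure (\<nu> P) G \<le> 1/4 * measure (\<nu> P) (ball y s)"
        using G sub sub' by (simp add: loc_eq)
      then have "\<not> measure (\<nu>' P) G < \<zeta> * measure (\<nu>' P) (ball y s)"
        using weak y s adm_y G(1,2) unfolding small_sets_transfer_def by blast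
      then show "\<zeta> * measure (loc (\<nu>' P)) (ball y s) \<le> measure (loc (\<nu>' P)) G"
        using G sub sub' by (simp add: loc_eq)
    qed
    have sub: "ball x r \<subseteq> ball x (20 * r)" using x by (intro subset_ball) auto
    have "measure (loc (\<nu>' P)) E \<le> \<epsilon> * measure (loc (\<nu>' P)) (ball x r)"
    proof (rule main[OF fin[OF fam(1)] fin[OF fam(2)] _ _ frontier_closed null[OF fam(2)] x
          dbl[OF fam(1)] dbl[OF fam(2)] comp E(1,2)])
      show "measure (loc (\<nu> P)) E < \<eta> * measure (loc (\<nu> P)) (ball x r)"
        using E sub by (simp add: loc_eq subset_trans)
    qed (simp_all add: loc(2)[OF _ sets.top])
    then show "measure (\<nu>' P) E \<le> \<epsilon> * measure (\<nu>' P) (ball x r)"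
      using E sub by (simp add: loc_eq subset_trans)
  qed
  with \<eta> show thesis by (rule that)
qed

text \<open>If the source is an elliptic measure and the target a single measure, the transfer only reaches
balls for which a pole exists, while the target needs all balls. The missing ones are large
balls in a bounded domain; they are covered by balls of a fixed size, and the heights above that size
belong to a compact part of \<open>\<Omega>\<close>.\<close>

lemma carleson_bound_drop_poles:
  fixes \<Omega> :: "(real^'n) set"
  assumes fam: "doubling_family False \<Omega> C \<nu>" and C: "1 \<le> C" and \<Omega>: "open \<Omega>" "frontier \<Omega> \<noteq> {}"
    and H: "locally_finite_on \<Omega> H" and const: "\<And>P Q. \<nu> P = \<nu> Q"
    and M: "carleson_bound True \<Omega> H \<nu> M" "0 \<le> M"
  obtains M' where "carleson_bound False \<Omega> H \<nu> M'"
proof -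
  have sets_H [simp]: "sets H = sets borel" using H by (simp add: locally_finite_on_def)
  have "\<Omega> \<noteq> {}" using \<Omega>(2) by auto
  then obtain \<rho> where \<rho>: "0 < \<rho>" "\<And>x r. 0 < r \<Longrightarrow> r \<le> \<rho> \<or> \<not> bounded \<Omega> \<Longrightarrow> \<exists>P\<in>\<Omega>. 2 * r \<le> dist x P"
    using far_pole_exists[OF \<Omega>(1)] by blast
  have far: "(\<integral>\<^sup>+y\<in>ball x r. emeasure H (cone \<Omega> r y) \<partial>\<nu> P) \<le> ennreal M * emeasure (\<nu> P) (ball x r)"
    if x: "x \<in> frontier \<Omega>" "0 < r" "r \<le> \<rho> \<or> \<not> bounded \<Omega>" for x r P
  proof -
    obtain Q where "Q \<in> \<Omega>" "2 * r \<le> dist x Q" using \<rho>(2) x by blast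
    then have "admissible True \<Omega> 2 x r Q" by (simp add: admissible_def)
    then have "(\<integral>\<^sup>+y\<in>ball x r. emeasure H (cone \<Omega> r y) \<partial>\<nu> Q) \<le> ennreal M * emeasure (\<nu> Q) (ball x r)"
      using M(1) x unfolding carleson_bound_def by blast
    then show ?thesis by (simp only: const[of P Q])
  qed
  define W where "W = (if bounded \<Omega> then enn2real (emeasure H {X \<in> \<Omega>. \<rho> / 2 \<le> bdist \<Omega> X}) else 0)"
  have W: "0 \<le> W" by (simp add: W_def)
  define M' where "M' = M * C ^ 4 + W"
  have M'_ge: "M \<le> M'"
  proof -
    have "M * 1 \<le> M * C ^ 4" using M(2) C by (intro mult_left_mono one_le_power) auto
    then show ?thesis using W by (simp add: M'_def)
  qed
  have "carleson_bound False \<Omega> H \<nu> M'"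
    unfolding carleson_bound_def
  proof (intro ballI allI impI)
    fix x r P assume x: "x \<in> frontier \<Omega>" "0 < r" and adm: "admissible False \<Omega> 2 x r P"
    show "(\<integral>\<^sup>+y\<in>ball x r. emeasure H (cone \<Omega> r y) \<partial>\<nu> P) \<le> ennreal M' * emeasure (\<nu> P) (ball x r)"
    proof (cases "r \<le> \<rho> \<or> \<not> bounded \<Omega>")
      case True
      have "ennreal M * emeasure (\<nu> P) (ball x r) \<le> ennreal M' * emeasure (\<nu> P) (ball x r)"
        using M'_ge by (intro mult_right_mono ennreal_leI) auto
      then show ?thesis using far[OF x True] by (rule order.trans[rotated])
    next
      case False
      note sets_\<nu> [measurable_cong, simp] = doubling_familyD(1)[OF fam adm]
      define g where "g y = emeasure H (cone \<Omega> (\<rho> / 2) y)" for y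
      have g: "g \<in> borel_measurable borel" unfolding g_def by (rule borel_measurable_emeasure_cone[OF H \<Omega>(1)])
      have "(\<integral>\<^sup>+y\<in>ball x r. g y \<partial>\<nu> P) \<le> ennreal (M * C ^ 4) * emeasure (\<nu> P) (ball x r)"
      proof (rule doubling_family_small_balls[OF fam C x adm _ _ g M(2)])
        show "0 < \<rho> / 2" "\<rho> / 2 \<le> r / 2" using \<rho>(1) False by auto
        fix y assume "y \<in> frontier \<Omega> \<inter> ball x r"
        then show "(\<integral>\<^sup>+z\<in>ball y (\<rho> / 2). g z \<partial>\<nu> P) \<le> ennreal M * emeasure (\<nu> P) (ball y (\<rho> / 2))"
          unfolding g_def using \<rho>(1) by (intro far) auto
      qed
      moreover have "(\<integral>\<^sup>+y\<in>ball x r. emeasure H (cone \<Omega> r y) \<partial>\<nu> P) \<le> (\<integral>\<^sup>+y. g y * indicator (ball x r) y + ennreal W * indicator (ball x r) y \<partial>\<nu> P)"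
      proof (rule nn_integral_mono)
        fix y
        have "emeasure H (cone \<Omega> r y) \<le> g y + emeasure H {X \<in> \<Omega>. dist X y \<le> 2 * r \<and> \<rho> / 2 \<le> bdist \<Omega> X}"
          unfolding g_def by (rule emeasure_cone_split[OF sets_H \<Omega>(1)])
        also have "emeasure H {X \<in> \<Omega>. dist X y \<le> 2 * r \<and> \<rho> / 2 \<le> bdist \<Omega> X} \<le> emeasure H {X \<in> \<Omega>. \<rho> / 2 \<le> bdist \<Omega> X}"
        proof (rule emeasure_mono)
          have "\<Omega> \<inter> {X. \<rho> / 2 \<le> bdist \<Omega> X} \<in> sets borel"
            using \<Omega>(1) by (intro sets.Int borel_closed[OF closed_Collect_le]) (auto intro!: continuous_intros)
          then show "{X \<in> \<Omega>. \<rho> / 2 \<le> bdist \<Omega> X} \<in> sets H" by (simp add: Int_def)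
        qed auto
        also have "\<dots> = ennreal W"
          using emeasure_away_from_boundary[OF H \<Omega>(1) _ \<Omega>(2), of "\<rho> / 2"] False \<rho>(1) by (simp add: W_def)
        finally show "emeasure H (cone \<Omega> r y) * indicator (ball x r) y \<le> g y * indicator (ball x r) y + ennreal W * indicator (ball x r) y"
          by (auto simp: indicator_def add_left_mono)
      qed
      moreover have "\<dots> = (\<integral>\<^sup>+y\<in>ball x r. g y \<partial>\<nu> P) + ennreal W * emeasure (\<nu> P) (ball x r)"
      proof (subst nn_integral_add)
        have [measurable]: "ball x r \<in> sets (\<nu> P)" "g \<in> borel_measurable (\<nu> P)"
          using g by (simp_all add: measurable_cong_sets[OF sets_\<nu> refl])
        show "(\<lambda>y. g y * indicator (ball x r) y) \<in> borel_measurable (\<nu> P)"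
          "(\<lambda>y. ennreal W * indicator (ball x r) y) \<in> borel_measurable (\<nu> P)" by measurable
      qed (simp add: nn_integral_cmult_indicator)
      ultimately have "(\<integral>\<^sup>+y\<in>ball x r. emeasure H (cone \<Omega> r y) \<partial>\<nu> P)
          \<le> ennreal (M * C ^ 4) * emeasure (\<nu> P) (ball x r) + ennreal W * emeasure (\<nu> P) (ball x r)"
        by (simp add: order.trans add_right_mono)
      also have "\<dots> = ennreal M' * emeasure (\<nu> P) (ball x r)"
        using M C W by (simp add: M'_def distrib_right)
      finally show ?thesis .
    qed
  qed
  then show thesis by (rule that)
qed

section \<open>The area function as a measure of cones\<close>

text \<open>The measure on all Borel sets of the surrounding space that is induced by a measure on a subset, such as \<open>m\<close> on \<open>\<Omega>\<close> or
an elliptic measure on the boundary.\<close>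

definition ambient :: "'a::topological_space measure \<Rightarrow> 'a measure" where
  "ambient M = distr M borel (\<lambda>x. x)"

lemma sets_ambient [simp, measurable_cong]: "sets (ambient M) = sets borel"
  by (simp add: ambient_def)

lemma emeasure_ambient:
  "(\<lambda>x. x) \<in> borel_measurable M \<Longrightarrow> A \<in> sets borel \<Longrightarrow> emeasure (ambient M) A = emeasure M (A \<inter> space M)"
  unfolding ambient_def by (subst emeasure_distr) auto

lemma measure_ambient:
  "(\<lambda>x. x) \<in> borel_measurable M \<Longrightarrow> A \<in> sets borel \<Longrightarrow> measure (ambient M) A = measure M (A \<inter> space M)"
  by (simp add: measure_def emeasure_ambient)

lemma divide_ennreal_le:
  assumes "0 < c" "ennreal c \<le> b"
  shows "a / b \<le> ennreal (1 / c) * a"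
proof (cases b)
  case (real r)
  then have r: "c \<le> r" using assms by simp
  have "inverse b = ennreal (1 / r)" using real r assms(1) by (simp add: inverse_ennreal divide_inverse)
  also have "\<dots> \<le> ennreal (1 / c)" using r assms(1) by (intro ennreal_leI) (simp add: field_simps)
  finally show ?thesis by (simp add: divide_ennreal_def mult.commute[of _ a] mult_left_mono)
qed simp

text \<open>Balls are connected, so a ball that leaves \<open>\<Omega>\<close> meets the boundary.\<close>

lemma ball_subset_domain:
  assumes "X \<in> \<Omega>"
  shows "ball X (bdist \<Omega> X) \<subseteq> \<Omega>"
proof (rule ccontr)
  assume "\<not> ?thesis"
  then have ne: "ball X (bdist \<Omega> X) - \<Omega> \<noteq> {}" by auto
  then have "0 < bdist \<Omega> X" by (auto intro: le_less_trans[OF zero_le_dist])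
  then have "ball X (bdist \<Omega> X) \<inter> \<Omega> \<noteq> {}" using assms centre_in_ball by blast
  then obtain y where "y \<in> ball X (bdist \<Omega> X)" "y \<in> frontier \<Omega>"
    using connected_Int_frontier[OF connected_ball] ne by blast
  then show False using bdist_le[of y \<Omega> X] by simp
qed

lemma weighted_measure_space:
  assumes "weighted_measure \<Omega> m"
  shows "sets m = sets (lebesgue_on \<Omega>)" "space m = \<Omega>" "(\<lambda>x. x) \<in> borel_measurable m"
proof -
  show s: "sets m = sets (lebesgue_on \<Omega>)" using assms by (auto simp: weighted_measure_def)
  show "space m = \<Omega>" using sets_eq_imp_space_eq[OF s] by simp
  have "(\<lambda>x. x) \<in> borel_measurable (lebesgue_on \<Omega>)"
    by (intro measurable_restrict_space1 measurable_completion) simp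
  then show "(\<lambda>x. x) \<in> borel_measurable m" by (simp add: measurable_cong_sets[OF s refl])
qed

lemma locally_finite_on_weighted_measure:
  assumes w: "weighted_measure \<Omega> m" and \<Omega>: "open \<Omega>"
  shows "locally_finite_on \<Omega> (ambient m)"
  unfolding locally_finite_on_def
proof (intro conjI allI impI)
  note m = weighted_measure_space[OF w]
  fix K assume K: "compact K \<and> K \<subseteq> \<Omega>"
  obtain w where w: "w \<in> borel_measurable (lebesgue_on \<Omega>)" "\<And>X. X \<in> \<Omega> \<Longrightarrow> 0 \<le> w X"
    "set_integrable lebesgue K w" "m = density (lebesgue_on \<Omega>) (\<lambda>X. ennreal (w X))"
    using assms(1) K unfolding weighted_measure_def by blast
  have [simp]: "\<Omega> \<in> sets lebesgue" using \<Omega> by (simp add: borel_open)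
  have K_borel: "K \<in> sets borel" using K by (simp add: compact_imp_closed borel_closed)
  then have K_sets: "K \<in> sets (lebesgue_on \<Omega>)"
    using K by (auto simp: sets_restrict_space image_iff intro!: bexI[of _ K])
  have "emeasure (ambient m) K = emeasure m K"
    using K K_borel m by (simp add: emeasure_ambient Int_absorb2)
  also have "\<dots> = (\<integral>\<^sup>+X\<in>K. ennreal (w X) \<partial>lebesgue_on \<Omega>)"
    unfolding w(4) using w(1) K_sets by (intro emeasure_density) auto
  also have "\<dots> = (\<integral>\<^sup>+X. ennreal (w X) * indicator K X * indicator \<Omega> X \<partial>lebesgue)"
    by (rule nn_integral_restrict_space) simp
  also have "\<dots> \<le> (\<integral>\<^sup>+X. ennreal (norm (indicator K X *\<^sub>R w X)) \<partial>lebesgue)"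
    using w(2) by (intro nn_integral_mono) (auto simp: indicator_def)
  also have "\<dots> < \<infinity>"
    using w(3) unfolding set_integrable_def integrable_iff_bounded by simp
  finally show "emeasure (ambient m) K < \<infinity>" .
qed simp

lemma sigma_finite_locally_finite:
  assumes H: "locally_finite_on \<Omega> H" and \<Omega>: "open \<Omega>" and null: "emeasure H (- \<Omega>) = 0"
  shows "sigma_finite_measure H"
proof
  have sets_H [simp]: "sets H = sets borel" using H by (simp add: locally_finite_on_def)
  have space_H: "space H = UNIV" using sets_eq_imp_space_eq[OF sets_H] by simp
  obtain K :: "nat \<Rightarrow> _" where K: "\<And>n. compact (K n)" "\<And>n. K n \<subseteq> \<Omega>" "(\<Union>n. K n) = \<Omega>"
    using open_Union_compact_subsets[OF \<Omega>] by metis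
  have "range K \<subseteq> sets borel" using K(1) by (auto simp: compact_imp_closed borel_closed)
  moreover have "- \<Omega> \<in> sets borel" using \<Omega> by auto
  ultimately show "\<exists>A. countable A \<and> A \<subseteq> sets H \<and> \<Union>A = space H \<and> (\<forall>a\<in>A. emeasure H a \<noteq> \<infinity>)"
    using K H null by (intro exI[of _ "insert (- \<Omega>) (range K)"]) (auto simp: space_H locally_finite_on_def less_top)
qed

definition area_density :: "(real^'n) set \<Rightarrow> (real^'n) measure \<Rightarrow> (real^'n \<Rightarrow> real) \<Rightarrow> real^'n \<Rightarrow> ennreal" where
  "area_density \<Omega> m f X = ennreal (\<bar>f X\<bar>\<^sup>2) / emeasure m (ball X (bdist \<Omega> X / 4))"

definition area_measure :: "(real^'n) set \<Rightarrow> (real^'n) measure \<Rightarrow> (real^'n \<Rightarrow> real) \<Rightarrow> (real^'n) measure" where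
  "area_measure \<Omega> m f = ambient (density m (area_density \<Omega> m f))"

lemma L2_loc_borel_measurable:
  assumes w: "weighted_measure \<Omega> m" and f: "f \<in> L2_loc m \<Omega>"
  shows "f \<in> borel_measurable m"
proof -
  note m = weighted_measure_space[OF w]
  have "sets (restrict_space m \<Omega>) = (\<inter>) (space m) ` sets m" by (simp add: sets_restrict_space m(2))
  also have "\<dots> = (\<lambda>A. A) ` sets m" by (rule image_cong) (simp_all add: Int_absorb1 sets.sets_into_space)
  finally have "sets (restrict_space m \<Omega>) = sets m" by simp
  from measurable_cong_sets[OF this refl] show ?thesis using f unfolding L2_loc_def by blast
qed

lemma ambient_whitney_ball:
  assumes "weighted_measure \<Omega> m" "X \<in> \<Omega>"
  shows "emeasure (ambient m) (ball X (bdist \<Omega> X / 4)) = emeasure m (ball X (bdist \<Omega> X / 4))"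
proof -
  have "ball X (bdist \<Omega> X / 4) \<subseteq> ball X (bdist \<Omega> X)" using bdist_nonneg[of \<Omega> X] by (intro subset_ball) simp
  then have "ball X (bdist \<Omega> X / 4) \<subseteq> \<Omega>" using ball_subset_domain[OF assms(2)] by simp
  then show ?thesis
    using weighted_measure_space[OF assms(1)] by (simp add: emeasure_ambient Int_absorb2)
qed

text \<open>The only issue is the measurability of \<open>X \<mapsto> m(B\<^sub>X)\<close>, which comes from the product structure: \<open>m(B\<^sub>X)\<close> is the
measure of a section of an open set.\<close>

lemma area_density_measurable:
  fixes \<Omega> :: "(real^'n) set"
  assumes w: "weighted_measure \<Omega> m" and \<Omega>: "open \<Omega>" and f: "f \<in> L2_loc m \<Omega>"
  shows "area_density \<Omega> m f \<in> borel_measurable m"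
proof -
  note m = weighted_measure_space[OF w]
  note lf = locally_finite_on_weighted_measure[OF w \<Omega>]
  have "emeasure (ambient m) (- \<Omega>) = 0" using \<Omega> m by (subst emeasure_ambient) auto
  then interpret sigma_finite_measure "ambient m" by (rule sigma_finite_locally_finite[OF lf \<Omega>])
  have "open {p :: (real^'n) \<times> (real^'n). dist (fst p) (snd p) < bdist \<Omega> (fst p) / 4}"
    by (intro open_Collect_less continuous_intros) auto
  then have "{p :: (real^'n) \<times> (real^'n). dist (fst p) (snd p) < bdist \<Omega> (fst p) / 4} \<in> sets (borel \<Otimes>\<^sub>M borel)"
    unfolding borel_prod by (rule borel_open)
  then have "{p :: (real^'n) \<times> (real^'n). dist (fst p) (snd p) < bdist \<Omega> (fst p) / 4} \<in> sets (borel \<Otimes>\<^sub>M ambient m)"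
    unfolding sets_pair_measure_cong[OF refl sets_ambient, of borel m] .
  from measurable_emeasure_Pair[OF this]
  have "(\<lambda>X. emeasure (ambient m) (ball X (bdist \<Omega> X / 4))) \<in> borel_measurable borel"
    by (simp add: ball_def vimage_def)
  from measurable_compose[OF m(3) this]
  have "(\<lambda>X. emeasure (ambient m) (ball X (bdist \<Omega> X / 4))) \<in> borel_measurable m" .
  then have [measurable]: "(\<lambda>X. emeasure m (ball X (bdist \<Omega> X / 4))) \<in> borel_measurable m"
    by (rule measurable_cong[THEN iffD1, rotated]) (simp add: ambient_whitney_ball[OF w] m(2))
  note [measurable] = L2_loc_borel_measurable[OF w f]
  show ?thesis unfolding area_density_def by measurable
qed

lemma area_fun_eq:
  fixes \<Omega> :: "(real^'n) set"
  assumes w: "weighted_measure \<Omega> m" and \<Omega>: "open \<Omega>" and f: "f \<in> L2_loc m \<Omega>"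
  shows "A \<in> sets borel \<Longrightarrow> A \<subseteq> \<Omega> \<Longrightarrow> emeasure (area_measure \<Omega> m f) A = (\<integral>\<^sup>+X\<in>A. area_density \<Omega> m f X \<partial>m)"
    and "(area_fun \<Omega> m r f y)\<^sup>2 = emeasure (area_measure \<Omega> m f) (cone \<Omega> r y)"
proof -
  note m = weighted_measure_space[OF w]
  have id: "(\<lambda>x. x) \<in> borel_measurable (density m (area_density \<Omega> m f))"
    using m(3) by simp
  show *: "emeasure (area_measure \<Omega> m f) A = (\<integral>\<^sup>+X\<in>A. area_density \<Omega> m f X \<partial>m)"
    if A: "A \<in> sets borel" "A \<subseteq> \<Omega>" for A
  proof -
    have "(\<lambda>x. x) -` A \<inter> space m \<in> sets m" using m(3) A(1) by (rule measurable_sets)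
    then have "A \<in> sets m" using A(2) m(2) by (simp add: Int_absorb2)
    have "emeasure (area_measure \<Omega> m f) A = emeasure (density m (area_density \<Omega> m f)) (A \<inter> \<Omega>)"
      using emeasure_ambient[OF id A(1)] by (simp add: area_measure_def m(2))
    also have "\<dots> = (\<integral>\<^sup>+X\<in>A. area_density \<Omega> m f X \<partial>m)"
      using A(2) \<open>A \<in> sets m\<close> area_density_measurable[OF w \<Omega> f] by (simp add: Int_absorb2 emeasure_density)
    finally show ?thesis .
  qed
  have "cone \<Omega> r y \<in> sets borel" unfolding cone_eq_fiber using \<Omega> by simp
  then show "(area_fun \<Omega> m r f y)\<^sup>2 = emeasure (area_measure \<Omega> m f) (cone \<Omega> r y)"
    by (subst *) (auto simp: area_fun_def ennreal_sqrt_power2 area_density_def cone_def)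
qed

text \<open>A degenerate weight is not excluded, but by doubling it vanishes either everywhere or on no ball.\<close>

lemma doubling_null_ball:
  fixes \<Omega> :: "(real^'n) set"
  assumes w: "weighted_measure \<Omega> m" and d: "m_doubling \<Omega> m" and \<Omega>: "open \<Omega>"
    and X: "X \<in> \<Omega>" "0 < r" and null: "emeasure m (ball X r \<inter> \<Omega>) = 0"
  shows "emeasure m \<Omega> = 0"
proof -
  note m = weighted_measure_space[OF w]
  obtain C where C: "\<And>s. 0 < s \<Longrightarrow> emeasure m (ball X (2 * s) \<inter> \<Omega>) \<le> ennreal C * emeasure m (ball X s \<inter> \<Omega>)"
    using d X(1) closure_subset[of \<Omega>] unfolding m_doubling_def by blast
  have z: "emeasure m (ball X (2 ^ k * r) \<inter> \<Omega>) = 0" for k :: nat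
  proof (induction k)
    case (Suc k)
    have "emeasure m (ball X (2 * (2 ^ k * r)) \<inter> \<Omega>) \<le> ennreal C * emeasure m (ball X (2 ^ k * r) \<inter> \<Omega>)"
      using X(2) by (intro C) simp
    then show ?case using Suc.IH by (simp add: mult.assoc)
  qed (use null in simp)
  have "\<Omega> \<subseteq> (\<Union>k. ball X (2 ^ k * r) \<inter> \<Omega>)"
  proof
    fix Y assume "Y \<in> \<Omega>"
    obtain k :: nat where "dist X Y / r < 2 ^ k" using real_arch_pow[of 2 "dist X Y / r"] by auto
    then show "Y \<in> (\<Union>k. ball X (2 ^ k * r) \<inter> \<Omega>)" using \<open>Y \<in> \<Omega>\<close> X(2) by (auto simp: field_simps)
  qed
  then have eq: "\<Omega> = (\<Union>k. ball X (2 ^ k * r) \<inter> \<Omega>)" by auto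
  have "ball X (2 ^ k * r) \<inter> \<Omega> \<in> sets m" for k :: nat
    using measurable_sets[OF m(3), of "ball X (2 ^ k * r)"] m(2) by simp
  then have "emeasure m (\<Union>k. ball X (2 ^ k * r) \<inter> \<Omega>) = 0"
    using z by (intro emeasure_UN_eq_0) auto
  then show ?thesis using eq by simp
qed

text \<open>On a compact subset \<open>m(B\<^sub>X)\<close> is bounded below: finitely many balls \<open>B(t, \<delta>(t)/16)\<close> cover it, and \<open>B\<^sub>X\<close> contains the
one in which \<open>X\<close> lies. If \<open>m\<close> vanishes, then so does \<open>H\<close>.\<close>

lemma locally_finite_on_area_measure:
  fixes \<Omega> :: "(real^'n) set"
  assumes w: "weighted_measure \<Omega> m" and d: "m_doubling \<Omega> m" and \<Omega>: "open \<Omega>" "frontier \<Omega> \<noteq> {}" and f: "f \<in> L2_loc m \<Omega>"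
  shows "locally_finite_on \<Omega> (area_measure \<Omega> m f)"
  unfolding locally_finite_on_def
proof (intro conjI allI impI)
  note m = weighted_measure_space[OF w]
  show "sets (area_measure \<Omega> m f) = sets borel" by (simp add: area_measure_def)
  fix K assume K: "compact K \<and> K \<subseteq> \<Omega>"
  have K_borel: "K \<in> sets borel" using K by (simp add: compact_imp_closed borel_closed)
  note em = area_fun_eq(1)[OF w \<Omega>(1) f K_borel conjunct2[OF K]]
  show "emeasure (area_measure \<Omega> m f) K < \<infinity>"
  proof (cases "emeasure m \<Omega> = 0")
    case True
    have "AE X in m. False"
      using True m(2) sets.top[of m] by (intro AE_I[where N = \<Omega>]) auto
    then have "(\<integral>\<^sup>+X\<in>K. area_density \<Omega> m f X \<partial>m) = (\<integral>\<^sup>+X. 0 \<partial>m)" by (intro nn_integral_cong_AE) auto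
    then show ?thesis using em by simp
  next
    case False
    have pos: "0 < emeasure m (ball X s \<inter> \<Omega>)" if "X \<in> \<Omega>" "0 < s" for X s
      using doubling_null_ball[OF w d \<Omega>(1) that] False by (auto simp: zero_less_iff_neq_zero)
    have \<delta>: "0 < bdist \<Omega> X" if "X \<in> \<Omega>" for X using bdist_pos[OF \<Omega> that] .
    obtain T where T: "T \<subseteq> K" "finite T" "K \<subseteq> (\<Union>t\<in>T. ball t (bdist \<Omega> t / 16))"
    proof (rule compactE_image[of K K "\<lambda>t. ball t (bdist \<Omega> t / 16)"])
      show "K \<subseteq> (\<Union>t\<in>K. ball t (bdist \<Omega> t / 16))" using \<delta> K by force
    qed (use K in auto)
    have "\<exists>c>0. \<forall>t\<in>T. ennreal c \<le> emeasure m (ball t (bdist \<Omega> t / 16) \<inter> \<Omega>)"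
      using T(2,1)
    proof (induction T rule: finite_induct)
      case (insert t T)
      then obtain c where c: "0 < c" "\<forall>t\<in>T. ennreal c \<le> emeasure m (ball t (bdist \<Omega> t / 16) \<inter> \<Omega>)" by auto
      have p: "0 < emeasure m (ball t (bdist \<Omega> t / 16) \<inter> \<Omega>)"
        using insert.prems K \<delta> by (intro pos) auto
      obtain c' where c': "0 < c'" "ennreal c' \<le> emeasure m (ball t (bdist \<Omega> t / 16) \<inter> \<Omega>)"
      proof (cases "emeasure m (ball t (bdist \<Omega> t / 16) \<inter> \<Omega>)")
        case (real a)
        then show ?thesis using p that[of a] by simp
      qed (use that[of 1] in simp)
      have le: "ennreal (min c c') \<le> ennreal c" "ennreal (min c c') \<le> ennreal c'" by (intro ennreal_leI; simp)+
      show ?case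
      proof (intro exI[of _ "min c c'"] conjI ballI)
        fix u assume "u \<in> insert t T"
        then show "ennreal (min c c') \<le> emeasure m (ball u (bdist \<Omega> u / 16) \<inter> \<Omega>)"
          using order.trans[OF le(1)] order.trans[OF le(2)] c(2) c'(2) by blast
      qed (use c c' in simp)
    qed (auto intro: exI[of _ 1])
    then obtain c where c: "0 < c" "\<And>t. t \<in> T \<Longrightarrow> ennreal c \<le> emeasure m (ball t (bdist \<Omega> t / 16) \<inter> \<Omega>)" by blast
    have lower: "ennreal c \<le> emeasure m (ball X (bdist \<Omega> X / 4))" if X: "X \<in> K" for X
    proof -
      obtain t where t: "t \<in> T" "dist t X < bdist \<Omega> t / 16" using T(3) X by auto
      have "bdist \<Omega> t \<le> bdist \<Omega> X + dist t X" by (rule bdist_lipschitz)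
      have "ball t (bdist \<Omega> t / 16) \<inter> \<Omega> \<subseteq> ball X (bdist \<Omega> X / 4)"
      proof
        fix Y assume "Y \<in> ball t (bdist \<Omega> t / 16) \<inter> \<Omega>"
        then show "Y \<in> ball X (bdist \<Omega> X / 4)"
          using t(2) \<open>bdist \<Omega> t \<le> bdist \<Omega> X + dist t X\<close> dist_triangle3[of X Y t] bdist_nonneg[of \<Omega> t] by simp
      qed
      moreover have "ball X (bdist \<Omega> X / 4) \<in> sets m"
      proof -
        have "ball X (bdist \<Omega> X / 4) \<subseteq> ball X (bdist \<Omega> X)" using bdist_nonneg[of \<Omega> X] by (intro subset_ball) simp
        then have "ball X (bdist \<Omega> X / 4) \<subseteq> \<Omega>" using ball_subset_domain[of X \<Omega>] X K by blast
        then show ?thesis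
          using measurable_sets[OF m(3), of "ball X (bdist \<Omega> X / 4)"] m(2) by (simp add: Int_absorb2)
      qed
      ultimately show ?thesis using c(2)[OF t(1)] emeasure_mono order.trans by blast
    qed
    have f_m: "(\<integral>\<^sup>+X\<in>K. ennreal ((norm (f X))\<^sup>2) \<partial>m) < \<infinity>" using f K unfolding L2_loc_def by blast
    have "emeasure (area_measure \<Omega> m f) K \<le> (\<integral>\<^sup>+X. ennreal (1 / c) * (ennreal ((norm (f X))\<^sup>2) * indicator K X) \<partial>m)"
      unfolding em using divide_ennreal_le[OF c(1) lower]
      by (intro nn_integral_mono) (auto simp: area_density_def indicator_def)
    also have "\<dots> = ennreal (1 / c) * (\<integral>\<^sup>+X\<in>K. ennreal ((norm (f X))\<^sup>2) \<partial>m)"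
    proof (rule nn_integral_cmult)
      note [measurable] = L2_loc_borel_measurable[OF w f]
      have [measurable]: "K \<in> sets m"
        using measurable_sets[OF m(3) K_borel] m(2) K by (simp add: Int_absorb2)
      show "(\<lambda>X. ennreal ((norm (f X))\<^sup>2) * indicator K X) \<in> borel_measurable m" by measurable
    qed
    also have "\<dots> < \<infinity>" using f_m by (simp add: ennreal_mult_less_top)
    finally show ?thesis .
  qed
qed

section \<open>Invariance of the Carleson condition\<close>

definition pole_dependent :: "('n::finite) bdry_measure \<Rightarrow> bool" where
  "pole_dependent \<mu> = (case \<mu> of Family _ \<Rightarrow> True | Single _ \<Rightarrow> False)"

definition ambient_family :: "('n::finite) bdry_measure \<Rightarrow> real^'n \<Rightarrow> (real^'n) measure" where
  "ambient_family \<mu> P = ambient (at_pole \<mu> P)"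

lemma poles_iff_admissible: "P \<in> poles \<Omega> \<mu> x r \<longleftrightarrow> admissible (pole_dependent \<mu>) \<Omega> 2 x r P"
  by (cases \<mu>) (auto simp: pole_dependent_def admissible_def not_less)

lemma boundary_borel_measureD:
  assumes "boundary_borel_measure \<Omega> \<sigma>"
  shows "space \<sigma> = frontier \<Omega>" "(\<lambda>x. x) \<in> borel_measurable \<sigma>"
proof -
  have s: "sets \<sigma> = sets (restrict_space borel (frontier \<Omega>))" using assms by (simp add: boundary_borel_measure_def)
  show "space \<sigma> = frontier \<Omega>" using sets_eq_imp_space_eq[OF s] by (simp add: space_restrict_space)
  have "(\<lambda>x. x) \<in> borel_measurable (restrict_space borel (frontier \<Omega>))" by (intro measurable_restrict_space1) simp
  then show "(\<lambda>x. x) \<in> borel_measurable \<sigma>" using measurable_cong_sets[OF s refl] by blast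
qed

lemma at_pole_boundary_measure:
  assumes "elliptic_or_doubling \<Omega> m \<mu>" "pole_dependent \<mu> \<longrightarrow> P \<in> \<Omega>"
  shows "boundary_borel_measure \<Omega> (at_pole \<mu> P)"
  using assms by (cases \<mu>) (auto simp: pole_dependent_def elliptic_measure_of_def doubling_measure_def)

lemma emeasure_ambient_family:
  assumes "elliptic_or_doubling \<Omega> m \<mu>" "pole_dependent \<mu> \<longrightarrow> P \<in> \<Omega>" "A \<in> sets borel"
  shows "emeasure (ambient_family \<mu> P) A = emeasure (at_pole \<mu> P) (A \<inter> frontier \<Omega>)"
    "measure (ambient_family \<mu> P) A = measure (at_pole \<mu> P) (A \<inter> frontier \<Omega>)"
  using boundary_borel_measureD[OF at_pole_boundary_measure[OF assms(1,2)]] assms(3)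
  by (simp_all add: ambient_family_def emeasure_ambient measure_ambient)

text \<open>Needed because positivity of elliptic measure on boundary balls is part of the change of pole formula, which
speaks about Corkscrew points. Existence of a pole outside the ball bounds \<open>r\<close> by the diameter.\<close>

lemma corkscrew_point_exists:
  fixes \<Omega> :: "(real^'n) set"
  assumes ck: "corkscrew_condition \<Omega> c" and \<Omega>: "open \<Omega>" and x: "x \<in> frontier \<Omega>" "0 < r"
    and far: "P \<in> \<Omega>" "r < dist x P"
  obtains X where "corkscrew_point \<Omega> c x r X"
proof -
  have c: "0 < c" using ck by (simp add: corkscrew_condition_def)
  have "r < diameter \<Omega>" if b: "bounded \<Omega>"
  proof -
    have "dist x P \<le> diameter (closure \<Omega>)"
      using x far b closure_subset[of \<Omega>] by (intro diameter_bounded_bound) (auto simp: frontier_def bounded_closure)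
    then show ?thesis using far(2) diameter_closure[OF b] by simp
  qed
  then obtain X where X: "ball X (c * r) \<subseteq> ball x r \<inter> \<Omega>"
    using ck x unfolding corkscrew_condition_def by blast
  have cr: "0 < c * r" using c x by simp
  then have "X \<in> ball X (c * r)" by simp
  then have "X \<in> ball x r \<inter> \<Omega>" using X by blast
  then have XX: "X \<in> \<Omega>" "dist X x < r" by (simp_all add: dist_commute)
  obtain z where z: "z \<in> frontier \<Omega>" "dist X z = bdist \<Omega> X"
    using nearest_boundary_point[of \<Omega> X] x(1) by blast
  have "z \<notin> \<Omega>" using z(1) \<Omega> by (simp add: frontier_def interior_open)
  then have "z \<notin> ball X (c * r)" using X by auto
  then have "c * r \<le> bdist \<Omega> X" using z(2) by simp
  then have "c * r / 100 \<le> bdist \<Omega> X" using cr by simp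
  then have "corkscrew_point \<Omega> c x r X"
    using XX x bdist_le[OF x(1), of X] by (simp add: corkscrew_point_def)
  then show thesis by (rule that)
qed

lemma doubling_familyI:
  assumes "\<And>P. b \<longrightarrow> P \<in> \<Omega> \<Longrightarrow>
        sets (\<nu> P) = sets borel \<and> emeasure (\<nu> P) (- frontier \<Omega>) = 0 \<and> sigma_finite_measure (\<nu> P)"
    and "\<And>x r P. x \<in> frontier \<Omega> \<Longrightarrow> 0 < r \<Longrightarrow> admissible b \<Omega> 3 x r P \<Longrightarrow>
        0 < emeasure (\<nu> P) (ball x r) \<and> emeasure (\<nu> P) (ball x r) < \<infinity> \<and>
        emeasure (\<nu> P) (ball x (2 * r)) \<le> ennreal C * emeasure (\<nu> P) (ball x r)"
  shows "doubling_family b \<Omega> C \<nu>"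
  using assms unfolding doubling_family_def by blast

lemma doubling_family_mono:
  assumes fam: "doubling_family b \<Omega> C \<nu>" and le: "C \<le> C'" "b \<longrightarrow> b'"
  shows "doubling_family b' \<Omega> C' \<nu>"
proof (rule doubling_familyI)
  show "sets (\<nu> P) = sets borel \<and> emeasure (\<nu> P) (- frontier \<Omega>) = 0 \<and> sigma_finite_measure (\<nu> P)"
    if "b' \<longrightarrow> P \<in> \<Omega>" for P
    using fam le that unfolding doubling_family_def by blast
  fix x r P assume x: "x \<in> frontier \<Omega>" "0 < r" and "admissible b' \<Omega> 3 x r P"
  then have "admissible b \<Omega> 3 x r P" using le by (auto simp: admissible_def)
  note * = doubling_family_ball[OF fam x this]
  have "ennreal C * emeasure (\<nu> P) (ball x r) \<le> ennreal C' * emeasure (\<nu> P) (ball x r)"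
    using le by (intro mult_right_mono ennreal_leI) auto
  then show "0 < emeasure (\<nu> P) (ball x r) \<and> emeasure (\<nu> P) (ball x r) < \<infinity> \<and>
        emeasure (\<nu> P) (ball x (2 * r)) \<le> ennreal C' * emeasure (\<nu> P) (ball x r)"
    using * order.trans by blast
qed

text \<open>By uniqueness, any elliptic measure of the operator agrees with the one for which the
estimates of a PDE friendly domain are asserted.\<close>

lemma doubling_family_of_elliptic_or_doubling:
  fixes \<Omega> :: "(real^'n) set"
  assumes pde: "pde_friendly \<Omega> m" and \<mu>: "elliptic_or_doubling \<Omega> m \<mu>" and ne: "frontier \<Omega> \<noteq> {}"
  obtains C where "1 \<le> C" "doubling_family (pole_dependent \<mu>) \<Omega> C (ambient_family \<mu>)"
proof -
  have \<Omega>: "open \<Omega>" using pde by (simp add: pde_friendly_def)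
  have basic: "sets (ambient_family \<mu> P) = sets borel" "emeasure (ambient_family \<mu> P) (- frontier \<Omega>) = 0"
    if "pole_dependent \<mu> \<longrightarrow> P \<in> \<Omega>" for P
    using emeasure_ambient_family(1)[OF \<mu> that, of "- frontier \<Omega>"]
    by (auto simp: ambient_family_def Compl_disjoint2)
  have "\<exists>C. doubling_family (pole_dependent \<mu>) \<Omega> C (ambient_family \<mu>)"
  proof (cases \<mu>)
    case (Family \<omega>)
    then have pd: "pole_dependent \<mu>" by (simp add: pole_dependent_def)
    obtain C\<^sub>L \<A> where L: "0 < C\<^sub>L" "elliptic_matrix \<Omega> C\<^sub>L \<A>" "elliptic_measure_of \<Omega> m \<A> \<omega>"
      using \<mu> Family by auto
    obtain c\<^sub>1 where c: "corkscrew_condition \<Omega> c\<^sub>1" "\<forall>C\<^sub>L>0. \<exists>C>0. \<exists>\<gamma>. 0 < \<gamma> \<and> \<gamma> < 1 \<and>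
           (\<forall>\<A>. elliptic_matrix \<Omega> C\<^sub>L \<A> \<longrightarrow>
              (\<exists>\<omega>. elliptic_measure_of \<Omega> m \<A> \<omega> \<and>
                 (\<forall>\<omega>'. elliptic_measure_of \<Omega> m \<A> \<omega>' \<longrightarrow> (\<forall>X\<in>\<Omega>. \<omega>' X = \<omega> X)) \<and>
                 boundary_doubling \<Omega> C \<omega> \<and> change_of_pole \<Omega> c\<^sub>1 C \<omega> \<and>
                 decay_estimate \<Omega> C \<gamma> \<omega> \<and> green_comparison \<Omega> m c\<^sub>1 C \<A> \<omega>))"
      using pde unfolding pde_friendly_def by blast
    obtain C \<omega>' where C: "0 < C" and \<omega>': "\<And>\<omega>''. elliptic_measure_of \<Omega> m \<A> \<omega>'' \<Longrightarrow> \<forall>X\<in>\<Omega>. \<omega>'' X = \<omega>' X"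
      "boundary_doubling \<Omega> C \<omega>'" "change_of_pole \<Omega> c\<^sub>1 C \<omega>'"
      using c(2) L(1,2) by metis
    have eq: "at_pole \<mu> X = \<omega>' X" if "X \<in> \<Omega>" for X using \<omega>'(1)[OF L(3)] that Family by simp
    have prob: "prob_space (\<omega>' X)" if "X \<in> \<Omega>" for X
    proof -
      have "prob_space (\<omega> X)" using L(3) that unfolding elliptic_measure_of_def by blast
      then show ?thesis using eq[OF that] Family by simp
    qed
    have ball: "emeasure (ambient_family \<mu> P) (ball x r) = ennreal (measure (\<omega>' P) (bball \<Omega> x r))" if P: "P \<in> \<Omega>" for P x r
    proof -
      interpret prob_space "\<omega>' P" by (rule prob[OF P])
      show ?thesis
        using emeasure_ambient_family(1)[OF \<mu>, of P "ball x r"] P eq[OF P]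
        by (simp add: bball_def emeasure_eq_measure)
    qed
    have "doubling_family (pole_dependent \<mu>) \<Omega> C (ambient_family \<mu>)"
    proof (rule doubling_familyI)
      fix P assume P: "pole_dependent \<mu> \<longrightarrow> P \<in> \<Omega>"
      interpret prob_space "at_pole \<mu> P" using prob[of P] eq[of P] P pd by simp
      have id: "(\<lambda>x. x) \<in> borel_measurable (at_pole \<mu> P)"
        by (rule boundary_borel_measureD[OF at_pole_boundary_measure[OF \<mu> P]])
      have "prob_space (ambient_family \<mu> P)"
        unfolding ambient_family_def ambient_def by (rule prob_space_distr[OF id])
      then interpret A: prob_space "ambient_family \<mu> P" .
      show "sets (ambient_family \<mu> P) = sets borel \<and> emeasure (ambient_family \<mu> P) (- frontier \<Omega>) = 0 \<and>
          sigma_finite_measure (ambient_family \<mu> P)"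
        by (intro conjI basic[OF P] A.sigma_finite_measure_axioms)
    next
      fix x r P assume x: "x \<in> frontier \<Omega>" "0 < r" and "admissible (pole_dependent \<mu>) \<Omega> 3 x r P"
      then have P: "P \<in> \<Omega>" "3 * r \<le> dist x P" using pd by (auto simp: admissible_def)
      obtain X where X: "corkscrew_point \<Omega> c\<^sub>1 x r X"
        using corkscrew_point_exists[OF c(1) \<Omega> x P(1)] P(2) x(2) by auto
      have "0 < measure (\<omega>' P) (bball \<Omega> x r)"
        using \<omega>'(3) x X P unfolding change_of_pole_def by auto
      moreover have "measure (\<omega>' P) (bball \<Omega> x (2 * r)) \<le> C * measure (\<omega>' P) (bball \<Omega> x r)"
        using \<omega>'(2) x P unfolding boundary_doubling_def by auto
      ultimately show "0 < emeasure (ambient_family \<mu> P) (ball x r) \<and> emeasure (ambient_family \<mu> P) (ball x r) < \<infinity> \<and>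
          emeasure (ambient_family \<mu> P) (ball x (2 * r)) \<le> ennreal C * emeasure (ambient_family \<mu> P) (ball x r)"
        using C by (simp add: ball[OF P(1)] ennreal_mult[symmetric] ennreal_leI)
    qed
    then show ?thesis by blast
  next
    case (Single \<sigma>)
    then have pd: "\<not> pole_dependent \<mu>" by (simp add: pole_dependent_def)
    have \<sigma>: "doubling_measure \<Omega> \<sigma>" using \<mu> Single by simp
    then obtain C where C: "\<forall>x\<in>frontier \<Omega>. \<forall>r>0. emeasure \<sigma> (bball \<Omega> x (2 * r)) \<le> ennreal C * emeasure \<sigma> (bball \<Omega> x r)"
      unfolding doubling_measure_def by blast
    have pos: "\<forall>x\<in>frontier \<Omega>. \<forall>r>0. 0 < emeasure \<sigma> (bball \<Omega> x r) \<and> emeasure \<sigma> (bball \<Omega> x r) < \<infinity>"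
      using \<sigma> unfolding doubling_measure_def by blast
    have ball: "emeasure (ambient_family \<mu> P) (ball x r) = emeasure \<sigma> (bball \<Omega> x r)" for P x r
      using emeasure_ambient_family(1)[OF \<mu>, of P "ball x r"] pd Single by (simp add: bball_def)
    have "doubling_family (pole_dependent \<mu>) \<Omega> C (ambient_family \<mu>)"
    proof (rule doubling_familyI)
      fix P assume P: "pole_dependent \<mu> \<longrightarrow> P \<in> \<Omega>"
      obtain x where x: "x \<in> frontier \<Omega>" using ne by auto
      have "sigma_finite_measure (ambient_family \<mu> P)"
      proof
        have "\<Union>(range (\<lambda>n. ball x (real (Suc n)))) = UNIV"
        proof -
          have "\<exists>n. dist x y < real (Suc n)" for y using reals_Archimedean2[of "dist x y"] by (metis less_trans lessI of_nat_less_iff)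
          then show ?thesis by auto
        qed
        moreover have "space (ambient_family \<mu> P) = UNIV"
          using sets_eq_imp_space_eq[OF basic(1)[OF P]] by simp
        ultimately show "\<exists>A. countable A \<and> A \<subseteq> sets (ambient_family \<mu> P) \<and> \<Union>A = space (ambient_family \<mu> P) \<and>
            (\<forall>a\<in>A. emeasure (ambient_family \<mu> P) a \<noteq> \<infinity>)"
          using pos x basic(1)[OF P]
          by (intro exI[of _ "range (\<lambda>n. ball x (real (Suc n)))"]) (auto simp: ball less_top)
      qed
      then show "sets (ambient_family \<mu> P) = sets borel \<and> emeasure (ambient_family \<mu> P) (- frontier \<Omega>) = 0 \<and>
          sigma_finite_measure (ambient_family \<mu> P)"
        by (intro conjI basic[OF P])
    qed (use C pos in \<open>simp add: ball\<close>)
    then show ?thesis by blast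
  qed
  then obtain C where "doubling_family (pole_dependent \<mu>) \<Omega> C (ambient_family \<mu>)" by blast
  then show thesis by (intro that[of "max C 1"] doubling_family_mono[OF \<open>doubling_family (pole_dependent \<mu>) \<Omega> C (ambient_family \<mu>)\<close>]) simp_all
qed

lemma KCM_iff_carleson_bound:
  fixes \<Omega> :: "(real^'n) set"
  assumes pde: "pde_friendly \<Omega> m" and \<mu>: "elliptic_or_doubling \<Omega> m \<mu>" and ne: "frontier \<Omega> \<noteq> {}" and f: "f \<in> L2_loc m \<Omega>"
  shows "f \<in> KCM \<Omega> m \<mu> \<longleftrightarrow>
    (\<exists>M\<ge>0. carleson_bound (pole_dependent \<mu>) \<Omega> (area_measure \<Omega> m f) (ambient_family \<mu>) M)"
proof -
  have p: "open \<Omega>" "weighted_measure \<Omega> m" "m_doubling \<Omega> m" using pde by (auto simp: pde_friendly_def)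
  note lf = locally_finite_on_area_measure[OF p(2,3,1) ne f]
  have int: "(\<integral>\<^sup>+y\<in>bball \<Omega> x r. (area_fun \<Omega> m r f y)\<^sup>2 \<partial>at_pole \<mu> P)
      = (\<integral>\<^sup>+y\<in>ball x r. emeasure (area_measure \<Omega> m f) (cone \<Omega> r y) \<partial>ambient_family \<mu> P)"
    and ball: "emeasure (at_pole \<mu> P) (bball \<Omega> x r) = emeasure (ambient_family \<mu> P) (ball x r)"
    if "admissible (pole_dependent \<mu>) \<Omega> 2 x r P" for x r P
  proof -
    have P: "pole_dependent \<mu> \<longrightarrow> P \<in> \<Omega>" using that by (simp add: admissible_def)
    note bm = boundary_borel_measureD[OF at_pole_boundary_measure[OF \<mu> P]]
    show "emeasure (at_pole \<mu> P) (bball \<Omega> x r) = emeasure (ambient_family \<mu> P) (ball x r)"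
      using emeasure_ambient_family(1)[OF \<mu> P, of "ball x r"] by (simp add: bball_def)
    have meas: "(\<lambda>y. emeasure (area_measure \<Omega> m f) (cone \<Omega> r y) * indicator (ball x r) y) \<in> borel_measurable borel"
      by (intro borel_measurable_times_ennreal borel_measurable_indicator borel_measurable_emeasure_cone[OF lf p(1)]) simp
    have "(\<integral>\<^sup>+y\<in>ball x r. emeasure (area_measure \<Omega> m f) (cone \<Omega> r y) \<partial>ambient_family \<mu> P)
       = (\<integral>\<^sup>+y\<in>ball x r. emeasure (area_measure \<Omega> m f) (cone \<Omega> r y) \<partial>at_pole \<mu> P)"
      unfolding ambient_family_def ambient_def by (subst nn_integral_distr[OF bm(2)]) (simp_all add: meas)
    also have "\<dots> = (\<integral>\<^sup>+y\<in>bball \<Omega> x r. (area_fun \<Omega> m r f y)\<^sup>2 \<partial>at_pole \<mu> P)"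
      using bm(1) by (intro nn_integral_cong) (auto simp: area_fun_eq(2)[OF p(2,1) f] bball_def indicator_def)
    finally show "(\<integral>\<^sup>+y\<in>bball \<Omega> x r. (area_fun \<Omega> m r f y)\<^sup>2 \<partial>at_pole \<mu> P)
      = (\<integral>\<^sup>+y\<in>ball x r. emeasure (area_measure \<Omega> m f) (cone \<Omega> r y) \<partial>ambient_family \<mu> P)" ..
  qed
  have "f \<in> KCM \<Omega> m \<mu> \<longleftrightarrow>
    (\<exists>M>0. carleson_bound (pole_dependent \<mu>) \<Omega> (area_measure \<Omega> m f) (ambient_family \<mu>) M)"
    unfolding KCM_def carleson_bound_def mem_Collect_eq Ball_def poles_iff_admissible
    by (intro arg_cong[of _ _ Ex] ext conj_cong all_cong1 imp_cong refl) (simp only: int ball)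
  also have "\<dots> \<longleftrightarrow> (\<exists>M\<ge>0. carleson_bound (pole_dependent \<mu>) \<Omega> (area_measure \<Omega> m f) (ambient_family \<mu>) M)"
  proof
    assume "\<exists>M\<ge>0. carleson_bound (pole_dependent \<mu>) \<Omega> (area_measure \<Omega> m f) (ambient_family \<mu>) M"
    then obtain M where M: "carleson_bound (pole_dependent \<mu>) \<Omega> (area_measure \<Omega> m f) (ambient_family \<mu>) M" by blast
    have "carleson_bound (pole_dependent \<mu>) \<Omega> (area_measure \<Omega> m f) (ambient_family \<mu>) (max M 1)"
      by (rule carleson_bound_mono[OF M]) simp
    then show "\<exists>M>0. carleson_bound (pole_dependent \<mu>) \<Omega> (area_measure \<Omega> m f) (ambient_family \<mu>) M"
      by (intro exI[of _ "max M 1"]) simp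
  qed (auto intro: less_imp_le)
  finally show ?thesis .
qed

lemma A_infinity_small_sets_transfer:
  fixes \<Omega> :: "(real^'n) set"
  assumes \<mu>: "elliptic_or_doubling \<Omega> m \<mu>" "elliptic_or_doubling \<Omega> m \<mu>'" and A: "\<mu>' \<in> A_infinity \<Omega> \<mu>"
    and b: "b \<longleftrightarrow> pole_dependent \<mu> \<or> pole_dependent \<mu>'"
    and fam: "doubling_family b \<Omega> C (ambient_family \<mu>)" "doubling_family b \<Omega> C (ambient_family \<mu>')"
    and \<xi>: "0 < \<xi>"
  obtains \<zeta> where "0 < \<zeta>" "small_sets_transfer b \<Omega> 3 \<zeta> \<xi> (ambient_family \<mu>') (ambient_family \<mu>)"
proof -
  have "\<exists>\<zeta>>0. \<forall>x\<in>frontier \<Omega>. \<forall>r>0. \<forall>X \<in> poles \<Omega> \<mu> x r \<inter> poles \<Omega> \<mu>' x r.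
        \<forall>E\<in>sets borel. E \<subseteq> bball \<Omega> x r \<longrightarrow>
          measure (at_pole \<mu>' X) E / measure (at_pole \<mu>' X) (bball \<Omega> x r) < \<zeta> \<longrightarrow>
          measure (at_pole \<mu> X) E / measure (at_pole \<mu> X) (bball \<Omega> x r) < \<xi>"
    using A \<xi> unfolding A_infinity_def mem_Collect_eq by (elim allE impE)
  then obtain \<zeta> where \<zeta>: "0 < \<zeta>" and A: "\<forall>x\<in>frontier \<Omega>. \<forall>r>0. \<forall>X \<in> poles \<Omega> \<mu> x r \<inter> poles \<Omega> \<mu>' x r.
        \<forall>E\<in>sets borel. E \<subseteq> bball \<Omega> x r \<longrightarrow>
          measure (at_pole \<mu>' X) E / measure (at_pole \<mu>' X) (bball \<Omega> x r) < \<zeta> \<longrightarrow>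
          measure (at_pole \<mu> X) E / measure (at_pole \<mu> X) (bball \<Omega> x r) < \<xi>"
    by (elim exE conjE)
  note A' = A[rule_format]
  have "small_sets_transfer b \<Omega> 3 \<zeta> \<xi> (ambient_family \<mu>') (ambient_family \<mu>)"
    unfolding small_sets_transfer_def
  proof (intro ballI allI impI)
    fix x r P E assume x: "x \<in> frontier \<Omega>" "0 < r" and adm: "admissible b \<Omega> 3 x r P"
      and E: "E \<in> sets borel" "E \<subseteq> ball x r"
        "measure (ambient_family \<mu>' P) E < \<zeta> * measure (ambient_family \<mu>' P) (ball x r)"
    have P: "pole_dependent \<mu> \<longrightarrow> P \<in> \<Omega>" "pole_dependent \<mu>' \<longrightarrow> P \<in> \<Omega>"
      using adm b by (auto simp: admissible_def)
    have poles: "P \<in> poles \<Omega> \<mu> x r \<inter> poles \<Omega> \<mu>' x r"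
      using adm b x by (auto simp: poles_iff_admissible admissible_def)
    note em = emeasure_ambient_family(2)[OF \<mu>(1) P(1)] emeasure_ambient_family(2)[OF \<mu>(2) P(2)]
    have pos: "0 < measure (ambient_family \<mu> P) (ball x r)" "0 < measure (ambient_family \<mu>' P) (ball x r)"
      using doubling_family_ball(1,2)[OF fam(1) x adm] doubling_family_ball(1,2)[OF fam(2) x adm]
      by (simp_all add: emeasure_eq_ennreal_measure less_top)
    have "measure (at_pole \<mu> P) (E \<inter> frontier \<Omega>) / measure (at_pole \<mu> P) (bball \<Omega> x r) < \<xi>"
    proof (rule A'[OF x poles])
      show "E \<inter> frontier \<Omega> \<in> sets borel" "E \<inter> frontier \<Omega> \<subseteq> bball \<Omega> x r"
        using E frontier_borel[of \<Omega>] by (auto simp: bball_def)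
      show "measure (at_pole \<mu>' P) (E \<inter> frontier \<Omega>) / measure (at_pole \<mu>' P) (bball \<Omega> x r) < \<zeta>"
        using E(1,3) pos(2) by (simp add: em bball_def divide_less_eq)
    qed
    then show "measure (ambient_family \<mu> P) E \<le> \<xi> * measure (ambient_family \<mu> P) (ball x r)"
      using E(1) pos(1) by (simp add: em bball_def divide_less_eq)
  qed
  with \<zeta> show thesis by (rule that)
qed

text \<open>The Whitney bound is derived with the poles of the source alone, the transfer with the poles of both
measures; if the target is a single measure, the bound is finally extended to the balls without poles.\<close>

lemma KCM_transfer:
  fixes \<Omega> :: "(real^'n) set"
  assumes pde: "pde_friendly \<Omega> m" and ne: "frontier \<Omega> \<noteq> {}" and f: "f \<in> L2_loc m \<Omega>"
    and \<mu>: "elliptic_or_doubling \<Omega> m \<mu>" "elliptic_or_doubling \<Omega> m \<mu>'" and C: "1 \<le> C"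
    and fam: "doubling_family (pole_dependent \<mu>) \<Omega> C (ambient_family \<mu>)"
      "doubling_family (pole_dependent \<mu>') \<Omega> C (ambient_family \<mu>')"
    and b: "b \<longleftrightarrow> pole_dependent \<mu> \<or> pole_dependent \<mu>'"
    and small: "\<And>\<epsilon>. 0 < \<epsilon> \<Longrightarrow> \<exists>\<eta>>0. small_sets_transfer b \<Omega> 64 \<eta> \<epsilon> (ambient_family \<mu>) (ambient_family \<mu>')"
    and K: "f \<in> KCM \<Omega> m \<mu>"
  shows "f \<in> KCM \<Omega> m \<mu>'"
proof -
  have p: "open \<Omega>" "weighted_measure \<Omega> m" "m_doubling \<Omega> m" using pde by (auto simp: pde_friendly_def)
  define H where "H = area_measure \<Omega> m f"
  have H: "locally_finite_on \<Omega> H" unfolding H_def by (rule locally_finite_on_area_measure[OF p(2,3,1) ne f])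
  then have sets_H: "sets H = sets borel" by (simp add: locally_finite_on_def)
  obtain M where M: "0 \<le> M" "carleson_bound (pole_dependent \<mu>) \<Omega> H (ambient_family \<mu>) M"
    using K unfolding KCM_iff_carleson_bound[OF pde \<mu>(1) ne f] H_def by blast
  have famb: "doubling_family b \<Omega> C (ambient_family \<mu>)" "doubling_family b \<Omega> C (ambient_family \<mu>')"
    using b by (auto intro: doubling_family_mono[OF fam(1)] doubling_family_mono[OF fam(2)])
  have Mb: "carleson_bound b \<Omega> H (ambient_family \<mu>) M"
    using M(2) b unfolding carleson_bound_def admissible_def by blast
  obtain W where W: "0 \<le> W" "\<And>Z. Z \<in> \<Omega> \<Longrightarrow> emeasure H (\<Omega> \<inter> ball Z (bdist \<Omega> Z / 4)) \<le> ennreal W"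
    using whitney_ball_bound[OF fam(1) C p(1) ne H M(2,1)] by blast
  obtain W' where W': "0 \<le> W'" "whitney_bound \<Omega> H (1/1024) W'"
    using whitney_bound_of_balls[OF p(1) sets_H _ W, of "1/1024"] by auto
  obtain M' where M': "carleson_bound b \<Omega> H (ambient_family \<mu>') M'"
    using carleson_transfer[OF famb C p(1) ne H W'(2,1) Mb M(1) small] by blast
  have "\<exists>M''. carleson_bound (pole_dependent \<mu>') \<Omega> H (ambient_family \<mu>') M''"
  proof (cases "b = pole_dependent \<mu>'")
    case True
    then show ?thesis using M' by auto
  next
    case False
    then have pd: "b" "\<not> pole_dependent \<mu>'" using b by auto
    then obtain \<sigma> where "\<mu>' = Single \<sigma>" by (cases \<mu>') (auto simp: pole_dependent_def)
    then have const: "ambient_family \<mu>' P = ambient_family \<mu>' Q" for P Q by (simp add: ambient_family_def)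
    have M'': "carleson_bound True \<Omega> H (ambient_family \<mu>') (max M' 0)"
      using carleson_bound_mono[OF M', of "max M' 0"] pd(1) by simp
    have fam': "doubling_family False \<Omega> C (ambient_family \<mu>')" using fam(2) pd(2) by simp
    show ?thesis
      using carleson_bound_drop_poles[OF fam' C p(1) ne H const M''] pd(2) by auto
  qed
  then obtain M'' where "carleson_bound (pole_dependent \<mu>') \<Omega> H (ambient_family \<mu>') M''" by blast
  then have "carleson_bound (pole_dependent \<mu>') \<Omega> H (ambient_family \<mu>') (max M'' 0)"
    by (rule carleson_bound_mono) simp
  then show ?thesis
    unfolding KCM_iff_carleson_bound[OF pde \<mu>(2) ne f] H_def by (intro exI[of _ "max M'' 0"]) simp
qed

theorem theorem1p29:
  fixes \<Omega> :: "(real^'n) set" and m :: "(real^'n) measure"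
    and \<mu>\<^sub>0 \<mu>\<^sub>1 :: "'n bdry_measure" and f :: "real^'n \<Rightarrow> real"
  assumes "CARD('n) \<ge> 2"
    and "pde_friendly \<Omega> m"
    and "elliptic_or_doubling \<Omega> m \<mu>\<^sub>0"
    and "elliptic_or_doubling \<Omega> m \<mu>\<^sub>1"
    and "\<mu>\<^sub>1 \<in> A_infinity \<Omega> \<mu>\<^sub>0"
    and "f \<in> L2_loc m \<Omega>"
  shows "f \<in> KCM \<Omega> m \<mu>\<^sub>0 \<longleftrightarrow> f \<in> KCM \<Omega> m \<mu>\<^sub>1"
proof (cases "frontier \<Omega> = {}")
  case True
  then show ?thesis by (auto simp: KCM_def intro: exI[of _ 1])
next
  case ne: False
  note pde = assms(2) and el = assms(3,4) and A = assms(5) and f = assms(6)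
  obtain C\<^sub>0 where C\<^sub>0: "1 \<le> C\<^sub>0" "doubling_family (pole_dependent \<mu>\<^sub>0) \<Omega> C\<^sub>0 (ambient_family \<mu>\<^sub>0)"
    using doubling_family_of_elliptic_or_doubling[OF pde el(1) ne] by blast
  obtain C\<^sub>1 where C\<^sub>1: "1 \<le> C\<^sub>1" "doubling_family (pole_dependent \<mu>\<^sub>1) \<Omega> C\<^sub>1 (ambient_family \<mu>\<^sub>1)"
    using doubling_family_of_elliptic_or_doubling[OF pde el(2) ne] by blast
  define C where "C = max C\<^sub>0 C\<^sub>1"
  have C: "1 \<le> C" using C\<^sub>0(1) by (simp add: C_def)
  define b where "b \<longleftrightarrow> pole_dependent \<mu>\<^sub>0 \<or> pole_dependent \<mu>\<^sub>1"
  have fam: "doubling_family (pole_dependent \<mu>\<^sub>0) \<Omega> C (ambient_family \<mu>\<^sub>0)"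
      "doubling_family (pole_dependent \<mu>\<^sub>1) \<Omega> C (ambient_family \<mu>\<^sub>1)"
    by (auto simp: C_def intro: doubling_family_mono[OF C\<^sub>0(2)] doubling_family_mono[OF C\<^sub>1(2)])
  have famb: "doubling_family b \<Omega> C (ambient_family \<mu>\<^sub>0)" "doubling_family b \<Omega> C (ambient_family \<mu>\<^sub>1)"
    by (auto simp: b_def intro: doubling_family_mono[OF fam(1)] doubling_family_mono[OF fam(2)])
  note A_inf = A_infinity_small_sets_transfer[OF el A b_def famb]
  have small\<^sub>1\<^sub>0: "\<exists>\<eta>>0. small_sets_transfer b \<Omega> 64 \<eta> \<epsilon> (ambient_family \<mu>\<^sub>1) (ambient_family \<mu>\<^sub>0)" if "0 < \<epsilon>" for \<epsilon>
  proof -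
    obtain \<zeta> where \<zeta>: "0 < \<zeta>" "small_sets_transfer b \<Omega> 3 \<zeta> \<epsilon> (ambient_family \<mu>\<^sub>1) (ambient_family \<mu>\<^sub>0)"
      using A_inf[OF \<open>0 < \<epsilon>\<close>] by blast
    have "admissible b \<Omega> 3 x r P" if "admissible b \<Omega> 64 x r P" "0 < r" for x r P
      using that by (auto simp: admissible_def)
    then show ?thesis using \<zeta> unfolding small_sets_transfer_def by blast
  qed
  have small\<^sub>0\<^sub>1: "\<exists>\<eta>>0. small_sets_transfer b \<Omega> 64 \<eta> \<epsilon> (ambient_family \<mu>\<^sub>0) (ambient_family \<mu>\<^sub>1)" if "0 < \<epsilon>" for \<epsilon>
  proof -
    obtain \<zeta> where \<zeta>: "0 < \<zeta>" "small_sets_transfer b \<Omega> 3 \<zeta> (1/4) (ambient_family \<mu>\<^sub>1) (ambient_family \<mu>\<^sub>0)"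
      using A_inf[of "1/4"] by auto
    show ?thesis using small_sets_transfer_reverse[OF famb C \<zeta> that] by blast
  qed
  have b': "b \<longleftrightarrow> pole_dependent \<mu>\<^sub>1 \<or> pole_dependent \<mu>\<^sub>0" by (auto simp: b_def)
  show ?thesis
    using KCM_transfer[OF pde ne f el C fam b_def small\<^sub>0\<^sub>1]
      KCM_transfer[OF pde ne f el(2,1) C fam(2,1) b' small\<^sub>1\<^sub>0] by blast
qed

end
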